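(* Let $d\ge 1$, let $(q,r)$ be a non-endpoint Schrödinger admissible pair, and let $N\ge 1$. Let $(\phi^j)_{j\ge1}\subset L^2_x(\mathbf{R}^d)$ and $g_n^j=g_{0,h_n^j,\xi_n^j,x_n^j,t_n^j}$ be the profiles and group elements of an $L^2_x$ linear profile decomposition, as described in the context, of a bounded sequence $(u_n)_{n\ge1}$ in $L^2_x(\mathbf{R}^d)$. If $q\ge r$, then $$\limsup_{n\to\infty}\Big\|\sum_{j=1}^Ne^{it\Delta}g_n^j(\phi^j)\Big\|^r_{L^q_tL^r_x}\le\sum_{j=1}^N\|e^{it\Delta}\phi^j\|^r_{L^q_tL^r_x};$$ if $q\le r$, then $$\limsup_{n\to\infty}\Big\|\sum_{j=1}^Ne^{it\Delta}g_n^j(\phi^j)\Big\|^q_{L^q_tL^r_x}\le\sum_{j=1}^N\|e^{it\Delta}\phi^j\|^q_{L^q_tL^r_x}.$$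
   Context: $e^{it\Delta}$ denotes the free Schrödinger evolution operator (solution operator of $i\partial_tu+\Delta u=0$ on $\mathbf{R}\times\mathbf{R}^d$), acting on the Fourier side by $\widehat{e^{it\Delta}f}(\xi)=e^{-it|\xi|^2}\hat f(\xi)$, where $\hat f(\xi)=\int_{\mathbf{R}^d}e^{-ix\cdot\xi}f(x)\,dx$. $\|f\|_{L^q_tL^r_x}:=\left(\int_{\mathbf{R}}\left(\int_{\mathbf{R}^d}|f(t,x)|^r\,dx\right)^{q/r}dt\right)^{1/q}$, with the usual modifications when $q$ or $r$ is $\infty$; $L^p_{t,x}:=L^p_tL^p_x$. Also $\langle f,g\rangle_{L^2_x}:=\int_{\mathbf{R}^d}f\bar g\,dx$. A pair $(q,r)$ with $q,r\ge 2$ is Schrödinger admissible if $\frac 2q+\frac dr=\frac d2$ and $(q,r,d)\neq(2,\infty,2)$. The endpoint pairs are $(q,r)=(2,\frac{2d}{d-2})$ when $d\ge 3$ and $(q,r)=(4,\infty)$ when $d=1$; all other admissible pairs are called non-endpoint. For $\theta\in\mathbf{R}/2\pi\mathbf{Z}$, $h_0>0$, $\xi_0,x_0\in\mathbf{R}^d$, $t_0\in\mathbf{R}$, the unitary map $g_{\theta,h_0,\xi_0,x_0,t_0}:L^2_x(\mathbf{R}^d)\to L^2_x(\mathbf{R}^d)$ is $$[g_{\theta,h_0,\xi_0,x_0,t_0}\phi](x)=e^{i\theta}e^{ix\cdot\xi_0}\,e^{-it_0\Delta}\Big[\tfrac{1}{h_0^{d/2}}\phi\big(\tfrac{\cdot-x_0}{h_0}\big)\Big](x).$$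 In everything below, $\lim_{n\to\infty}$ is understood as $\limsup_{n\to\infty}$ (applied to the modulus in the case of the complex-valued inner products). Orthogonality: for $j\ne k$, two sequences $(h_n^j,\xi_n^j,x_n^j,t_n^j)_{n\ge1}$ and $(h_n^k,\xi_n^k,x_n^k,t_n^k)_{n\ge1}$ in $(0,\infty)\times\mathbf{R}^d\times\mathbf{R}^d\times\mathbf{R}$ are orthogonal if one of the following holds: - $\lim_{n\to\infty}\left(\frac{h_n^k}{h_n^j}+\frac{h_n^j}{h_n^k}+h_n^j|\xi_n^j-\xi_n^k|\right)=\infty$; - $\lim_{n\to\infty}\left(\frac{|t_n^j-t_n^k|}{(h_n^j)^2}+\left|\frac{x_n^j-x_n^k}{h_n^j}+\frac{t_n^k(\xi_n^k-\xi_n^j)}{h_n^j}\right|\right)=\infty$. Profile decomposition: for a bounded sequence $(u_n)$ in $L^2_x$, after passing to a subsequence, there are $\phi^j\in L^2_x$ and $g_n^j=g_{0,h_n^j,\xi_n^j,x_n^j,t_n^j}$ with (pairwise) orthogonal parameters $(h_n^j,\xi_n^j,x_n^j,t_n^j)$ such that for any $N\ge1$ there is $e_n^N\in L^2_x$ with $u_n=\sum_{j=1}^Ng_n^j(\phi^j)+e_n^N$, and - $\lim_{N\to\infty}\lim_{n\to\infty}\|e^{it\Delta}e_n^N\|_{L^{2+4/d}_{t,x}}=0$; - for any $N\ge1$, $\lim_{n\to\infty}\big(\|u_n\|_{L^2_x}^2-(\sum_{j=1}^N\|\phi^j\|_{L^2_x}^2+\|e_n^N\|_{L^2_x}^2)\big)=0$;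 - for $j\ne k$, $\lim_{n\to\infty}\|e^{it\Delta}g_n^j(\phi^j)\,e^{it\Delta}g_n^k(\phi^k)\|_{L^{1+2/d}_{t,x}}=0$ and $\lim_{n\to\infty}\langle g_n^j(\phi^j),g_n^k(\phi^k)\rangle_{L^2_x}=0$; - for $1\le j\le N$, $\lim_{n\to\infty}\langle g_n^j(\phi^j),e_n^N\rangle_{L^2_x}=0$. The $\phi^j$ and $g_n^j$ in the claim are those of such a decomposition. *)

theory Defs
  imports "HOL-Probability.Essential_Supremum"
begin

section \<open>Lebesgue norms with values in the extended half-line\<close>

text \<open>Intended for positive exponents only.\<close>

definition ennreal_powr :: "ennreal \<Rightarrow> real \<Rightarrow> ennreal"  (infixr "powr\<^sub>e" 80) where
  "x powr\<^sub>e a = (if x = \<infinity> then \<infinity> else ennreal (enn2real x powr a))"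

definition Lp_norm :: "'a measure \<Rightarrow> ennreal \<Rightarrow> ('a \<Rightarrow> ennreal) \<Rightarrow> ennreal" where
  "Lp_norm M p f =
     (if p = \<infinity> then esssup M f
      else (\<integral>\<^sup>+ x. f x powr\<^sub>e enn2real p \<partial>M) powr\<^sub>e (1 / enn2real p))"

text \<open>
  The norm of L^q in time of L^r in space. As the integral is iterated, its value depends only
  on the almost-everywhere class of f(t) for each t; no joint measurability in (t,x) is involved.
\<close>

definition mixed_norm ::
  "ennreal \<Rightarrow> ennreal \<Rightarrow> (real \<Rightarrow> real ^ 'n \<Rightarrow> complex) \<Rightarrow> ennreal" where
  "mixed_norm q r f =
     Lp_norm lborel q (\<lambda>t. Lp_norm lborel r (\<lambda>x. ennreal (cmod (f t x))))"

text \<open>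
  Elements of L^p are represented by Borel functions; every almost-everywhere class of Lebesgue
  measurable functions contains one.
\<close>

definition Lp_space :: "ennreal \<Rightarrow> (real ^ 'n \<Rightarrow> complex) set" where
  "Lp_space p =
     {f. f \<in> borel_measurable lborel \<and> Lp_norm lborel p (\<lambda>x. ennreal (cmod (f x))) < \<infinity>}"

definition L2_norm :: "(real ^ 'n \<Rightarrow> complex) \<Rightarrow> real" where
  "L2_norm f = enn2real (Lp_norm lborel 2 (\<lambda>x. ennreal (cmod (f x))))"

definition L2_inner :: "(real ^ 'n \<Rightarrow> complex) \<Rightarrow> (real ^ 'n \<Rightarrow> complex) \<Rightarrow> complex" where
  "L2_inner f g = (\<integral> x. f x * cnj (g x) \<partial>lborel)"

section \<open>Fourier transform and free Schroedinger evolution\<close>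

definition fourier_integral :: "(real ^ 'n \<Rightarrow> complex) \<Rightarrow> real ^ 'n \<Rightarrow> complex" where
  "fourier_integral f \<xi> = (\<integral> x. cis (- (x \<bullet> \<xi>)) * f x \<partial>lborel)"

text \<open>
  The Fourier transform on L^2 is the continuous extension of the Fourier integral from
  the intersection of L^1 and L^2. As representatives are unique only almost everywhere, it is
  expressed as the relation "F is a Fourier transform of f".
\<close>

definition L2_fourier :: "(real ^ 'n \<Rightarrow> complex) \<Rightarrow> (real ^ 'n \<Rightarrow> complex) \<Rightarrow> bool" where
  "L2_fourier f F \<longleftrightarrow>
     f \<in> Lp_space 2 \<and> F \<in> Lp_space 2 \<and>
     (\<exists>s. (\<forall>k. s k \<in> Lp_space 1 \<inter> Lp_space 2) \<and>
          (\<lambda>k. L2_norm (\<lambda>x. s k x - f x)) \<longlonglongrightarrow> 0 \<and>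
          (\<forall>k. fourier_integral (s k) \<in> Lp_space 2) \<and>
          (\<lambda>k. L2_norm (\<lambda>\<xi>. fourier_integral (s k) \<xi> - F \<xi>)) \<longlonglongrightarrow> 0)"

text \<open>A representative of the evolution at time t, determined up to null sets, for f in L^2.\<close>

definition schroedinger :: "real \<Rightarrow> (real ^ 'n \<Rightarrow> complex) \<Rightarrow> real ^ 'n \<Rightarrow> complex" where
  "schroedinger t f =
     (SOME u. \<exists>F. L2_fourier f F \<and> L2_fourier u (\<lambda>\<xi>. cis (- t * (norm \<xi>)\<^sup>2) * F \<xi>))"

definition admissible :: "'n::finite itself \<Rightarrow> ennreal \<Rightarrow> ennreal \<Rightarrow> bool" where
  "admissible _ q r \<longleftrightarrow>
     2 \<le> q \<and> 2 \<le> r \<and>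
     2 / q + of_nat CARD('n) / r = of_nat CARD('n) / 2 \<and>
     \<not> (q = 2 \<and> r = \<infinity> \<and> CARD('n) = 2)"

definition endpoint :: "'n::finite itself \<Rightarrow> ennreal \<Rightarrow> ennreal \<Rightarrow> bool" where
  "endpoint _ q r \<longleftrightarrow>
     (3 \<le> CARD('n) \<and> q = 2 \<and> r = ennreal (2 * real CARD('n) / (real CARD('n) - 2))) \<or>
     (CARD('n) = 1 \<and> q = 4 \<and> r = \<infinity>)"

section \<open>Linear profile decompositions\<close>

definition sym_group ::
  "real \<Rightarrow> real \<Rightarrow> real ^ 'n \<Rightarrow> real ^ 'n \<Rightarrow> real \<Rightarrow>
    (real ^ 'n \<Rightarrow> complex) \<Rightarrow> real ^ 'n \<Rightarrow> complex" where
  "sym_group \<theta> h0 \<xi>0 x0 t0 \<phi> x =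
     cis \<theta> * cis (x \<bullet> \<xi>0) *
     schroedinger (- t0)
       (\<lambda>y. complex_of_real (1 / h0 powr (real CARD('n) / 2)) * \<phi> ((y - x0) /\<^sub>R h0)) x"

text \<open>
  Limits are read as upper limits, here and below. In particular an infinite limit means
  unboundedness.
\<close>

definition orthogonal_params ::
  "(nat \<Rightarrow> real) \<Rightarrow> (nat \<Rightarrow> real ^ 'n) \<Rightarrow> (nat \<Rightarrow> real ^ 'n) \<Rightarrow> (nat \<Rightarrow> real) \<Rightarrow>
   (nat \<Rightarrow> real) \<Rightarrow> (nat \<Rightarrow> real ^ 'n) \<Rightarrow> (nat \<Rightarrow> real ^ 'n) \<Rightarrow> (nat \<Rightarrow> real) \<Rightarrow> bool" where
  "orthogonal_params hj \<xi>j xj tj hk \<xi>k xk tk \<longleftrightarrow>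
     limsup (\<lambda>n. ereal (hk n / hj n + hj n / hk n + hj n * norm (\<xi>j n - \<xi>k n))) = \<infinity> \<or>
     limsup (\<lambda>n. ereal (\<bar>tj n - tk n\<bar> / (hj n)\<^sup>2 +
        norm ((xj n - xk n) /\<^sub>R hj n + (tk n / hj n) *\<^sub>R (\<xi>k n - \<xi>j n)))) = \<infinity>"

text \<open>
  Profiles, parameters and remainders carry their index j or N, starting from 1, as first
  argument and the index n of the sequence as second or last argument.
\<close>

definition profile_decomposition ::
  "(nat \<Rightarrow> real ^ 'n \<Rightarrow> complex) \<Rightarrow> (nat \<Rightarrow> real ^ 'n \<Rightarrow> complex) \<Rightarrow>
   (nat \<Rightarrow> nat \<Rightarrow> real) \<Rightarrow> (nat \<Rightarrow> nat \<Rightarrow> real ^ 'n) \<Rightarrow> (nat \<Rightarrow> nat \<Rightarrow> real ^ 'n) \<Rightarrow>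
   (nat \<Rightarrow> nat \<Rightarrow> real) \<Rightarrow> bool" where
  "profile_decomposition u \<phi> h \<xi> x t \<longleftrightarrow>
    (let d = real CARD('n);
         g = (\<lambda>j n. sym_group 0 (h j n) (\<xi> j n) (x j n) (t j n) (\<phi> j)) in
     (\<forall>j\<ge>1. \<phi> j \<in> Lp_space 2) \<and>
     (\<forall>j\<ge>1. \<forall>n. 0 < h j n) \<and>
     (\<forall>j\<ge>1. \<forall>k\<ge>1. j \<noteq> k \<longrightarrow>
        orthogonal_params (h j) (\<xi> j) (x j) (t j) (h k) (\<xi> k) (x k) (t k)) \<and>
     (\<forall>j\<ge>1. \<forall>k\<ge>1. j \<noteq> k \<longrightarrow>
        limsup (\<lambda>n. mixed_norm (ennreal (1 + 2 / d)) (ennreal (1 + 2 / d))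
          (\<lambda>s y. schroedinger s (g j n) y * schroedinger s (g k n) y)) = 0 \<and>
        limsup (\<lambda>n. ereal (cmod (L2_inner (g j n) (g k n)))) = 0) \<and>
     (\<exists>e :: nat \<Rightarrow> nat \<Rightarrow> real ^ 'n \<Rightarrow> complex.
        (\<forall>N\<ge>1. \<forall>n. e N n \<in> Lp_space 2 \<and>
           (AE y in lborel. u n y = (\<Sum>j=1..N. g j n y) + e N n y)) \<and>
        limsup (\<lambda>N. limsup (\<lambda>n. mixed_norm (ennreal (2 + 4 / d)) (ennreal (2 + 4 / d))
          (\<lambda>s. schroedinger s (e N n)))) = 0 \<and>
        (\<forall>N\<ge>1. limsup (\<lambda>n. ereal ((L2_norm (u n))\<^sup>2 -
           ((\<Sum>j=1..N. (L2_norm (\<phi> j))\<^sup>2) + (L2_norm (e N n))\<^sup>2))) = 0) \<and>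
        (\<forall>N\<ge>1. \<forall>j\<in>{1..N}. limsup (\<lambda>n. ereal (cmod (L2_inner (g j n) (e N n)))) = 0)))"

end

theory Submission
  imports Defs "HOL-Probability.Characteristic_Functions"
begin

text \<open>
  If one of the norms on the right is infinite there is nothing to prove, so Strichartz estimates
  are not needed. Otherwise the mixed norm, raised to the power \<open>min q r\<close>, is subadditive in
  the r-th power of the modulus, and the r-th power of a sum exceeds the sum of the r-th powers
  (up to a factor close to 1) only by cross terms \<open>|F\<^sub>j F\<^sub>k|\<close> to the power \<open>r/2\<close>.
  By Galilean covariance every \<open>|F\<^sub>j|\<close> is a rescaled and translated copy of a fixed function of
  finite mixed norm, which may be truncated to a bounded function of bounded support; for such
  functions the mixed norm of the product is controlled, uniformly in the parameters, by the
  diagonal norm that the profile decomposition sends to zero. The case \<open>q = \<infinity>\<close>, \<open>r = 2\<close> is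
  unitarity of the evolution together with the asymptotic orthogonality of the profiles.
\<close>

section \<open>Powers of extended reals and the space of square integrable functions\<close>

text \<open>Two obstacles shape the development. The first is that \<open>schroedinger\<close>
  chooses a representative separately at each time, so nothing guarantees measurability in time and
  space jointly, while additivity of iterated integrals and dominated convergence require it. The
  norms, however, see each time slice only up to null sets; so every evolution is exchanged for a
  jointly measurable one, built as an explicit limit of inverse Fourier integrals. This rests on
  Plancherel, inversion and surjectivity for the relation \<open>L2_fourier\<close>. The second is
  that cross terms are known to vanish only at the diagonal exponent P = 1 + 2/d, whereas they are
  needed with exponents q/2 in time and r/2 in space, which may lie on either side of P. Both obey
  the same parabolic scaling, (d - d r/2) q/r = -2 and d - d P = -2, so the comparison can be made
  on a box of unit size: there the small values of a bounded function cost little, and the large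
  ones are controlled by the diagonal norm.\<close>

lemma ennreal_powr_ennreal: "0 \<le> x \<Longrightarrow> ennreal x powr\<^sub>e a = ennreal (x powr a)"
  by (simp add: ennreal_powr_def)

lemma ennreal_powr_top [simp]: "top powr\<^sub>e a = top"
  by (simp add: ennreal_powr_def)

lemma ennreal_powr_0 [simp]: "0 powr\<^sub>e a = 0"
  by (simp add: ennreal_powr_def)

lemma ennreal_powr_1 [simp]: "x powr\<^sub>e 1 = x"
  by (cases x) (auto simp: ennreal_powr_def)

lemma ennreal_powr_mono: "0 \<le> a \<Longrightarrow> x \<le> y \<Longrightarrow> x powr\<^sub>e a \<le> y powr\<^sub>e a"
  by (cases x; cases y) (auto simp: ennreal_powr_ennreal powr_mono2 top_unique)

lemma ennreal_powr_powr: "(x powr\<^sub>e a) powr\<^sub>e b = x powr\<^sub>e (a * b)"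
  by (cases x) (auto simp: ennreal_powr_ennreal powr_powr)

lemma ennreal_powr_eq_0_iff [simp]: "x powr\<^sub>e a = 0 \<longleftrightarrow> x = 0"
  by (cases x) (auto simp: ennreal_powr_ennreal)

lemma ennreal_powr_less_top_iff [simp]: "x powr\<^sub>e a < top \<longleftrightarrow> x < top"
  by (cases x) (auto simp: ennreal_powr_ennreal)

lemma ennreal_powr_mult: "(x * y) powr\<^sub>e a = x powr\<^sub>e a * y powr\<^sub>e a"
proof (cases "x = 0 \<or> y = 0")
  case False
  then show ?thesis
    by (cases x; cases y)
       (auto simp: ennreal_powr_ennreal ennreal_mult'[symmetric] powr_mult ennreal_top_mult ennreal_mult_top)
qed auto

lemma measurable_ennreal_powr [measurable (raw)]:
  assumes [measurable]: "f \<in> borel_measurable M"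
  shows "(\<lambda>x. f x powr\<^sub>e a) \<in> borel_measurable M"
  unfolding ennreal_powr_def by measurable

lemma borel_measurable_cnj [measurable (raw)]:
  assumes "f \<in> borel_measurable M"
  shows "(\<lambda>x. cnj (f x)) \<in> borel_measurable M"
  by (rule measurable_compose[OF assms borel_measurable_continuous_onI]) (intro continuous_intros)

lemma tendsto_ennreal_powr_0:
  assumes "0 < a" "(u \<longlongrightarrow> (0::ennreal)) F"
  shows "((\<lambda>n. u n powr\<^sub>e a) \<longlongrightarrow> 0) F"
proof -
  \<comment> \<open>Below 1 the values are finite, so the convention at infinity in
    \<open>ennreal_powr\<close> drops out and real powers take over.\<close>
  have "eventually (\<lambda>n. u n < 1) F"
    using assms(2) by (rule order_tendstoD) simp
  then have ev: "eventually (\<lambda>n. ennreal (enn2real (u n) powr a) = u n powr\<^sub>e a) F"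
    by eventually_elim (auto simp: ennreal_powr_def)
  have "((\<lambda>n. enn2real (u n)) \<longlongrightarrow> enn2real 0) F"
    using assms(2) by (intro tendsto_enn2real) auto
  then have "((\<lambda>n. enn2real (u n) powr a) \<longlongrightarrow> 0) F"
    using assms(1) by (auto intro!: tendsto_eq_intros tendsto_zero_powrI)
  then have "((\<lambda>n. ennreal (enn2real (u n) powr a)) \<longlongrightarrow> ennreal 0) F"
    by (rule tendsto_ennrealI)
  then show ?thesis
    using ev by (simp add: tendsto_cong)
qed

section \<open>The L^2 seminorm on functions\<close>

lemma Lp_norm_2: "Lp_norm M 2 (\<lambda>x. ennreal (cmod (f x))) =
    (\<integral>\<^sup>+x. ennreal ((cmod (f x))\<^sup>2) \<partial>M) powr\<^sub>e (1/2)"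
  by (simp add: Lp_norm_def ennreal_powr_ennreal powr_numeral)

lemma Lp_space_2_iff: "f \<in> Lp_space 2 \<longleftrightarrow>
    f \<in> borel_measurable lborel \<and> integrable lborel (\<lambda>x. (cmod (f x))\<^sup>2)"
  unfolding Lp_space_def Lp_norm_2 by (auto simp: integrable_iff_bounded)

lemma Lp_space_1_iff: "f \<in> Lp_space 1 \<longleftrightarrow> integrable lborel f"
  by (auto simp: Lp_space_def Lp_norm_def integrable_iff_bounded ennreal_powr_ennreal)

lemma L2_norm_eq_sqrt:
  assumes "f \<in> borel_measurable lborel"
  shows "L2_norm f = sqrt (LBINT x. (cmod (f x))\<^sup>2)"
proof -
  have [measurable]: "f \<in> borel_measurable borel" using assms by simp
  have *: "(LBINT x. (cmod (f x))\<^sup>2) = enn2real (\<integral>\<^sup>+x. ennreal ((cmod (f x))\<^sup>2) \<partial>lborel)"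
    by (rule integral_eq_nn_integral) auto
  show ?thesis
    unfolding L2_norm_def Lp_norm_2 *
    by (cases "\<integral>\<^sup>+x. ennreal ((cmod (f x))\<^sup>2) \<partial>lborel")
       (auto simp: ennreal_powr_ennreal powr_half_sqrt)
qed

lemma Lp_space_2_measurable: "f \<in> Lp_space 2 \<Longrightarrow> f \<in> borel_measurable borel"
  by (simp add: Lp_space_2_iff)

lemma L2_norm_nonneg [simp]: "0 \<le> L2_norm f"
  by (simp add: L2_norm_def)

lemma L2_norm_power2:
  "f \<in> Lp_space 2 \<Longrightarrow> (L2_norm f)\<^sup>2 = (LBINT x. (cmod (f x))\<^sup>2)"
  by (auto simp: Lp_space_2_iff L2_norm_eq_sqrt)

lemma nn_integral_eq_L2_norm:
  assumes "f \<in> Lp_space 2"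
  shows "(\<integral>\<^sup>+x. ennreal ((cmod (f x))\<^sup>2) \<partial>lborel) = ennreal ((L2_norm f)\<^sup>2)"
  using assms unfolding L2_norm_power2[OF assms]
  by (intro nn_integral_eq_integral) (auto simp: Lp_space_2_iff)

lemma Lp_space_2_I:
  assumes "f \<in> borel_measurable borel" "(\<integral>\<^sup>+x. ennreal ((cmod (f x))\<^sup>2) \<partial>lborel) \<le> ennreal C"
  shows "f \<in> Lp_space 2"
  unfolding Lp_space_2_iff integrable_iff_bounded
  using assms le_less_trans[OF assms(2) ennreal_less_top] by simp

lemma L2_norm_le_I:
  assumes "f \<in> borel_measurable borel" "0 \<le> C"
    "(\<integral>\<^sup>+x. ennreal ((cmod (f x))\<^sup>2) \<partial>lborel) \<le> ennreal (C\<^sup>2)"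
  shows "L2_norm f \<le> C"
proof -
  have "f \<in> Lp_space 2" using assms by (intro Lp_space_2_I)
  then have "ennreal ((L2_norm f)\<^sup>2) \<le> ennreal (C\<^sup>2)"
    using assms(3) by (simp add: nn_integral_eq_L2_norm)
  then show ?thesis
    using assms(2) by (auto intro: power2_le_imp_le)
qed

text \<open>Cauchy-Schwarz is applied first to nonnegative integrals, where it presupposes no
  finiteness; integrability of the product is then a consequence. The form with moduli under the
  integral serves the triangle inequality and later an application of Fubini.\<close>

lemma L2_mult:
  assumes "f \<in> Lp_space 2" "g \<in> Lp_space 2"
  shows integrable_L2_mult: "integrable lborel (\<lambda>x. f x * g x)"
    and L2_Cauchy_Schwarz_abs: "(LBINT x. cmod (f x) * cmod (g x)) \<le> L2_norm f * L2_norm g"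
    and L2_Cauchy_Schwarz: "cmod (LBINT x. f x * g x) \<le> L2_norm f * L2_norm g"
proof -
  have [measurable]: "f \<in> borel_measurable borel" "g \<in> borel_measurable borel"
    using assms by (auto simp: Lp_space_2_iff)
  have "(\<integral>\<^sup>+x. ennreal (cmod (f x)) * ennreal (cmod (g x)) \<partial>lborel)\<^sup>2 \<le>
        (\<integral>\<^sup>+x. (ennreal (cmod (f x)))\<^sup>2 \<partial>lborel) * (\<integral>\<^sup>+x. (ennreal (cmod (g x)))\<^sup>2 \<partial>lborel)"
    by (rule Cauchy_Schwarz_nn_integral) auto
  also have "\<dots> = ennreal ((L2_norm f * L2_norm g)\<^sup>2)"
    using assms by (simp add: ennreal_power nn_integral_eq_L2_norm power_mult_distrib ennreal_mult)
  finally have le: "(\<integral>\<^sup>+x. ennreal (cmod (f x) * cmod (g x)) \<partial>lborel)\<^sup>2 \<le> ennreal ((L2_norm f * L2_norm g)\<^sup>2)"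
    by (simp add: ennreal_mult)
  then have le': "(\<integral>\<^sup>+x. ennreal (cmod (f x) * cmod (g x)) \<partial>lborel) \<le> ennreal (L2_norm f * L2_norm g)"
    by (cases "\<integral>\<^sup>+x. ennreal (cmod (f x) * cmod (g x)) \<partial>lborel")
       (auto simp: ennreal_power top_unique dest: power2_le_imp_le)
  then have fin: "(\<integral>\<^sup>+x. ennreal (cmod (f x) * cmod (g x)) \<partial>lborel) < \<infinity>"
    using le_less_trans by fastforce
  then show int: "integrable lborel (\<lambda>x. f x * g x)"
    by (simp add: integrable_iff_bounded norm_mult)
  have int': "integrable lborel (\<lambda>x. cmod (f x) * cmod (g x))"
    using integrable_norm[OF int] by (simp add: norm_mult)
  have "ennreal (LBINT x. cmod (f x) * cmod (g x)) \<le> ennreal (L2_norm f * L2_norm g)"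
    using le' int' by (subst nn_integral_eq_integral[symmetric]) auto
  then show le2: "(LBINT x. cmod (f x) * cmod (g x)) \<le> L2_norm f * L2_norm g"
    by (simp add: ennreal_le_iff)
  have "cmod (LBINT x. f x * g x) \<le> (LBINT x. cmod (f x * g x))"
    by (rule integral_norm_bound)
  then show "cmod (LBINT x. f x * g x) \<le> L2_norm f * L2_norm g"
    using le2 by (simp add: norm_mult)
qed

lemma Lp_space_2_bound:
  assumes "f \<in> Lp_space 2" "g \<in> borel_measurable borel" "\<And>x. cmod (g x) \<le> C * cmod (f x)"
  shows "g \<in> Lp_space 2"
  unfolding Lp_space_2_iff
proof (intro conjI)
  show "integrable lborel (\<lambda>x. (cmod (g x))\<^sup>2)"
  proof (rule Bochner_Integration.integrable_bound)
    show "integrable lborel (\<lambda>x. C\<^sup>2 * (cmod (f x))\<^sup>2)"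
      using assms(1) by (auto simp: Lp_space_2_iff)
    show "AE x in lborel. norm ((cmod (g x))\<^sup>2) \<le> norm (C\<^sup>2 * (cmod (f x))\<^sup>2)"
      using assms(3) by (auto simp: power_mult_distrib[symmetric] intro!: power_mono)
  qed (use assms in measurable)
qed (use assms in simp)

lemma Lp_space_2_cmult [intro]:
  assumes "f \<in> Lp_space 2" shows "(\<lambda>x. c * f x) \<in> Lp_space 2"
  by (rule Lp_space_2_bound[OF assms, where C = "cmod c"])
     (use assms in \<open>auto simp: norm_mult intro!: borel_measurable_times dest: Lp_space_2_measurable\<close>)

lemma Lp_space_2_cnj [intro]:
  assumes "f \<in> Lp_space 2" shows "(\<lambda>x. cnj (f x)) \<in> Lp_space 2"
  by (rule Lp_space_2_bound[OF assms, where C = 1])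
     (use Lp_space_2_measurable[OF assms] in auto)

lemma Lp_space_2_add [intro]:
  assumes "f \<in> Lp_space 2" "g \<in> Lp_space 2"
  shows "(\<lambda>x. f x + g x) \<in> Lp_space 2"
  unfolding Lp_space_2_iff
proof (intro conjI)
  have [measurable]: "f \<in> borel_measurable borel" "g \<in> borel_measurable borel"
    using assms by (auto simp: Lp_space_2_iff)
  show "(\<lambda>x. f x + g x) \<in> borel_measurable lborel" by simp
  show "integrable lborel (\<lambda>x. (cmod (f x + g x))\<^sup>2)"
  proof (rule Bochner_Integration.integrable_bound)
    show "integrable lborel (\<lambda>x. 2 * (cmod (f x))\<^sup>2 + 2 * (cmod (g x))\<^sup>2)"
      using assms by (auto simp: Lp_space_2_iff)
    show "AE x in lborel. norm ((cmod (f x + g x))\<^sup>2) \<le> norm (2 * (cmod (f x))\<^sup>2 + 2 * (cmod (g x))\<^sup>2)"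
    proof (rule AE_I2)
      fix x
      have "(cmod (f x + g x))\<^sup>2 \<le> (cmod (f x) + cmod (g x))\<^sup>2"
        by (intro power_mono norm_triangle_ineq) auto
      also have "\<dots> \<le> 2 * (cmod (f x))\<^sup>2 + 2 * (cmod (g x))\<^sup>2"
        using zero_le_power2[of "cmod (f x) - cmod (g x)"] by (simp add: power2_eq_square algebra_simps)
      finally show "norm ((cmod (f x + g x))\<^sup>2) \<le> norm (2 * (cmod (f x))\<^sup>2 + 2 * (cmod (g x))\<^sup>2)"
        by simp
    qed
  qed measurable
qed

lemma Lp_space_2_diff [intro]:
  assumes "f \<in> Lp_space 2" "g \<in> Lp_space 2"
  shows "(\<lambda>x. f x - g x) \<in> Lp_space 2"
  using Lp_space_2_add[OF assms(1) Lp_space_2_cmult[OF assms(2), of "-1"]] by simp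

lemma Lp_space_2_zero [intro, simp]: "(\<lambda>x. 0) \<in> Lp_space 2"
  by (simp add: Lp_space_2_iff)

lemma Lp_space_2_sum [intro]:
  assumes "\<And>i. i \<in> I \<Longrightarrow> f i \<in> Lp_space 2"
  shows "(\<lambda>x. \<Sum>i\<in>I. f i x) \<in> Lp_space 2"
  using assms by (induction I rule: infinite_finite_induct) auto

lemma L2_norm_triangle:
  assumes "f \<in> Lp_space 2" "g \<in> Lp_space 2"
  shows "L2_norm (\<lambda>x. f x + g x) \<le> L2_norm f + L2_norm g"
proof (rule power2_le_imp_le)
  note int = integrable_norm[OF integrable_L2_mult[OF assms], unfolded norm_mult]
  have "(L2_norm (\<lambda>x. f x + g x))\<^sup>2 = (LBINT x. (cmod (f x + g x))\<^sup>2)"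
    using assms by (intro L2_norm_power2) auto
  also have "\<dots> \<le> (LBINT x. (cmod (f x))\<^sup>2 + 2 * (cmod (f x) * cmod (g x)) + (cmod (g x))\<^sup>2)"
  proof (rule integral_mono)
    show "integrable lborel (\<lambda>x. (cmod (f x + g x))\<^sup>2)"
      using Lp_space_2_add[OF assms] by (simp add: Lp_space_2_iff)
    show "integrable lborel (\<lambda>x. (cmod (f x))\<^sup>2 + 2 * (cmod (f x) * cmod (g x)) + (cmod (g x))\<^sup>2)"
      using assms int by (auto simp: Lp_space_2_iff)
    fix x
    have "(cmod (f x + g x))\<^sup>2 \<le> (cmod (f x) + cmod (g x))\<^sup>2"
      by (intro power_mono norm_triangle_ineq) auto
    then show "(cmod (f x + g x))\<^sup>2 \<le> (cmod (f x))\<^sup>2 + 2 * (cmod (f x) * cmod (g x)) + (cmod (g x))\<^sup>2"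
      by (simp add: power2_eq_square algebra_simps)
  qed
  also have "\<dots> = (L2_norm f)\<^sup>2 + 2 * (LBINT x. cmod (f x) * cmod (g x)) + (L2_norm g)\<^sup>2"
    using assms int by (simp add: L2_norm_power2 Lp_space_2_iff)
  also have "\<dots> \<le> (L2_norm f + L2_norm g)\<^sup>2"
    using L2_Cauchy_Schwarz_abs[OF assms] by (simp add: power2_eq_square algebra_simps)
  finally show "(L2_norm (\<lambda>x. f x + g x))\<^sup>2 \<le> (L2_norm f + L2_norm g)\<^sup>2" .
qed auto

lemma L2_norm_cmult:
  assumes "f \<in> Lp_space 2"
  shows "L2_norm (\<lambda>x. c * f x) = cmod c * L2_norm f"
proof -
  have [measurable]: "f \<in> borel_measurable borel" using assms by (simp add: Lp_space_2_iff)
  show ?thesis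
    by (simp add: L2_norm_eq_sqrt norm_mult power_mult_distrib real_sqrt_mult)
qed

lemma L2_norm_unimodular:
  assumes "f \<in> borel_measurable borel" "g \<in> borel_measurable borel" "\<And>x. cmod (f x) = cmod (g x)"
  shows "L2_norm f = L2_norm g"
  using assms by (simp add: L2_norm_eq_sqrt)

lemma L2_norm_minus_commute:
  "L2_norm (\<lambda>x. f x - g x) = L2_norm (\<lambda>x. g x - f x)"
  by (simp add: L2_norm_def norm_minus_commute)

lemma L2_norm_triangle_diff:
  assumes "f \<in> Lp_space 2" "g \<in> Lp_space 2" "k \<in> Lp_space 2"
  shows "L2_norm (\<lambda>x. f x - k x) \<le> L2_norm (\<lambda>x. f x - g x) + L2_norm (\<lambda>x. g x - k x)"
proof -
  have "(\<lambda>x. f x - k x) = (\<lambda>x. (f x - g x) + (g x - k x))" by auto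
  then show ?thesis
    using L2_norm_triangle[of "\<lambda>x. f x - g x" "\<lambda>x. g x - k x"] assms by auto
qed

lemma L2_norm_diff_abs:
  assumes "f \<in> Lp_space 2" "g \<in> Lp_space 2"
  shows "\<bar>L2_norm f - L2_norm g\<bar> \<le> L2_norm (\<lambda>x. f x - g x)"
  using L2_norm_triangle_diff[OF assms Lp_space_2_zero] L2_norm_triangle_diff[OF assms(2,1) Lp_space_2_zero]
  by (simp add: L2_norm_minus_commute[of g f])

abbreviation L2_tendsto :: "(nat \<Rightarrow> real ^ 'n \<Rightarrow> complex) \<Rightarrow> (real ^ 'n \<Rightarrow> complex) \<Rightarrow> bool" where
  "L2_tendsto s f \<equiv> (\<lambda>k. L2_norm (\<lambda>x. s k x - f x)) \<longlonglongrightarrow> 0"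

lemma L2_norm_tendsto:
  assumes "\<And>k::nat. s k \<in> Lp_space 2" "f \<in> Lp_space 2" "L2_tendsto s f"
  shows "(\<lambda>k. L2_norm (s k)) \<longlonglongrightarrow> L2_norm f"
proof -
  have "(\<lambda>k. L2_norm (s k) - L2_norm f) \<longlonglongrightarrow> 0"
    by (rule Lim_null_comparison[OF _ assms(3)]) (use L2_norm_diff_abs[OF assms(1,2)] in simp)
  then show ?thesis by (simp add: LIM_zero_iff)
qed

lemma L2_norm_cong_AE:
  assumes "f \<in> borel_measurable borel" "g \<in> borel_measurable borel" "AE x in lborel. f x = g x"
  shows "L2_norm f = L2_norm g"
proof -
  have "(LBINT x. (cmod (f x))\<^sup>2) = (LBINT x. (cmod (g x))\<^sup>2)"
    using assms by (intro integral_cong_AE) auto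
  then show ?thesis using assms by (simp add: L2_norm_eq_sqrt)
qed

lemma L2_norm_eq_0_iff:
  assumes "f \<in> Lp_space 2"
  shows "L2_norm f = 0 \<longleftrightarrow> (AE x in lborel. f x = 0)"
proof -
  have "L2_norm f = 0 \<longleftrightarrow> (LBINT x. (cmod (f x))\<^sup>2) = 0"
    using assms by (simp add: L2_norm_eq_sqrt Lp_space_2_iff)
  also have "\<dots> \<longleftrightarrow> (AE x in lborel. f x = 0)"
    using assms by (subst integral_nonneg_eq_0_iff_AE) (auto simp: Lp_space_2_iff)
  finally show ?thesis .
qed

text \<open>The pairing is bilinear rather than Hermitian because the multiplication formula of the
  Fourier transform is; conjugates are inserted by hand where needed. The difference splits as (s -
  f) r + f (r - g).\<close>

lemma L2_bilinear_tendsto: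
  assumes "\<And>k::nat. s k \<in> Lp_space 2" "f \<in> Lp_space 2" "L2_tendsto s f"
    and "\<And>k. r k \<in> Lp_space 2" "g \<in> Lp_space 2" "L2_tendsto r g"
  shows "(\<lambda>k. LBINT x. s k x * r k x) \<longlonglongrightarrow> (LBINT x. f x * g x)"
proof -
  have "(\<lambda>k. (LBINT x. s k x * r k x) - (LBINT x. f x * g x)) \<longlonglongrightarrow> 0"
  proof (rule Lim_null_comparison)
    show "(\<lambda>k. L2_norm (\<lambda>x. s k x - f x) * L2_norm (r k) + L2_norm f * L2_norm (\<lambda>x. r k x - g x)) \<longlonglongrightarrow> 0"
      using tendsto_add[OF tendsto_mult[OF assms(3) L2_norm_tendsto[OF assms(4-6)]]
          tendsto_mult[OF tendsto_const[of "L2_norm f"] assms(6)]] by simp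
    show "\<forall>\<^sub>F k in sequentially. norm ((LBINT x. s k x * r k x) - (LBINT x. f x * g x)) \<le>
        L2_norm (\<lambda>x. s k x - f x) * L2_norm (r k) + L2_norm f * L2_norm (\<lambda>x. r k x - g x)"
    proof (rule always_eventually, rule allI)
      fix k
      have "(LBINT x. s k x * r k x) - (LBINT x. f x * g x) =
          (LBINT x. s k x * r k x - f x * g x)"
        using assms by (intro Bochner_Integration.integral_diff[symmetric] integrable_L2_mult) auto
      also have "\<dots> = (LBINT x. (s k x - f x) * r k x + f x * (r k x - g x))"
        by (intro Bochner_Integration.integral_cong) (auto simp: algebra_simps)
      also have "\<dots> = (LBINT x. (s k x - f x) * r k x) + (LBINT x. f x * (r k x - g x))"
        using assms by (intro Bochner_Integration.integral_add integrable_L2_mult) auto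
      finally show "norm ((LBINT x. s k x * r k x) - (LBINT x. f x * g x)) \<le>
        L2_norm (\<lambda>x. s k x - f x) * L2_norm (r k) + L2_norm f * L2_norm (\<lambda>x. r k x - g x)"
        using L2_Cauchy_Schwarz[of "\<lambda>x. s k x - f x" "r k"] L2_Cauchy_Schwarz[of f "\<lambda>x. r k x - g x"] assms
        by (auto intro!: norm_triangle_mono)
    qed
  qed
  then show ?thesis by (simp add: LIM_zero_iff)
qed

section \<open>The Fourier integral\<close>

lemma affine_substitution:
  fixes f :: "'a::euclidean_space \<Rightarrow> 'b::{banach, second_countable_topology}" and g :: "'a \<Rightarrow> ennreal"
  assumes h: "0 < h"
  shows nn_integral_affine: "g \<in> borel_measurable borel \<Longrightarrow>
      (\<integral>\<^sup>+x. g ((x - c) /\<^sub>R h) \<partial>lborel) = ennreal (h ^ DIM('a)) * (\<integral>\<^sup>+x. g x \<partial>lborel)"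
    and integral_affine: "f \<in> borel_measurable borel \<Longrightarrow>
      (LBINT x. f ((x - c) /\<^sub>R h)) = h ^ DIM('a) *\<^sub>R (LBINT x. f x)"
    and integrable_affine: "integrable lborel f \<Longrightarrow> integrable lborel (\<lambda>x. f ((x - c) /\<^sub>R h))"
    and AE_affine: "AE x in lborel. P x \<Longrightarrow> AE x in lborel. P ((x - c) /\<^sub>R h)"
proof -
  have eq: "lborel = density (distr lborel borel (\<lambda>x. c + h *\<^sub>R x)) (\<lambda>_. ennreal (h ^ DIM('a)))"
    using lborel_affine[of h c] h by simp
  have h0: "h \<noteq> 0" using h by simp
  have sc: "\<And>x. ((c + h *\<^sub>R x) - c) /\<^sub>R h = (x::'a)" using h by simp
  show "(\<integral>\<^sup>+x. g ((x - c) /\<^sub>R h) \<partial>lborel) = ennreal (h ^ DIM('a)) * (\<integral>\<^sup>+x. g x \<partial>lborel)"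
    if [measurable]: "g \<in> borel_measurable borel"
    by (subst eq) (simp add: nn_integral_density nn_integral_distr nn_integral_cmult h0)
  show "(LBINT x. f ((x - c) /\<^sub>R h)) = h ^ DIM('a) *\<^sub>R (LBINT x. f x)"
    if [measurable]: "f \<in> borel_measurable borel"
    using h by (subst eq) (simp add: integral_density integral_distr)
  show "integrable lborel (\<lambda>x. f ((x - c) /\<^sub>R h))" if "integrable lborel f"
  proof -
    have [measurable]: "f \<in> borel_measurable borel" using that by auto
    show ?thesis
      using h that by (subst eq) (simp add: integrable_density integrable_distr_eq)
  qed
  show "AE x in lborel. P ((x - c) /\<^sub>R h)" if P: "AE x in lborel. P x"
  proof -
    \<comment> \<open>The set where \<open>P\<close> fails may be non-measurable, so a Borel null
      set containing it is transported instead.\<close>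
    obtain N where N: "{x. \<not> P x} \<subseteq> N" "N \<in> sets borel" "emeasure lborel N = 0"
      using P by (auto elim!: AE_E)
    have "emeasure lborel ((\<lambda>x. (x - c) /\<^sub>R h) -` N) = (\<integral>\<^sup>+x. indicator N ((x - c) /\<^sub>R h) \<partial>lborel)"
    proof (subst nn_integral_indicator[symmetric])
      show "(\<lambda>x. (x - c) /\<^sub>R h) -` N \<in> sets lborel"
        using measurable_sets[of "\<lambda>x. (x - c) /\<^sub>R h" lborel borel N] N by simp
    qed (auto simp: indicator_def intro!: nn_integral_cong)
    also have "\<dots> = 0"
    proof -
      have [measurable]: "N \<in> sets borel" by fact
      have eqN: "(\<integral>\<^sup>+x. indicator N ((x - c) /\<^sub>R h) \<partial>lborel) = ennreal (h ^ DIM('a)) * emeasure lborel N"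
        by (subst eq) (simp add: nn_integral_density nn_integral_distr nn_integral_cmult h0)
      then show ?thesis using N by simp
    qed
    finally show ?thesis
      using N measurable_sets[of "\<lambda>x. (x - c) /\<^sub>R h" lborel borel N]
      by (intro AE_I[where N = "(\<lambda>x. (x - c) /\<^sub>R h) -` N"]) auto
  qed
qed

lemma borel_measurable_cis [measurable]: "cis \<in> borel_measurable borel"
  by (intro borel_measurable_continuous_onI continuous_on_cis continuous_on_id)

lemma cmod_fourier_integral_le:
  "cmod (fourier_integral f \<xi>) \<le> (LBINT x. cmod (f x))"
  unfolding fourier_integral_def
  using integral_norm_bound[of lborel "\<lambda>x. cis (- (x \<bullet> \<xi>)) * f x"] by (simp add: norm_mult)

lemma borel_measurable_fourier_integral [measurable]:
  assumes [measurable]: "f \<in> borel_measurable borel"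
  shows "fourier_integral f \<in> borel_measurable borel"
  unfolding fourier_integral_def by measurable

lemma integrable_cis_mult [simp]:
  fixes f :: "real ^ 'n \<Rightarrow> complex"
  assumes "integrable lborel f" "g \<in> borel_measurable borel"
  shows "integrable lborel (\<lambda>x. cis (g x) * f x)"
proof -
  have [measurable]: "f \<in> borel_measurable borel" "g \<in> borel_measurable borel" using assms by auto
  show ?thesis
    by (rule Bochner_Integration.integrable_bound[OF assms(1)]) (auto simp: norm_mult)
qed

text \<open>Dilation, translation and modulation are treated at once because the symmetry group
  combines all three. The modulated Gaussians in Plancherel's theorem are the case
  \<open>x0 = 0\<close>.\<close>

lemma fourier_integral_affine:
  fixes f :: "real ^ 'n \<Rightarrow> complex"
  assumes [measurable]: "f \<in> borel_measurable borel" and h: "0 < h"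
  shows "fourier_integral (\<lambda>x. cis (x \<bullet> \<xi>0) * f ((x - x0) /\<^sub>R h)) \<xi> =
    h ^ CARD('n) * cis (- (x0 \<bullet> (\<xi> - \<xi>0))) * fourier_integral f (h *\<^sub>R (\<xi> - \<xi>0))"
proof -
  define F where "F y = cis (- (x0 \<bullet> (\<xi> - \<xi>0))) * (cis (- (y \<bullet> (h *\<^sub>R (\<xi> - \<xi>0)))) * f y)" for y
  have [measurable]: "F \<in> borel_measurable borel" unfolding F_def by measurable
  have "cis (- (x \<bullet> \<xi>)) * (cis (x \<bullet> \<xi>0) * f ((x - x0) /\<^sub>R h)) = F ((x - x0) /\<^sub>R h)" for x
  proof -
    have "x = x0 + h *\<^sub>R ((x - x0) /\<^sub>R h)" using h by simp
    then have "x \<bullet> (\<xi> - \<xi>0) = x0 \<bullet> (\<xi> - \<xi>0) + ((x - x0) /\<^sub>R h) \<bullet> (h *\<^sub>R (\<xi> - \<xi>0))"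
      by (metis inner_add_left inner_scaleR_left inner_scaleR_right)
    then have "- (x \<bullet> \<xi>) + x \<bullet> \<xi>0 = - (x0 \<bullet> (\<xi> - \<xi>0)) + - (((x - x0) /\<^sub>R h) \<bullet> (h *\<^sub>R (\<xi> - \<xi>0)))"
      by (simp only: inner_diff_right)
    then show ?thesis
      unfolding F_def mult.assoc[symmetric] cis_mult by metis
  qed
  then have "fourier_integral (\<lambda>x. cis (x \<bullet> \<xi>0) * f ((x - x0) /\<^sub>R h)) \<xi> = (LBINT x. F ((x - x0) /\<^sub>R h))"
    by (simp add: fourier_integral_def)
  also have "\<dots> = h ^ CARD('n) *\<^sub>R (LBINT x. F x)"
    using integral_affine[OF h, of F x0] by simp
  also have "(LBINT x. F x) = cis (- (x0 \<bullet> (\<xi> - \<xi>0))) * fourier_integral f (h *\<^sub>R (\<xi> - \<xi>0))"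
    unfolding F_def fourier_integral_def by simp
  finally show ?thesis by (simp add: scaleR_conv_of_real)
qed

section \<open>The multiplication formula and the transform of the Gaussian\<close>

lemma lborel_pair_integrable_mult:
  fixes f :: "'a::euclidean_space \<Rightarrow> complex" and g :: "'b::euclidean_space \<Rightarrow> complex"
  assumes f: "integrable lborel f" and g: "integrable lborel g"
  shows "integrable (lborel \<Otimes>\<^sub>M lborel) (\<lambda>(x, y). f x * g y)"
proof -
  have [measurable]: "f \<in> borel_measurable borel" "g \<in> borel_measurable borel" using assms by auto
  show ?thesis
    by (rule lborel_pair.Fubini_integrable) (use f g in \<open>auto simp: norm_mult\<close>)
qed

lemma integral_fourier_integral_mult:
  fixes f g :: "real ^ 'n \<Rightarrow> complex"
  assumes f: "integrable lborel f" and g: "integrable lborel g"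
  shows "(LBINT \<xi>. fourier_integral f \<xi> * g \<xi>) = (LBINT x. f x * fourier_integral g x)"
proof -
  have [measurable]: "f \<in> borel_measurable borel" "g \<in> borel_measurable borel" using assms by auto
  have int: "integrable (lborel \<Otimes>\<^sub>M lborel) (\<lambda>(x, \<xi>). cis (- (x \<bullet> \<xi>)) * f x * g \<xi>)"
    by (rule Bochner_Integration.integrable_bound[OF lborel_pair_integrable_mult[OF f g]])
       (auto simp: norm_mult)
  have "(LBINT \<xi>. fourier_integral f \<xi> * g \<xi>) =
      (LBINT \<xi>. (LBINT x. cis (- (x \<bullet> \<xi>)) * f x * g \<xi>))"
    unfolding fourier_integral_def by simp
  also have "\<dots> = (LBINT x. (LBINT \<xi>. cis (- (x \<bullet> \<xi>)) * f x * g \<xi>))"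
    by (rule lborel_pair.Fubini_integral[OF int])
  also have "\<dots> = (LBINT x. f x * fourier_integral g x)"
  proof (rule Bochner_Integration.integral_cong[OF refl])
    fix x
    have "(LBINT \<xi>. cis (- (x \<bullet> \<xi>)) * f x * g \<xi>) = (LBINT \<xi>. f x * (cis (- (\<xi> \<bullet> x)) * g \<xi>))"
      by (simp add: mult_ac inner_commute)
    then show "(LBINT \<xi>. cis (- (x \<bullet> \<xi>)) * f x * g \<xi>) = f x * fourier_integral g x"
      by (simp add: fourier_integral_def)
  qed
  finally show ?thesis .
qed

text \<open>This is the characteristic function of the standard normal distribution, read at -t; the
  factor sqrt (2 pi) undoes the normalization of the density.\<close>

lemma gaussian_fourier_real:
  "(LBINT x. cis (- (x * t)) * complex_of_real (exp (- x\<^sup>2 / 2))) = complex_of_real (sqrt (2 * pi) * exp (- t\<^sup>2 / 2))"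
proof -
  have "char std_normal_distribution (- t) = complex_of_real (exp (- t\<^sup>2 / 2))"
    by (simp add: char_std_normal_distribution)
  also have "char std_normal_distribution (- t) = (LBINT x. std_normal_density x *\<^sub>R iexp (- t * x))"
    unfolding char_def by (subst integral_density) auto
  also have "\<dots> = (LBINT x. complex_of_real (1 / sqrt (2 * pi)) * (cis (- (x * t)) * complex_of_real (exp (- x\<^sup>2 / 2))))"
    by (intro Bochner_Integration.integral_cong refl)
       (simp add: std_normal_density_def scaleR_conv_of_real cis_conv_exp mult_ac)
  also have "\<dots> = complex_of_real (1 / sqrt (2 * pi)) * (LBINT x. cis (- (x * t)) * complex_of_real (exp (- x\<^sup>2 / 2)))"
    by (rule integral_mult_right_zero)
  finally show ?thesis
    by (simp add: field_simps)
qed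

lemma integrable_gaussian_real: "integrable lborel (\<lambda>x. complex_of_real (exp (- (x::real)\<^sup>2 / 2)))"
proof -
  have "integrable lborel (\<lambda>x. sqrt (2 * pi) * std_normal_density x)"
    by (intro integrable_mult_right) simp
  then have "integrable lborel (\<lambda>x. exp (- (x::real)\<^sup>2 / 2))"
    by (simp add: std_normal_density_def)
  then show ?thesis by (rule integrable_of_real)
qed

definition gaussian :: "real ^ 'n \<Rightarrow> complex" where
  "gaussian x = complex_of_real (exp (- (norm x)\<^sup>2 / 2))"

lemma borel_measurable_gaussian [measurable]: "gaussian \<in> borel_measurable borel"
  unfolding gaussian_def by measurable

text \<open>Both the character and the Gaussian factor over the coordinates, so that integrals over
  the product form of \<open>lborel\<close> reduce to the one-dimensional Gaussian.\<close>

lemma gaussian_prod: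
  fixes \<xi> :: "real ^ 'n"
  defines "x \<equiv> (\<lambda>f. \<Sum>b\<in>Basis. f b *\<^sub>R b :: real ^ 'n)"
  shows "cis (- (x f \<bullet> \<xi>)) * gaussian (x f) =
    (\<Prod>b\<in>Basis. cis (- (f b * (\<xi> \<bullet> b))) * complex_of_real (exp (- (f b)\<^sup>2 / 2)))"
proof -
  have 1: "x f \<bullet> \<xi> = (\<Sum>b\<in>Basis. f b * (\<xi> \<bullet> b))"
    unfolding x_def inner_commute[of _ \<xi>] inner_sum_right by simp
  have "(norm (x f))\<^sup>2 = (\<Sum>b\<in>Basis. (x f \<bullet> b)\<^sup>2)"
    by (subst power2_norm_eq_inner, subst euclidean_inner) (simp add: power2_eq_square)
  also have "\<dots> = (\<Sum>b\<in>Basis. (f b)\<^sup>2)"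
    by (intro sum.cong refl) (simp add: x_def inner_sum_left inner_Basis if_distrib cong: if_cong)
  finally have 2: "(norm (x f))\<^sup>2 = (\<Sum>b\<in>Basis. (f b)\<^sup>2)" .
  show ?thesis
    unfolding gaussian_def 1 2 prod.distrib cis_conv_exp of_real_prod[symmetric]
    by (simp add: exp_sum[symmetric] sum_divide_distrib sum_negf[symmetric] sum_distrib_left flip: exp_of_real)
qed

lemma integrable_gaussian [simp]: "integrable lborel (gaussian :: real ^ 'n \<Rightarrow> complex)"
  and fourier_integral_gaussian:
    "fourier_integral gaussian (\<xi> :: real ^ 'n) = complex_of_real (sqrt (2 * pi) ^ CARD('n)) * gaussian \<xi>"
proof -
  interpret P: product_sigma_finite "\<lambda>b::real^'n. lborel :: real measure" by standard
  define x where "x = (\<lambda>f. \<Sum>b\<in>Basis. f b *\<^sub>R b :: real ^ 'n)"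
  have [measurable]: "x \<in> measurable (Pi\<^sub>M Basis (\<lambda>b. lborel)) borel"
    unfolding x_def by measurable
  have eq: "lborel = distr (Pi\<^sub>M Basis (\<lambda>b. lborel)) borel x"
    unfolding x_def by (rule lborel_eq)
  have int1: "integrable lborel (\<lambda>y. cis (- (y * s)) * complex_of_real (exp (- (y::real)\<^sup>2 / 2)))" for s
    by (rule Bochner_Integration.integrable_bound[OF integrable_gaussian_real]) (auto simp: norm_mult)
  have "integrable lborel (\<lambda>y. cis (- (y \<bullet> \<zeta>)) * gaussian y)" for \<zeta> :: "real ^ 'n"
  proof (subst eq, subst integrable_distr_eq)
    show "integrable (Pi\<^sub>M Basis (\<lambda>b. lborel)) (\<lambda>f. cis (- (x f \<bullet> \<zeta>)) * gaussian (x f))"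
      unfolding x_def gaussian_prod by (rule P.product_integrable_prod) (use int1 in auto)
  qed auto
  from this[of 0] show "integrable lborel (gaussian :: real ^ 'n \<Rightarrow> complex)" by simp
  have "fourier_integral gaussian \<xi> = (\<integral>f. cis (- (x f \<bullet> \<xi>)) * gaussian (x f) \<partial>Pi\<^sub>M Basis (\<lambda>b. lborel))"
    unfolding fourier_integral_def by (subst eq, subst integral_distr) auto
  also have "\<dots> = (\<Prod>b\<in>Basis. complex_of_real (sqrt (2 * pi) * exp (- (\<xi> \<bullet> b)\<^sup>2 / 2)))"
    unfolding x_def gaussian_prod
    by (subst P.product_integral_prod) (use int1 gaussian_fourier_real in auto)
  also have "\<dots> = complex_of_real (sqrt (2 * pi) ^ CARD('n)) * (\<Prod>b\<in>Basis. complex_of_real (exp (- (\<xi> \<bullet> b)\<^sup>2 / 2)))"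
    by (simp add: prod.distrib)
  \<comment> \<open>At frequency 0 the oscillating factors are 1, and the product formula
    reassembles the Gaussian from the coordinates of \<xi>.\<close>
  also have "(\<Prod>b\<in>Basis. complex_of_real (exp (- (\<xi> \<bullet> b)\<^sup>2 / 2))) = gaussian \<xi>"
    using gaussian_prod[of "\<lambda>b. \<xi> \<bullet> b" 0] by (simp add: euclidean_representation)
  finally show "fourier_integral gaussian \<xi> = complex_of_real (sqrt (2 * pi) ^ CARD('n)) * gaussian \<xi>" .
qed

section \<open>Plancherel's theorem for integrable functions\<close>

lemma L2_norm_tendsto_0_dominated:
  fixes s :: "nat \<Rightarrow> real ^ 'n \<Rightarrow> complex"
  assumes [measurable]: "\<And>k. s k \<in> borel_measurable borel"
    and w: "integrable lborel w" and "\<And>k. AE x in lborel. (cmod (s k x))\<^sup>2 \<le> w x"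
    and lim: "AE x in lborel. (\<lambda>k. s k x) \<longlonglongrightarrow> 0"
  shows "(\<lambda>k. L2_norm (s k)) \<longlonglongrightarrow> 0"
proof -
  have "(\<lambda>k. LBINT x. (cmod (s k x))\<^sup>2) \<longlonglongrightarrow> (LBINT (x::real^'n). 0)"
  proof (rule integral_dominated_convergence[OF _ _ w])
    show "AE x in lborel. (\<lambda>k. (cmod (s k x))\<^sup>2) \<longlonglongrightarrow> 0"
      using lim by eventually_elim (auto intro!: tendsto_eq_intros)
    show "AE x in lborel. norm ((cmod (s k x))\<^sup>2) \<le> w x" for k
      using assms(3)[of k] by eventually_elim auto
  qed auto
  then show ?thesis
    by (simp add: L2_norm_eq_sqrt) (metis real_sqrt_zero tendsto_real_sqrt)
qed

lemma L2_truncate_tendsto: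
  assumes f: "f \<in> Lp_space 2"
  shows "(\<lambda>k. L2_norm (\<lambda>x. (if norm x \<le> real k \<and> cmod (f x) \<le> real k then f x else 0) - f x)) \<longlonglongrightarrow> 0"
proof (rule L2_norm_tendsto_0_dominated)
  let ?T = "\<lambda>k x. if norm x \<le> real k \<and> cmod (f x) \<le> real k then f x else 0"
  have [measurable]: "f \<in> borel_measurable borel" using f by (simp add: Lp_space_2_iff)
  show "(\<lambda>x. ?T k x - f x) \<in> borel_measurable borel" for k
    by measurable
  show "integrable lborel (\<lambda>x. (cmod (f x))\<^sup>2)" using f by (simp add: Lp_space_2_iff)
  show "AE x in lborel. (cmod (?T k x - f x))\<^sup>2 \<le> (cmod (f x))\<^sup>2" for k
    by auto
  show "AE x in lborel. (\<lambda>k. ?T k x - f x) \<longlonglongrightarrow> 0"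
  proof (rule AE_I2, rule tendsto_eventually)
    fix x
    show "\<forall>\<^sub>F k in sequentially. ?T k x - f x = 0"
      using eventually_ge_at_top[of "nat \<lceil>norm x + cmod (f x)\<rceil>"]
    proof eventually_elim
      case (elim k)
      then have "norm x + cmod (f x) \<le> real k" by linarith
      then have "norm x \<le> real k \<and> cmod (f x) \<le> real k"
        using norm_ge_zero[of x] norm_ge_zero[of "f x"] by linarith
      then show ?case by simp
    qed
  qed
qed

lemma integrable_const_cball: "integrable lborel (\<lambda>x::'a::euclidean_space. C * indicator (cball 0 R) x :: real)"
  by (intro integrable_mult_right integrable_real_indicator) (simp_all add: emeasure_lborel_cball_finite[unfolded infinity_ennreal_def])

lemma Lp_space_bounded_support:
  assumes [measurable]: "f \<in> borel_measurable borel"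
    and "\<And>x. cmod (f x) \<le> C" "\<And>x. R < norm x \<Longrightarrow> f x = 0"
  shows "f \<in> Lp_space 1 \<inter> Lp_space 2"
proof
  have C: "0 \<le> C" using assms(2)[of 0] norm_ge_zero order_trans by blast
  show "f \<in> Lp_space 1"
    unfolding Lp_space_1_iff
    by (rule Bochner_Integration.integrable_bound[OF integrable_const_cball[of C R]])
       (use assms C in \<open>auto simp: indicator_def not_le\<close>)
  show "f \<in> Lp_space 2"
    unfolding Lp_space_2_iff
  proof
    show "integrable lborel (\<lambda>x. (cmod (f x))\<^sup>2)"
      by (rule Bochner_Integration.integrable_bound[OF integrable_const_cball[of "C\<^sup>2" R]])
         (use assms C in \<open>auto simp: indicator_def not_le intro!: power_mono\<close>)
  qed simp
qed

text \<open>Measurability supplies continuous functions converging almost everywhere to a truncation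
  of f, but without any bounds. Clipping their values at modulus k and cutting them off near the
  ball of radius k restores a dominating function, and does not disturb the limit, which obeys both
  bounds already.\<close>

lemma L2_dense_continuous:
  fixes f :: "real ^ 'n \<Rightarrow> complex"
  assumes f: "f \<in> Lp_space 2" and e: "0 < e"
  obtains g B R where "continuous_on UNIV g" "\<And>x. cmod (g x) \<le> B" "\<And>x. R < norm x \<Longrightarrow> g x = 0"
    "L2_norm (\<lambda>x. g x - f x) < e"
proof -
  have [measurable]: "f \<in> borel_measurable borel" using f by (simp add: Lp_space_2_iff)
  define F where "F k x = (if norm x \<le> real k \<and> cmod (f x) \<le> real k then f x else 0)" for k x
  have "L2_tendsto F f"
    unfolding F_def by (rule L2_truncate_tendsto[OF f])
  from order_tendstoD(2)[OF this, of "e / 2"]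
  obtain k0 where k0: "\<And>k. k \<ge> k0 \<Longrightarrow> L2_norm (\<lambda>x. F k x - f x) < e / 2"
    using e unfolding eventually_sequentially by (metis half_gt_zero)
  \<comment> \<open>The successor makes k positive, as \<open>clip\<close> divides by it.\<close>
  define k where "k = Suc k0"
  have k: "L2_norm (\<lambda>x. F k x - f x) < e / 2" "0 < real k"
    using k0[of k] by (auto simp: k_def)
  have Fk[measurable]: "F k \<in> borel_measurable borel" unfolding F_def by measurable
  have Fb: "cmod (F k x) \<le> real k" "norm x > real k \<Longrightarrow> F k x = 0" for x by (auto simp: F_def)
  have F2: "F k \<in> Lp_space 2" using Lp_space_bounded_support[OF Fk Fb] by auto
  have "F k \<in> borel_measurable lebesgue"
    using Fk by (simp add: measurable_completion)
  then have "F k measurable_on UNIV"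
    by (rule lebesgue_measurable_imp_measurable_on) simp
  then obtain N g where N: "negligible N" and g: "\<And>n. continuous_on UNIV (g n)"
      "\<And>x. x \<notin> N \<Longrightarrow> (\<lambda>n. g n x) \<longlonglongrightarrow> F k x"
    unfolding measurable_on_def by auto
  define clip where "clip z = z / complex_of_real (max 1 (cmod z / real k))" for z
  define cut where "cut x = max 0 (min 1 (real k + 1 - norm x))" for x :: "real ^ 'n"
  define s where "s n x = complex_of_real (cut x) * clip (g n x)" for n x
  have clip_cont: "continuous_on UNIV clip"
    unfolding clip_def by (intro continuous_intros) (use k(2) in \<open>auto simp: max_def split: if_splits\<close>)
  have clip_le: "cmod (clip z) \<le> real k" for z
    using k(2) by (auto simp: clip_def norm_divide max_def divide_simps split: if_splits)
  have clip_id: "clip z = z" if "cmod z \<le> real k" for z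
    using that k(2) by (simp add: clip_def max_def)
  have cont: "continuous_on UNIV (s n)" for n
    unfolding s_def cut_def using g(1)[of n]
    by (intro continuous_intros continuous_on_compose2[OF clip_cont]) auto
  have s_le: "cmod (s n x) \<le> real k" for n x
  proof -
    have "0 \<le> cut x" "cut x \<le> 1" by (auto simp: cut_def)
    then have "cmod (s n x) \<le> 1 * cmod (clip (g n x))"
      unfolding s_def norm_mult by (intro mult_right_mono) auto
    then show ?thesis using clip_le[of "g n x"] by simp
  qed
  have s_0: "s n x = 0" if "real k + 1 < norm x" for n x
    using that by (simp add: s_def cut_def)
  have [measurable]: "s n \<in> borel_measurable borel" for n
    by (intro borel_measurable_continuous_onI cont)
  have "(\<lambda>n. L2_norm (\<lambda>x. s n x - F k x)) \<longlonglongrightarrow> 0"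
  proof (rule L2_norm_tendsto_0_dominated)
    show "integrable lborel (\<lambda>x::real^'n. (2 * real k)\<^sup>2 * indicator (cball 0 (real k + 1)) x)"
      by (rule integrable_const_cball)
    show "AE x in lborel. (cmod (s n x - F k x))\<^sup>2 \<le> (2 * real k)\<^sup>2 * indicator (cball 0 (real k + 1)) x" for n
    proof (rule AE_I2)
      fix x
      show "(cmod (s n x - F k x))\<^sup>2 \<le> (2 * real k)\<^sup>2 * indicator (cball 0 (real k + 1)) x"
      proof (cases "norm x \<le> real k + 1")
        case True
        have "cmod (s n x - F k x) \<le> 2 * real k"
          using norm_triangle_ineq4[of "s n x" "F k x"] s_le[of n x] Fb(1)[of x] by linarith
        from power_mono[OF this norm_ge_zero, of 2] show ?thesis using True by simp
      next
        case False
        then show ?thesis using s_0[of x n] Fb(2)[of x] by auto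
      qed
    qed
    have "AE x in lebesgue. x \<notin> N"
      using N by (simp add: negligible_iff_null_sets AE_not_in)
    then have "AE x in lborel. x \<notin> N" by (simp add: AE_completion_iff)
    then show "AE x in lborel. (\<lambda>n. s n x - F k x) \<longlonglongrightarrow> 0"
    proof eventually_elim
      fix x assume "x \<notin> N"
      have "isCont clip (F k x)" using clip_cont by (simp add: continuous_on_eq_continuous_at)
      from isCont_tendsto_compose[OF this g(2)[OF \<open>x \<notin> N\<close>]]
      have "(\<lambda>n. clip (g n x)) \<longlonglongrightarrow> F k x" using clip_id[OF Fb(1)] by simp
      then have "(\<lambda>n. s n x) \<longlonglongrightarrow> complex_of_real (cut x) * F k x"
        unfolding s_def by (intro tendsto_intros)
      \<comment> \<open>Outside the ball of radius k the function F k vanishes; inside, the cutoff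
        equals 1.\<close>
      moreover have "complex_of_real (cut x) * F k x = F k x"
        by (auto simp: F_def cut_def)
      ultimately show "(\<lambda>n. s n x - F k x) \<longlonglongrightarrow> 0" by (simp add: LIM_zero_iff)
    qed
  qed measurable
  from order_tendstoD(2)[OF this, of "e / 2"]
  obtain n where n: "L2_norm (\<lambda>x. s n x - F k x) < e / 2"
    using e unfolding eventually_sequentially by (metis half_gt_zero order_refl)
  have "s n \<in> Lp_space 2" using Lp_space_bounded_support[of "s n", OF _ s_le s_0] by auto
  then have "L2_norm (\<lambda>x. s n x - f x) < e"
    using L2_norm_triangle_diff[of "s n" "F k" f] n k(1) f F2 by auto
  then show ?thesis using cont s_le s_0 that by blast
qed

lemma L2_translate:
  assumes "f \<in> Lp_space 2"
  shows Lp_space_2_translate: "(\<lambda>x. f (x + z)) \<in> Lp_space 2"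
    and L2_norm_translate: "L2_norm (\<lambda>x. f (x + z)) = L2_norm f"
proof -
  have [measurable]: "f \<in> borel_measurable borel" using assms by (simp add: Lp_space_2_iff)
  have "integrable lborel (\<lambda>x. (cmod (f (x + z)))\<^sup>2)"
    using integrable_affine[of 1 "\<lambda>x. (cmod (f x))\<^sup>2" "-z"] assms by (simp add: Lp_space_2_iff)
  then show "(\<lambda>x. f (x + z)) \<in> Lp_space 2" by (simp add: Lp_space_2_iff)
  show "L2_norm (\<lambda>x. f (x + z)) = L2_norm f"
    using integral_affine[of 1 "\<lambda>x. (cmod (f x))\<^sup>2" "-z"] by (simp add: L2_norm_eq_sqrt)
qed

text \<open>For continuous functions of bounded support this is dominated convergence; translation
  invariance of the norm carries it over to every f that they approximate.\<close>

lemma L2_translation_continuous: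
  fixes f :: "real ^ 'n \<Rightarrow> complex"
  assumes f: "f \<in> Lp_space 2" and z: "z \<longlonglongrightarrow> 0"
  shows "(\<lambda>k. L2_norm (\<lambda>x. f (x + z k) - f x)) \<longlonglongrightarrow> 0"
proof (rule LIMSEQ_I)
  fix e :: real assume "0 < e"
  then have e3: "0 < e / 3" by simp
  obtain g B R where g: "continuous_on UNIV g" "\<And>x. cmod (g x) \<le> B" "\<And>x. R < norm x \<Longrightarrow> g x = 0"
    "L2_norm (\<lambda>x. g x - f x) < e / 3"
    using L2_dense_continuous[OF f e3] by blast
  have [measurable]: "g \<in> borel_measurable borel" using g(1) by (rule borel_measurable_continuous_onI)
  have g2: "g \<in> Lp_space 2" using Lp_space_bounded_support[of g, OF _ g(2,3)] by auto
  \<comment> \<open>Convergent shifts are bounded, so all translates of g live in one ball and share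
    a dominating function.\<close>
  obtain Z where Z: "\<And>k. norm (z k) \<le> Z"
    using convergent_imp_Bseq[of z] z by (auto simp: convergent_def Bseq_def)
  have B: "0 \<le> B" using g(2)[of 0] norm_ge_zero order_trans by blast
  have Z0: "0 \<le> Z" using Z[of 0] norm_ge_zero order_trans by blast
  have "(\<lambda>k. L2_norm (\<lambda>x. g (x + z k) - g x)) \<longlonglongrightarrow> 0"
  proof (rule L2_norm_tendsto_0_dominated)
    show "integrable lborel (\<lambda>x::real^'n. (2 * B)\<^sup>2 * indicator (cball 0 (R + Z)) x)"
      by (rule integrable_const_cball)
    show "AE x in lborel. (cmod (g (x + z k) - g x))\<^sup>2 \<le> (2 * B)\<^sup>2 * indicator (cball 0 (R + Z)) x" for k
    proof (rule AE_I2)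
      fix x
      show "(cmod (g (x + z k) - g x))\<^sup>2 \<le> (2 * B)\<^sup>2 * indicator (cball 0 (R + Z)) x"
      proof (cases "norm x \<le> R + Z")
        case True
        have "cmod (g (x + z k) - g x) \<le> 2 * B"
          using norm_triangle_ineq4[of "g (x + z k)" "g x"] g(2)[of x] g(2)[of "x + z k"] by linarith
        from power_mono[OF this norm_ge_zero, of 2] show ?thesis using True by simp
      next
        case False
        have "norm x \<le> norm (x + z k) + norm (z k)"
          using norm_triangle_ineq4[of "x + z k" "z k"] by simp
        then have "R < norm (x + z k)" "R < norm x" using False Z[of k] Z0 by auto
        then show ?thesis using g(3) by auto
      qed
    qed
    show "AE x in lborel. (\<lambda>k. g (x + z k) - g x) \<longlonglongrightarrow> 0"
    proof (rule AE_I2)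
      fix x
      have "isCont g x" using g(1) by (simp add: continuous_on_eq_continuous_at)
      moreover have "(\<lambda>k. x + z k) \<longlonglongrightarrow> x" using tendsto_add[OF tendsto_const[of x] z] by simp
      ultimately have "(\<lambda>k. g (x + z k)) \<longlonglongrightarrow> g x" by (rule isCont_tendsto_compose)
      then show "(\<lambda>k. g (x + z k) - g x) \<longlonglongrightarrow> 0" by (simp add: LIM_zero_iff)
    qed
  qed measurable
  then have "eventually (\<lambda>k. L2_norm (\<lambda>x. g (x + z k) - g x) < e / 3) sequentially"
    using e3 by (rule order_tendstoD)
  then have "eventually (\<lambda>k. L2_norm (\<lambda>x. f (x + z k) - f x) < e) sequentially"
  proof eventually_elim
    fix k assume k: "L2_norm (\<lambda>x. g (x + z k) - g x) < e / 3"
    note tr = Lp_space_2_translate[OF f, of "z k"] Lp_space_2_translate[OF g2, of "z k"]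
    have "L2_norm (\<lambda>x. f (x + z k) - f x) \<le> L2_norm (\<lambda>x. f (x + z k) - g (x + z k)) + L2_norm (\<lambda>x. g (x + z k) - f x)"
      by (rule L2_norm_triangle_diff) (use tr f in auto)
    moreover have "L2_norm (\<lambda>x. g (x + z k) - f x) \<le> L2_norm (\<lambda>x. g (x + z k) - g x) + L2_norm (\<lambda>x. g x - f x)"
      by (rule L2_norm_triangle_diff) (use tr f g2 in auto)
    moreover have "L2_norm (\<lambda>x. f (x + z k) - g (x + z k)) = L2_norm (\<lambda>x. g x - f x)"
      using L2_norm_translate[of "\<lambda>x. g x - f x" "z k"] f g2 by (subst L2_norm_minus_commute) auto
    ultimately show "L2_norm (\<lambda>x. f (x + z k) - f x) < e" using g(4) k by linarith
  qed
  then show "\<exists>no. \<forall>k\<ge>no. norm (L2_norm (\<lambda>x. f (x + z k) - f x) - 0) < e"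
    by (auto simp: eventually_sequentially)
qed

section \<open>Plancherel by Gaussian damping\<close>

lemma integral_gaussian: "(LBINT (x::real^'n). gaussian x) = complex_of_real (sqrt (2 * pi) ^ CARD('n))"
  using fourier_integral_gaussian[where \<xi> = "0 :: real^'n"] by (simp add: fourier_integral_def gaussian_def)

text \<open>
  The multiplication formula is used twice, first to move one transform onto the damped conjugate
  of the other, then to compute the latter; only the Gaussian is ever transformed explicitly.
\<close>

lemma gaussian_damped_power:
  fixes f :: "real ^ 'n \<Rightarrow> complex"
  assumes f1: "integrable lborel f" and f2: "f \<in> Lp_space 2" and \<epsilon>: "0 < \<epsilon>"
  shows "(LBINT \<xi>. fourier_integral f \<xi> * (cnj (fourier_integral f \<xi>) * gaussian (\<epsilon> *\<^sub>R \<xi>))) =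
    complex_of_real (sqrt (2 * pi) ^ CARD('n)) * (LBINT w. gaussian w * (LBINT x. f x * cnj (f (x + \<epsilon> *\<^sub>R w))))"
proof -
  define K where "K = complex_of_real (sqrt (2 * pi) ^ CARD('n))"
  have [measurable]: "f \<in> borel_measurable borel" using f1 by auto
  define C where "C = (LBINT x. cmod (f x))"
  have C: "cmod (fourier_integral f \<xi>) \<le> C" for \<xi> unfolding C_def by (rule cmod_fourier_integral_le)
  have C0: "0 \<le> C" by (simp add: C_def)
  define G where "G \<xi> = gaussian (\<epsilon> *\<^sub>R \<xi>)" for \<xi> :: "real ^ 'n"
  have [measurable]: "G \<in> borel_measurable borel" unfolding G_def by measurable
  have intG: "integrable lborel G"
    using integrable_affine[of "1 / \<epsilon>" gaussian 0] \<epsilon> by (simp add: G_def[abs_def])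
  have int: "integrable lborel (\<lambda>\<xi>. cnj (fourier_integral f \<xi>) * G \<xi>)"
    by (rule Bochner_Integration.integrable_bound[of _ "\<lambda>\<xi>. C * cmod (G \<xi>)"])
       (use intG C C0 in \<open>auto simp: norm_mult intro!: mult_right_mono\<close>)
  \<comment> \<open>The transform of a wide modulated Gaussian is a bump of width \<epsilon> centred
    at x; integrating f against it averages f near x.\<close>
  have FG: "fourier_integral (\<lambda>\<xi>. cis (\<xi> \<bullet> x) * G \<xi>) y = (1 / \<epsilon>) ^ CARD('n) * (K * gaussian ((y - x) /\<^sub>R \<epsilon>))" for x y
    using fourier_integral_affine[of gaussian "1 / \<epsilon>" x 0 y] \<epsilon>
    by (simp add: G_def[abs_def] fourier_integral_gaussian K_def divide_inverse)
  have inner: "fourier_integral (\<lambda>\<xi>. cnj (fourier_integral f \<xi>) * G \<xi>) x =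
      K * (LBINT w. cnj (f (x + \<epsilon> *\<^sub>R w)) * gaussian w)" for x
  proof -
    define H where "H w = f (x + \<epsilon> *\<^sub>R w) * gaussian w" for w
    have [measurable]: "H \<in> borel_measurable borel" unfolding H_def by measurable
    have "fourier_integral (\<lambda>\<xi>. cnj (fourier_integral f \<xi>) * G \<xi>) x =
        (LBINT \<xi>. cnj (fourier_integral f \<xi> * (cis (\<xi> \<bullet> x) * G \<xi>)))"
      unfolding fourier_integral_def[of "\<lambda>\<xi>. cnj (fourier_integral f \<xi>) * G \<xi>"]
      by (intro Bochner_Integration.integral_cong refl) (simp add: cis_cnj G_def gaussian_def)
    also have "\<dots> = cnj (LBINT \<xi>. fourier_integral f \<xi> * (cis (\<xi> \<bullet> x) * G \<xi>))"
      by (rule Bochner_Integration.integral_cnj)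
    also have "(LBINT \<xi>. fourier_integral f \<xi> * (cis (\<xi> \<bullet> x) * G \<xi>)) =
        (LBINT y. f y * fourier_integral (\<lambda>\<xi>. cis (\<xi> \<bullet> x) * G \<xi>) y)"
      by (rule integral_fourier_integral_mult[OF f1]) (use intG in simp)
    also have "\<dots> = (LBINT y. ((1 / \<epsilon>) ^ CARD('n) * K) * H ((y - x) /\<^sub>R \<epsilon>))"
      using \<epsilon> by (intro Bochner_Integration.integral_cong refl) (simp add: FG H_def)
    also have "\<dots> = ((1 / \<epsilon>) ^ CARD('n) * K) * (LBINT y. H ((y - x) /\<^sub>R \<epsilon>))"
      by (rule integral_mult_right_zero)
    also have "(LBINT y. H ((y - x) /\<^sub>R \<epsilon>)) = \<epsilon> ^ CARD('n) *\<^sub>R (LBINT w. H w)"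
      using integral_affine[OF \<epsilon>, of H x] by simp
    finally have "fourier_integral (\<lambda>\<xi>. cnj (fourier_integral f \<xi>) * G \<xi>) x = cnj (K * (LBINT w. H w))"
      using \<epsilon> by (simp add: scaleR_conv_of_real power_divide)
    also have "\<dots> = K * (LBINT w. cnj (H w))" by (simp add: K_def)
    finally show ?thesis by (simp add: H_def gaussian_def)
  qed
  let ?E = "\<lambda>w x. K * (f x * (cnj (f (x + \<epsilon> *\<^sub>R w)) * gaussian w))"
  \<comment> \<open>Integrability on the product: for fixed w, Cauchy-Schwarz in x gives a bound by
    the square of the norm of f, uniformly in w, and the Gaussian makes this integrable in
    w.\<close>
  have int2: "integrable (lborel \<Otimes>\<^sub>M lborel) (\<lambda>(w, x). ?E w x)"
  proof (rule lborel_pair.Fubini_integrable)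
    show "(\<lambda>(w, x). ?E w x) \<in> borel_measurable (lborel \<Otimes>\<^sub>M lborel)"
      by measurable
    have ff: "integrable lborel (\<lambda>x. f x * cnj (f (x + \<epsilon> *\<^sub>R w)))" for w
      using f2 Lp_space_2_translate[OF f2] by (intro integrable_L2_mult) auto
    show "AE w in lborel. integrable lborel (\<lambda>x. case (w, x) of (w, x) \<Rightarrow> ?E w x)"
    proof (rule AE_I2)
      fix w
      show "integrable lborel (\<lambda>x. case (w, x) of (w, x) \<Rightarrow> ?E w x)"
        using integrable_mult_right[OF integrable_mult_left[OF ff[of w], of "gaussian w"], of K] by (simp add: mult_ac)
    qed
    show "integrable lborel (\<lambda>w. LBINT x. norm (case (w, x) of (w, x) \<Rightarrow> ?E w x))"
    proof (rule Bochner_Integration.integrable_bound)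
      show "integrable lborel (\<lambda>w. cmod K * (L2_norm f * L2_norm f) * cmod (gaussian w :: complex))"
        by (intro integrable_mult_right integrable_norm integrable_gaussian)
      show "AE w in lborel. norm (LBINT x. norm (case (w, x) of (w, x) \<Rightarrow> ?E w x))
          \<le> norm (cmod K * (L2_norm f * L2_norm f) * cmod (gaussian w))"
      proof (rule AE_I2)
        fix w
        have "(LBINT x. norm (case (w, x) of (w, x) \<Rightarrow> ?E w x)) =
           (LBINT x. (cmod K * cmod (gaussian w)) * (cmod (f x) * cmod (f (x + \<epsilon> *\<^sub>R w))))"
          by (intro Bochner_Integration.integral_cong refl) (simp add: norm_mult)
        also have "\<dots> = (cmod K * cmod (gaussian w)) * (LBINT x. cmod (f x) * cmod (f (x + \<epsilon> *\<^sub>R w)))"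
          by (rule integral_mult_right_zero)
        also have "\<dots> \<le> (cmod K * cmod (gaussian w)) * (L2_norm f * L2_norm f)"
          using L2_Cauchy_Schwarz_abs[OF f2 Lp_space_2_translate[OF f2, of "\<epsilon> *\<^sub>R w"]]
          by (intro mult_left_mono) (auto simp: L2_norm_translate[OF f2])
        finally show "norm (LBINT x. norm (case (w, x) of (w, x) \<Rightarrow> ?E w x))
          \<le> norm (cmod K * (L2_norm f * L2_norm f) * cmod (gaussian w))"
          by (simp add: mult_ac abs_mult)
      qed
    qed measurable
  qed
  have "(LBINT \<xi>. fourier_integral f \<xi> * (cnj (fourier_integral f \<xi>) * G \<xi>)) =
      (LBINT x. f x * fourier_integral (\<lambda>\<xi>. cnj (fourier_integral f \<xi>) * G \<xi>) x)"
    by (rule integral_fourier_integral_mult[OF f1 int])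
  also have "\<dots> = (LBINT x. (LBINT w. ?E w x))"
  proof (intro Bochner_Integration.integral_cong refl)
    fix x
    have "(LBINT w. ?E w x) = (LBINT w. (K * f x) * (cnj (f (x + \<epsilon> *\<^sub>R w)) * gaussian w))"
      by (simp only: mult.assoc)
    also have "\<dots> = (K * f x) * (LBINT w. cnj (f (x + \<epsilon> *\<^sub>R w)) * gaussian w)"
      by (rule integral_mult_right_zero)
    finally show "f x * fourier_integral (\<lambda>\<xi>. cnj (fourier_integral f \<xi>) * G \<xi>) x =
        (LBINT w. ?E w x)"
      unfolding inner by (simp only: mult_ac)
  qed
  also have "\<dots> = (LBINT w. (LBINT x. ?E w x))"
    by (rule lborel_pair.Fubini_integral[OF int2])
  also have "\<dots> = (LBINT w. K * (gaussian w * (LBINT x. f x * cnj (f (x + \<epsilon> *\<^sub>R w)))))"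
  proof (intro Bochner_Integration.integral_cong refl)
    fix w
    have "(LBINT x. ?E w x) = (LBINT x. (K * gaussian w) * (f x * cnj (f (x + \<epsilon> *\<^sub>R w))))"
      by (simp add: mult_ac)
    then show "(LBINT x. ?E w x) = K * (gaussian w * (LBINT x. f x * cnj (f (x + \<epsilon> *\<^sub>R w))))"
      by simp
  qed
  also have "\<dots> = K * (LBINT w. gaussian w * (LBINT x. f x * cnj (f (x + \<epsilon> *\<^sub>R w))))"
    by (rule integral_mult_right_zero)
  finally show ?thesis by (simp add: G_def K_def)
qed

text \<open>The damped power of the transform is, up to constants, a Gaussian average on scale
  \<epsilon> of the autocorrelation A, which is continuous at 0 with value the squared norm of f. As
  \<epsilon> decreases to 0, the same quantity increases to the undamped power. Finiteness and value
  of the norm of the transform thus come out together.\<close>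

theorem plancherel_L1_L2:
  fixes f :: "real ^ 'n \<Rightarrow> complex"
  assumes f1: "f \<in> Lp_space 1" and f2: "f \<in> Lp_space 2"
  shows "fourier_integral f \<in> Lp_space 2"
    and "L2_norm (fourier_integral f) = sqrt (2 * pi) ^ CARD('n) * L2_norm f"
proof -
  define K where "K = sqrt (2 * pi) ^ CARD('n)"
  have K: "0 < K" by (simp add: K_def)
  have i1: "integrable lborel f" using f1 by (simp add: Lp_space_1_iff)
  have [measurable]: "f \<in> borel_measurable borel" using i1 by auto
  define \<epsilon> where "\<epsilon> k = 1 / real (Suc k)" for k
  \<comment> \<open>The decrease of \<epsilon> makes the damping factors increase, as monotone
    convergence demands.\<close>
  have \<epsilon>: "0 < \<epsilon> k" "\<epsilon> (Suc k) \<le> \<epsilon> k" for k by (auto simp: \<epsilon>_def divide_simps)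
  have \<epsilon>0: "\<epsilon> \<longlonglongrightarrow> 0" unfolding \<epsilon>_def by (rule LIMSEQ_Suc[OF lim_1_over_n])
  define A where "A z = (LBINT x. f x * cnj (f (x + z)))" for z
  have [measurable]: "A \<in> borel_measurable borel" unfolding A_def by measurable
  have A_le: "cmod (A z) \<le> (L2_norm f)\<^sup>2" for z
    unfolding A_def using L2_Cauchy_Schwarz[OF f2 Lp_space_2_cnj[OF Lp_space_2_translate[OF f2, of z]]]
      L2_norm_translate[OF f2, of z] L2_norm_unimodular[of "\<lambda>x. cnj (f (x + z))" "\<lambda>x. f (x + z)"]
    by (simp add: power2_eq_square)
  have A_0: "A 0 = complex_of_real ((L2_norm f)\<^sup>2)"
    by (simp add: A_def L2_norm_power2[OF f2] complex_norm_square[symmetric] del: of_real_power)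
  have A_lim: "(\<lambda>k. A (\<epsilon> k *\<^sub>R w)) \<longlonglongrightarrow> A 0" for w
  proof -
    have z: "(\<lambda>k. \<epsilon> k *\<^sub>R w) \<longlonglongrightarrow> 0" using tendsto_scaleR[OF \<epsilon>0 tendsto_const[of w]] by simp
    have eq: "L2_norm (\<lambda>x. cnj (f (x + \<epsilon> k *\<^sub>R w)) - cnj (f x)) = L2_norm (\<lambda>x. f (x + \<epsilon> k *\<^sub>R w) - f x)" for k
      by (rule L2_norm_unimodular) (auto simp flip: complex_cnj_diff)
    have "(\<lambda>k. LBINT x. f x * cnj (f (x + \<epsilon> k *\<^sub>R w))) \<longlonglongrightarrow> (LBINT x. f x * cnj (f x))"
      by (rule L2_bilinear_tendsto)
         (use f2 Lp_space_2_translate[OF f2] L2_translation_continuous[OF f2 z] in \<open>auto simp: eq L2_norm_eq_sqrt\<close>)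
    then show ?thesis by (simp add: A_def)
  qed
  define W where "W k = (LBINT \<xi>. fourier_integral f \<xi> * (cnj (fourier_integral f \<xi>) * gaussian (\<epsilon> k *\<^sub>R \<xi>)))" for k
  have "(\<lambda>k. LBINT w. gaussian w * A (\<epsilon> k *\<^sub>R w)) \<longlonglongrightarrow> (LBINT (w::real^'n). gaussian w * A 0)"
  proof (rule integral_dominated_convergence)
    show "integrable lborel (\<lambda>w. cmod (gaussian w :: complex) * (L2_norm f)\<^sup>2)"
      by (intro integrable_mult_left integrable_norm integrable_gaussian)
    show "AE w in lborel. norm (gaussian w * A (\<epsilon> k *\<^sub>R w)) \<le> cmod (gaussian w) * (L2_norm f)\<^sup>2" for k
      using A_le by (auto simp: norm_mult intro!: mult_left_mono)
  qed (use A_lim in \<open>auto intro!: tendsto_intros\<close>)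
  \<comment> \<open>One factor K is the constant in the damped power formula, the other the total
    mass of the Gaussian.\<close>
  then have "W \<longlonglongrightarrow> K * (K * A 0)"
    unfolding W_def gaussian_damped_power[OF i1 f2 \<epsilon>(1)] K_def A_def
    using integral_gaussian[where 'n = 'n] by (auto intro!: tendsto_intros simp: A_def)
  then have "W \<longlonglongrightarrow> complex_of_real (K\<^sup>2 * (L2_norm f)\<^sup>2)"
    by (simp add: A_0 power2_eq_square mult_ac)
  from tendsto_Re[OF this] have ReW: "(\<lambda>k. Re (W k)) \<longlonglongrightarrow> K\<^sup>2 * (L2_norm f)\<^sup>2" by simp
  define D where "D k \<xi> = (cmod (fourier_integral f \<xi>))\<^sup>2 * exp (- (\<epsilon> k * norm \<xi>)\<^sup>2 / 2)" for k \<xi>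
  have [measurable]: "D k \<in> borel_measurable borel" for k unfolding D_def by measurable
  have W_D: "fourier_integral f \<xi> * (cnj (fourier_integral f \<xi>) * gaussian (\<epsilon> k *\<^sub>R \<xi>)) = complex_of_real (D k \<xi>)" for k \<xi>
    using \<epsilon>(1)[of k] by (simp add: D_def gaussian_def complex_norm_square mult_ac del: of_real_power)
  have D0: "0 \<le> D k \<xi>" for k \<xi> by (simp add: D_def)
  have "integrable lborel (D k)" for k
  proof (rule Bochner_Integration.integrable_bound)
    show "integrable lborel (\<lambda>\<xi>::real^'n. (LBINT x. cmod (f x))\<^sup>2 * cmod (gaussian ((\<xi> - 0) /\<^sub>R (1 / \<epsilon> k))))"
      using \<epsilon>(1)[of k] by (intro integrable_mult_right integrable_norm integrable_affine integrable_gaussian) auto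
    show "AE \<xi> in lborel. norm (D k \<xi>) \<le> norm ((LBINT x. cmod (f x))\<^sup>2 * cmod (gaussian ((\<xi> - 0) /\<^sub>R (1 / \<epsilon> k))))"
      using cmod_fourier_integral_le[of f] \<epsilon>(1)[of k]
      by (auto simp: D_def gaussian_def abs_mult intro!: mult_mono power_mono)
  qed simp
  then have "(\<integral>\<^sup>+\<xi>. ennreal (D k \<xi>) \<partial>lborel) = ennreal (Re (W k))" for k
    unfolding W_def W_D using D0 by (subst nn_integral_eq_integral) auto
  then have lim1: "(\<lambda>k. \<integral>\<^sup>+\<xi>. ennreal (D k \<xi>) \<partial>lborel) \<longlonglongrightarrow> ennreal (K\<^sup>2 * (L2_norm f)\<^sup>2)"
    using tendsto_ennrealI[OF ReW] by simp
  have lim2: "(\<lambda>k. \<integral>\<^sup>+\<xi>. ennreal (D k \<xi>) \<partial>lborel) \<longlonglongrightarrow> (\<integral>\<^sup>+\<xi>. ennreal ((cmod (fourier_integral f \<xi>))\<^sup>2) \<partial>lborel)"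
  proof (rule nn_integral_LIMSEQ)
    show "incseq (\<lambda>k \<xi>. ennreal (D k \<xi>))"
    proof (rule incseq_SucI, rule le_funI, rule ennreal_leI)
      fix k and \<xi> :: "real ^ 'n"
      have "(\<epsilon> (Suc k) * norm \<xi>)\<^sup>2 \<le> (\<epsilon> k * norm \<xi>)\<^sup>2"
        using \<epsilon> less_imp_le[OF \<epsilon>(1)] by (intro power_mono mult_right_mono) auto
      then show "D k \<xi> \<le> D (Suc k) \<xi>" unfolding D_def by (intro mult_left_mono) auto
    qed
    fix \<xi> :: "real ^ 'n"
    have "(\<lambda>k. D k \<xi>) \<longlonglongrightarrow> (cmod (fourier_integral f \<xi>))\<^sup>2 * exp (- (0 * norm \<xi>)\<^sup>2 / 2)"
      unfolding D_def by (intro tendsto_intros \<epsilon>0) auto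
    then show "(\<lambda>k. ennreal (D k \<xi>)) \<longlonglongrightarrow> ennreal ((cmod (fourier_integral f \<xi>))\<^sup>2)"
      by (intro tendsto_ennrealI) simp
  qed measurable
  have eq: "(\<integral>\<^sup>+\<xi>. ennreal ((cmod (fourier_integral f \<xi>))\<^sup>2) \<partial>lborel) = ennreal (K\<^sup>2 * (L2_norm f)\<^sup>2)"
    using LIMSEQ_unique[OF lim2 lim1] .
  show *: "fourier_integral f \<in> Lp_space 2"
    by (rule Lp_space_2_I[OF _ eq_refl[OF eq]]) measurable
  have "ennreal ((L2_norm (fourier_integral f))\<^sup>2) = ennreal ((K * L2_norm f)\<^sup>2)"
    using eq nn_integral_eq_L2_norm[OF *] by (simp add: power_mult_distrib)
  then have "(L2_norm (fourier_integral f))\<^sup>2 = (K * L2_norm f)\<^sup>2" by simp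
  then show "L2_norm (fourier_integral f) = sqrt (2 * pi) ^ CARD('n) * L2_norm f"
    using K by (simp add: power2_eq_iff_nonneg K_def)
qed

section \<open>The Fourier transform on square integrable functions and the free evolution\<close>

lemma L2_norm_zero [simp]: "L2_norm (\<lambda>x. 0) = 0"
  by (simp add: L2_norm_eq_0_iff)

text \<open>A rapidly Cauchy sequence converges almost everywhere, so the limit can be the explicit
  pointwise \<open>lim\<close>; this formula, rather than mere existence, later preserves
  measurability in the time variable. Even with weights 2^k the squared increments have a finite
  total integral, hence a finite sum at almost every point, which forces geometric decay of the
  increments there. Fatou then gives the norm estimate.\<close>

lemma L2_complete:
  fixes s :: "nat \<Rightarrow> real ^ 'n \<Rightarrow> complex"
  assumes s: "\<And>k. s k \<in> Lp_space 2" and d: "\<And>k. L2_norm (\<lambda>x. s (Suc k) x - s k x) \<le> (1/2) ^ k"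
  defines "f \<equiv> \<lambda>x. lim (\<lambda>k. s k x)"
  shows L2_complete_in: "f \<in> Lp_space 2"
    and L2_complete_tendsto: "L2_tendsto s f"
proof -
  have [measurable]: "s k \<in> borel_measurable borel" for k using s[of k] by (simp add: Lp_space_2_iff)
  have fm[measurable]: "f \<in> borel_measurable borel" unfolding f_def by measurable
  define D where "D k x = (cmod (s (Suc k) x - s k x))\<^sup>2" for k x
  have [measurable]: "D k \<in> borel_measurable borel" for k unfolding D_def by measurable
  have "(\<integral>\<^sup>+x. ennreal (2 ^ k * D k x) \<partial>lborel) \<le> ennreal ((1/2) ^ k)" for k
  proof -
    have "(\<integral>\<^sup>+x. ennreal (2 ^ k * D k x) \<partial>lborel) = ennreal (2 ^ k) * ennreal ((L2_norm (\<lambda>x. s (Suc k) x - s k x))\<^sup>2)"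
      using nn_integral_eq_L2_norm[of "\<lambda>x. s (Suc k) x - s k x"] s
      by (simp add: ennreal_mult nn_integral_cmult D_def Lp_space_2_diff)
    also have "\<dots> = ennreal (2 ^ k * (L2_norm (\<lambda>x. s (Suc k) x - s k x))\<^sup>2)"
      by (simp add: ennreal_mult)
    also have "\<dots> \<le> ennreal (2 ^ k * ((1/2) ^ k)\<^sup>2)"
      using d by (intro ennreal_leI mult_left_mono power_mono) auto
    also have "2 ^ k * ((1/2) ^ k)\<^sup>2 = ((1/2)::real) ^ k"
      by (simp add: power2_eq_square power_divide)
    finally show ?thesis .
  qed
  then have "(\<Sum>k. \<integral>\<^sup>+x. ennreal (2 ^ k * D k x) \<partial>lborel) \<le> (\<Sum>k. ennreal ((1/2) ^ k))"
    by (intro suminf_le) auto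
  also have "\<dots> = ennreal (\<Sum>k. (1/2) ^ k)"
    by (rule suminf_ennreal2) (auto intro: summable_geometric)
  finally have "(\<integral>\<^sup>+x. (\<Sum>k. ennreal (2 ^ k * D k x)) \<partial>lborel) \<noteq> \<infinity>"
    by (subst nn_integral_suminf) (auto simp: top_unique)
  then have "AE x in lborel. (\<Sum>k. ennreal (2 ^ k * D k x)) \<noteq> \<infinity>"
    by (rule nn_integral_PInf_AE[rotated]) measurable
  then have AE: "AE x in lborel. (\<lambda>k. s k x) \<longlonglongrightarrow> f x"
  proof eventually_elim
    case (elim x)
    then obtain B where B: "(\<Sum>k. ennreal (2 ^ k * D k x)) = ennreal B" "0 \<le> B"
      by (cases "\<Sum>k. ennreal (2 ^ k * D k x)") auto
    have le: "cmod (s (Suc k) x - s k x) \<le> sqrt B * (1 / sqrt 2) ^ k" for k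
    proof -
      have "ennreal (2 ^ k * D k x) \<le> ennreal B"
        unfolding B(1)[symmetric] using sum_le_suminf[OF summableI, of "{k}" "\<lambda>k. ennreal (2 ^ k * D k x)"] by simp
      then have "2 ^ k * D k x \<le> B" using B(2) by (simp add: ennreal_le_iff)
      then have "D k x \<le> B / 2 ^ k" by (simp add: field_simps)
      then have "sqrt (D k x) \<le> sqrt (B / 2 ^ k)" by simp
      then show ?thesis by (simp add: D_def real_sqrt_divide real_sqrt_power power_divide)
    qed
    have "summable (\<lambda>k. s (Suc k) x - s k x)"
    proof (rule summable_comparison_test')
      show "summable (\<lambda>k. sqrt B * (1 / sqrt 2) ^ k)"
        by (intro summable_mult summable_geometric) auto
      show "\<And>k. k \<ge> 0 \<Longrightarrow> cmod (s (Suc k) x - s k x) \<le> sqrt B * (1 / sqrt 2) ^ k" using le by auto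
    qed
    then have "convergent (\<lambda>n. s n x - s 0 x)"
      by (simp add: summable_iff_convergent sum_lessThan_telescope[of "\<lambda>n. s n x"])
    then have "convergent (\<lambda>n. s n x)" by (simp add: convergent_diff_const_right_iff)
    then show ?case unfolding f_def by (simp add: convergent_LIMSEQ_iff)
  qed
  \<comment> \<open>The bound is written as a difference so that each new increment fits exactly and
    the induction closes.\<close>
  have dist: "L2_norm (\<lambda>x. s (k + m) x - s k x) \<le> 2 * (1/2) ^ k - 2 * (1/2) ^ (k + m)" for k m
  proof (induction m)
    case (Suc m)
    have "L2_norm (\<lambda>x. s (k + Suc m) x - s k x) \<le>
        L2_norm (\<lambda>x. s (Suc (k + m)) x - s (k + m) x) + L2_norm (\<lambda>x. s (k + m) x - s k x)"
      using L2_norm_triangle_diff[of "s (Suc (k + m))" "s (k + m)" "s k"] s by simp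
    then show ?case using Suc d[of "k + m"] by simp
  qed simp
  have nn: "(\<integral>\<^sup>+x. ennreal ((cmod (s k x - f x))\<^sup>2) \<partial>lborel) \<le> ennreal ((2 * (1/2) ^ k)\<^sup>2)" for k
  proof -
    have "(\<integral>\<^sup>+x. ennreal ((cmod (s k x - f x))\<^sup>2) \<partial>lborel) =
        (\<integral>\<^sup>+x. liminf (\<lambda>m. ennreal ((cmod (s (k + m) x - s k x))\<^sup>2)) \<partial>lborel)"
    proof (rule nn_integral_cong_AE)
      show "AE x in lborel. ennreal ((cmod (s k x - f x))\<^sup>2) = liminf (\<lambda>m. ennreal ((cmod (s (k + m) x - s k x))\<^sup>2))"
        using AE
      proof eventually_elim
        case (elim x)
        have "(\<lambda>m. s (k + m) x) \<longlonglongrightarrow> f x"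
          using LIMSEQ_ignore_initial_segment[OF elim, of k] by (simp add: add.commute)
        then have "(\<lambda>m. ennreal ((cmod (s (k + m) x - s k x))\<^sup>2)) \<longlonglongrightarrow> ennreal ((cmod (f x - s k x))\<^sup>2)"
          by (intro tendsto_intros)
        from lim_imp_Liminf[OF sequentially_bot this] show ?case by (simp add: norm_minus_commute[of "s k x" "f x"])
      qed
    qed
    also have "\<dots> \<le> liminf (\<lambda>m. \<integral>\<^sup>+x. ennreal ((cmod (s (k + m) x - s k x))\<^sup>2) \<partial>lborel)"
      by (rule nn_integral_liminf) measurable
    also have "\<dots> \<le> ennreal ((2 * (1/2) ^ k)\<^sup>2)"
    proof (rule Liminf_le[OF sequentially_bot], rule always_eventually, rule allI)
      fix m
      have "L2_norm (\<lambda>x. s (k + m) x - s k x) \<le> 2 * (1/2) ^ k"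
        using dist[of k m] by (rule order_trans) simp
      then show "(\<integral>\<^sup>+x. ennreal ((cmod (s (k + m) x - s k x))\<^sup>2) \<partial>lborel) \<le> ennreal ((2 * (1/2) ^ k)\<^sup>2)"
        unfolding nn_integral_eq_L2_norm[OF Lp_space_2_diff[OF s s]]
        by (intro ennreal_leI power_mono) auto
    qed
    finally show ?thesis .
  qed
  have "(\<lambda>x. s 0 x - f x) \<in> Lp_space 2" by (rule Lp_space_2_I[OF _ nn]) measurable
  from Lp_space_2_diff[OF s[of 0] this] show "f \<in> Lp_space 2" by simp
  show "L2_tendsto s f"
  proof (rule Lim_null_comparison)
    show "\<forall>\<^sub>F k in sequentially. norm (L2_norm (\<lambda>x. s k x - f x)) \<le> 2 * (1/2) ^ k"
      by (intro always_eventually allI) (auto intro!: L2_norm_le_I[OF _ _ nn])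
    show "(\<lambda>k. 2 * (1/2) ^ k) \<longlonglongrightarrow> (0::real)"
      using tendsto_mult[OF tendsto_const[of 2] LIMSEQ_realpow_zero[of "1/2"]] by simp
  qed
qed

text \<open>The indices r k are chosen independently of each other, with no monotonicity: closeness
  to the common limit already bounds consecutive differences.\<close>

lemma L2_fast_approx:
  assumes "\<And>k::nat. s k \<in> Lp_space 2" "f \<in> Lp_space 2" "L2_tendsto s f" "0 < c"
  obtains r :: "nat \<Rightarrow> nat" where "\<And>k. L2_norm (\<lambda>x. s (r k) x - f x) \<le> c * (1/2) ^ k"
    "\<And>k. L2_norm (\<lambda>x. s (r (Suc k)) x - s (r k) x) \<le> 2 * c * (1/2) ^ k"
proof -
  have "\<exists>i. L2_norm (\<lambda>x. s i x - f x) \<le> c * (1/2) ^ k" for k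
  proof -
    have "eventually (\<lambda>i. L2_norm (\<lambda>x. s i x - f x) < c * (1/2) ^ k) sequentially"
      by (rule order_tendstoD(2)[OF assms(3)]) (use assms(4) in simp)
    then show ?thesis by (auto simp: eventually_sequentially intro: less_imp_le)
  qed
  then obtain r where r: "\<And>k. L2_norm (\<lambda>x. s (r k) x - f x) \<le> c * (1/2) ^ k" by metis
  have "L2_norm (\<lambda>x. s (r (Suc k)) x - s (r k) x) \<le> 2 * c * (1/2) ^ k" for k
  proof -
    have "L2_norm (\<lambda>x. s (r (Suc k)) x - s (r k) x) \<le> c * (1/2) ^ Suc k + c * (1/2) ^ k"
      using L2_norm_triangle_diff[of "s (r (Suc k))" f "s (r k)"] assms(1,2) r[of "Suc k"] r[of k]
        L2_norm_minus_commute[of f "s (r k)"] by simp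
    also have "\<dots> \<le> 2 * c * (1/2) ^ k" using assms(4) by (simp add: field_simps)
    finally show ?thesis .
  qed
  with r show ?thesis using that by blast
qed

section \<open>The transform on L^2 as a closed isometric relation\<close>

lemma fourier_integral_diff:
  assumes "integrable lborel f" "integrable lborel g"
  shows "fourier_integral (\<lambda>x. f x - g x) \<xi> = fourier_integral f \<xi> - fourier_integral g \<xi>"
proof -
  have "fourier_integral (\<lambda>x. f x - g x) \<xi> = (LBINT x. cis (- (x \<bullet> \<xi>)) * f x - cis (- (x \<bullet> \<xi>)) * g x)"
    by (simp add: fourier_integral_def algebra_simps)
  also have "\<dots> = fourier_integral f \<xi> - fourier_integral g \<xi>"
    unfolding fourier_integral_def by (rule Bochner_Integration.integral_diff) (use assms in auto)
  finally show ?thesis .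
qed

lemma fourier_integral_cmult: "fourier_integral (\<lambda>x. c * f x) \<xi> = c * fourier_integral f \<xi>"
proof -
  have "fourier_integral (\<lambda>x. c * f x) \<xi> = (LBINT x. c * (cis (- (x \<bullet> \<xi>)) * f x))"
    by (simp add: fourier_integral_def mult_ac)
  then show ?thesis by (simp add: fourier_integral_def)
qed

lemma Lp_space_1_diff: "f \<in> Lp_space 1 \<Longrightarrow> g \<in> Lp_space 1 \<Longrightarrow> (\<lambda>x. f x - g x) \<in> Lp_space 1"
  by (simp add: Lp_space_1_iff)

lemma L2_fourierD:
  assumes "L2_fourier f F"
  shows L2_fourier_in1: "f \<in> Lp_space 2" and L2_fourier_in2: "F \<in> Lp_space 2"
  using assms by (auto simp: L2_fourier_def)

lemma L2_fourierE:
  assumes "L2_fourier f F"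
  obtains s where "\<And>k. s k \<in> Lp_space 1" "\<And>k::nat. s k \<in> Lp_space 2" "L2_tendsto s f"
    "L2_tendsto (\<lambda>k. fourier_integral (s k)) F"
  using assms by (auto simp: L2_fourier_def)

lemma L2_fourierI:
  assumes "f \<in> Lp_space 2" "F \<in> Lp_space 2" "\<And>k. s k \<in> Lp_space 1" "\<And>k::nat. s k \<in> Lp_space 2"
    "L2_tendsto s f" "L2_tendsto (\<lambda>k. fourier_integral (s k)) F"
  shows "L2_fourier f F"
  unfolding L2_fourier_def using assms plancherel_L1_L2(1) by blast

lemma L2_fourier_L1:
  assumes "f \<in> Lp_space 1" "f \<in> Lp_space 2"
  shows "L2_fourier f (fourier_integral f)"
  by (rule L2_fourierI[where s = "\<lambda>_. f"]) (use assms plancherel_L1_L2(1) in auto)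

lemma L2_fourier_exists:
  fixes f :: "real ^ 'n \<Rightarrow> complex"
  assumes f: "f \<in> Lp_space 2"
  obtains F where "L2_fourier f F"
proof -
  have [measurable]: "f \<in> borel_measurable borel" using f by (simp add: Lp_space_2_iff)
  define K where "K = sqrt (2 * pi) ^ CARD('n)"
  have K: "0 < K" by (simp add: K_def)
  define T where "T k x = (if norm x \<le> real k \<and> cmod (f x) \<le> real k then f x else 0)" for k x
  have "T k \<in> Lp_space 1 \<inter> Lp_space 2" for k
    by (rule Lp_space_bounded_support[of _ "real k" "real k"]) (auto simp: T_def[abs_def])
  then have T: "T k \<in> Lp_space 1" "T k \<in> Lp_space 2" for k by auto
  have Tlim: "L2_tendsto T f" unfolding T_def by (rule L2_truncate_tendsto[OF f])
  \<comment> \<open>The transform multiplies norms by K, so the constant 1 / (2 K) leaves increments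
    of at most (1/2)^k after transforming, the rate that \<open>L2_complete\<close> expects.\<close>
  obtain r where r: "\<And>k. L2_norm (\<lambda>x. T (r k) x - f x) \<le> 1 / (2 * K) * (1/2) ^ k"
    "\<And>k. L2_norm (\<lambda>x. T (r (Suc k)) x - T (r k) x) \<le> 2 * (1 / (2 * K)) * (1/2) ^ k"
    using L2_fast_approx[OF T(2) f Tlim, of "1 / (2 * K)"] K by auto
  define s where "s k = T (r k)" for k
  have s: "s k \<in> Lp_space 1" "s k \<in> Lp_space 2" for k by (auto simp: s_def T)
  have sf: "L2_tendsto s f"
  proof (rule Lim_null_comparison)
    show "\<forall>\<^sub>F k in sequentially. norm (L2_norm (\<lambda>x. s k x - f x)) \<le> 1 / (2 * K) * (1/2) ^ k"
      using r(1) by (simp add: s_def)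
    show "(\<lambda>k. 1 / (2 * K) * (1/2) ^ k) \<longlonglongrightarrow> 0"
      using tendsto_mult_right_zero[OF LIMSEQ_realpow_zero[of "1/2"], of "1 / (2 * K)"] by simp
  qed
  have d: "L2_norm (\<lambda>\<xi>. fourier_integral (s (Suc k)) \<xi> - fourier_integral (s k) \<xi>) \<le> (1/2) ^ k" for k
  proof -
    have "(\<lambda>\<xi>. fourier_integral (s (Suc k)) \<xi> - fourier_integral (s k) \<xi>) = fourier_integral (\<lambda>x. s (Suc k) x - s k x)"
      using s(1) by (auto simp: fourier_integral_diff Lp_space_1_iff)
    then have "L2_norm (\<lambda>\<xi>. fourier_integral (s (Suc k)) \<xi> - fourier_integral (s k) \<xi>) = K * L2_norm (\<lambda>x. s (Suc k) x - s k x)"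
      using plancherel_L1_L2(2)[of "\<lambda>x. s (Suc k) x - s k x"] s by (simp add: K_def Lp_space_1_diff Lp_space_2_diff)
    also have "\<dots> \<le> K * (2 * (1 / (2 * K)) * (1/2) ^ k)"
      using K r(2)[of k] by (intro mult_left_mono) (auto simp: s_def)
    also have "\<dots> = (1/2) ^ k" using K by simp
    finally show ?thesis .
  qed
  show ?thesis
    by (rule that[OF L2_fourierI[OF f L2_complete_in[OF plancherel_L1_L2(1)[OF s] d] s sf
      L2_complete_tendsto[OF plancherel_L1_L2(1)[OF s] d]]])
qed

lemma L2_fourier_norm:
  fixes f :: "real ^ 'n \<Rightarrow> complex"
  assumes "L2_fourier f F"
  shows "L2_norm F = sqrt (2 * pi) ^ CARD('n) * L2_norm f"
proof -
  obtain s where s: "\<And>k. s k \<in> Lp_space 1" "\<And>k::nat. s k \<in> Lp_space 2" "L2_tendsto s f"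
    "L2_tendsto (\<lambda>k. fourier_integral (s k)) F"
    using assms by (rule L2_fourierE) (rule that)
  have "(\<lambda>k. L2_norm (fourier_integral (s k))) \<longlonglongrightarrow> L2_norm F"
    by (rule L2_norm_tendsto[OF plancherel_L1_L2(1)[OF s(1,2)] L2_fourier_in2[OF assms] s(4)])
  moreover have "(\<lambda>k. L2_norm (fourier_integral (s k))) \<longlonglongrightarrow> sqrt (2 * pi) ^ CARD('n) * L2_norm f"
    unfolding plancherel_L1_L2(2)[OF s(1,2)]
    by (intro tendsto_mult tendsto_const L2_norm_tendsto[OF s(2) L2_fourier_in1[OF assms] s(3)])
  ultimately show ?thesis by (rule LIMSEQ_unique)
qed

lemma L2_fourier_diff:
  assumes "L2_fourier f F" "L2_fourier g G"
  shows "L2_fourier (\<lambda>x. f x - g x) (\<lambda>\<xi>. F \<xi> - G \<xi>)"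
proof -
  obtain s where s: "\<And>k. s k \<in> Lp_space 1" "\<And>k::nat. s k \<in> Lp_space 2" "L2_tendsto s f"
    "L2_tendsto (\<lambda>k. fourier_integral (s k)) F"
    using assms(1) by (rule L2_fourierE) (rule that)
  obtain r where r: "\<And>k. r k \<in> Lp_space 1" "\<And>k::nat. r k \<in> Lp_space 2" "L2_tendsto r g"
    "L2_tendsto (\<lambda>k. fourier_integral (r k)) G"
    using assms(2) by (rule L2_fourierE) (rule that)
  note L2 = L2_fourierD[OF assms(1)] L2_fourierD[OF assms(2)]
  have le: "L2_norm (\<lambda>x. (a x - b x) - (c x - d x)) \<le> L2_norm (\<lambda>x. a x - c x) + L2_norm (\<lambda>x. b x - d x)"
    if "a \<in> Lp_space 2" "b \<in> Lp_space 2" "c \<in> Lp_space 2" "d \<in> Lp_space 2" for a b c d :: "real ^ 'a \<Rightarrow> complex"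
  proof -
    have "(\<lambda>x. (a x - b x) - (c x - d x)) = (\<lambda>x. (a x - c x) + (d x - b x))" by auto
    then show ?thesis
      using L2_norm_triangle[of "\<lambda>x. a x - c x" "\<lambda>x. d x - b x"] that L2_norm_minus_commute[of b d] by auto
  qed
  show ?thesis
  proof (rule L2_fourierI)
    show "(\<lambda>x. s k x - r k x) \<in> Lp_space 1" for k using s r by (intro Lp_space_1_diff)
    show "(\<lambda>k. L2_norm (\<lambda>x. s k x - r k x - (f x - g x))) \<longlonglongrightarrow> 0"
      by (rule Lim_null_comparison[OF _ tendsto_add_zero[OF s(3) r(3)]]) (use s r L2 in \<open>auto intro!: always_eventually le\<close>)
    have "(\<lambda>k. L2_norm (\<lambda>\<xi>. fourier_integral (s k) \<xi> - fourier_integral (r k) \<xi> - (F \<xi> - G \<xi>))) \<longlonglongrightarrow> 0"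
      by (rule Lim_null_comparison[OF _ tendsto_add_zero[OF s(4) r(4)]]) (use s r L2 in \<open>auto intro!: always_eventually le plancherel_L1_L2(1)\<close>)
    then show "(\<lambda>k. L2_norm (\<lambda>\<xi>. fourier_integral (\<lambda>x. s k x - r k x) \<xi> - (F \<xi> - G \<xi>))) \<longlonglongrightarrow> 0"
      using s(1) r(1) by (simp add: fourier_integral_diff Lp_space_1_iff)
  qed (use s r L2 in auto)
qed

lemma L2_fourier_cmult:
  assumes "L2_fourier f F"
  shows "L2_fourier (\<lambda>x. c * f x) (\<lambda>\<xi>. c * F \<xi>)"
proof -
  obtain s where s: "\<And>k. s k \<in> Lp_space 1" "\<And>k::nat. s k \<in> Lp_space 2" "L2_tendsto s f"
    "L2_tendsto (\<lambda>k. fourier_integral (s k)) F"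
    using assms(1) by (rule L2_fourierE) (rule that)
  note L2 = L2_fourierD[OF assms]
  have eq: "L2_norm (\<lambda>x. c * a x - c * b x) = cmod c * L2_norm (\<lambda>x. a x - b x)"
    if "a \<in> Lp_space 2" "b \<in> Lp_space 2" for a b :: "real ^ 'a \<Rightarrow> complex"
    using L2_norm_cmult[OF Lp_space_2_diff[OF that], of c] by (simp add: right_diff_distrib)
  show ?thesis
  proof (rule L2_fourierI)
    show "(\<lambda>x. c * s k x) \<in> Lp_space 1" for k using s(1)[of k] by (simp add: Lp_space_1_iff)
    show "(\<lambda>k. L2_norm (\<lambda>x. c * s k x - c * f x)) \<longlonglongrightarrow> 0"
      using tendsto_mult_right_zero[OF s(3)] by (simp add: eq s L2)
    show "(\<lambda>k. L2_norm (\<lambda>\<xi>. fourier_integral (\<lambda>x. c * s k x) \<xi> - c * F \<xi>)) \<longlonglongrightarrow> 0"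
      using tendsto_mult_right_zero[OF s(4)] by (simp add: fourier_integral_cmult eq plancherel_L1_L2(1) s L2)
  qed (use s L2 in auto)
qed

lemma L2_fourier_add:
  assumes "L2_fourier f F" "L2_fourier g G"
  shows "L2_fourier (\<lambda>x. f x + g x) (\<lambda>\<xi>. F \<xi> + G \<xi>)"
  using L2_fourier_diff[OF assms(1) L2_fourier_cmult[OF assms(2), of "-1"]] by simp

lemma L2_fourier_zero: "L2_fourier (\<lambda>x :: real ^ 'a. 0) (\<lambda>\<xi>. 0)"
proof -
  obtain F :: "real ^ 'a \<Rightarrow> complex" where "L2_fourier (\<lambda>x. 0) F" using L2_fourier_exists[OF Lp_space_2_zero] .
  from L2_fourier_cmult[OF this, of 0] show ?thesis by simp
qed

lemma L2_fourier_sum: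
  assumes "\<And>i. i \<in> I \<Longrightarrow> L2_fourier (f i) (F i)"
  shows "L2_fourier (\<lambda>x. \<Sum>i\<in>I. f i x) (\<lambda>\<xi>. \<Sum>i\<in>I. F i \<xi>)"
  using assms
  by (induction I rule: infinite_finite_induct) (auto simp: L2_fourier_zero intro: L2_fourier_add)

text \<open>Each side says that the norm of a difference vanishes, and by Plancherel these norms are
  proportional. From left to right this is well-definedness of the transform; from right to left it
  is injectivity, by which identities between evolutions are proved on the Fourier side.\<close>

lemma L2_fourier_AE_unique:
  assumes "L2_fourier f F" "L2_fourier g G"
  shows "(AE x in lborel. f x = g x) \<longleftrightarrow> (AE \<xi> in lborel. F \<xi> = G \<xi>)"
proof -
  note d = L2_fourier_diff[OF assms]
  show ?thesis
    using L2_fourier_norm[OF d] L2_norm_eq_0_iff[OF L2_fourier_in1[OF d]] L2_norm_eq_0_iff[OF L2_fourier_in2[OF d]]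
    by simp
qed

lemma L2_fourier_cong_AE:
  assumes "L2_fourier f F" "AE x in lborel. f x = f' x" "AE \<xi> in lborel. F \<xi> = F' \<xi>"
    "f' \<in> borel_measurable borel" "F' \<in> borel_measurable borel"
  shows "L2_fourier f' F'"
proof -
  obtain s where s: "\<And>k. s k \<in> Lp_space 1" "\<And>k::nat. s k \<in> Lp_space 2" "L2_tendsto s f"
    "L2_tendsto (\<lambda>k. fourier_integral (s k)) F"
    using assms(1) by (rule L2_fourierE) (rule that)
  note L2 = L2_fourierD[OF assms(1)]
  have in2: "g' \<in> Lp_space 2" if "g \<in> Lp_space 2" "AE x in lborel. g x = g' x" "g' \<in> borel_measurable borel" for g g' :: "real ^ 'a \<Rightarrow> complex"
  proof -
    have "(\<integral>\<^sup>+x. ennreal ((cmod (g' x))\<^sup>2) \<partial>lborel) = (\<integral>\<^sup>+x. ennreal ((cmod (g x))\<^sup>2) \<partial>lborel)"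
      by (rule nn_integral_cong_AE) (use that(2) in auto)
    then show ?thesis using that nn_integral_eq_L2_norm[OF that(1)] by (auto intro!: Lp_space_2_I eq_refl)
  qed
  have eq: "L2_norm (\<lambda>x. a x - g x) = L2_norm (\<lambda>x. a x - g' x)"
    if "g \<in> Lp_space 2" "AE x in lborel. g x = g' x" "g' \<in> borel_measurable borel" "a \<in> Lp_space 2" for a g g' :: "real ^ 'a \<Rightarrow> complex"
  proof (rule L2_norm_cong_AE)
    have [measurable]: "a \<in> borel_measurable borel" "g \<in> borel_measurable borel" "g' \<in> borel_measurable borel"
      using that by (auto simp: Lp_space_2_iff)
    show "(\<lambda>x. a x - g x) \<in> borel_measurable borel" "(\<lambda>x. a x - g' x) \<in> borel_measurable borel" by measurable
    show "AE x in lborel. a x - g x = a x - g' x" using that(2) by auto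
  qed
  show ?thesis
  proof (rule L2_fourierI[OF _ _ s(1,2)])
    show "L2_tendsto s f'"
      using s(3) by (simp add: eq[OF L2(1) assms(2,4) s(2)])
    show "L2_tendsto (\<lambda>k. fourier_integral (s k)) F'"
      using s(4) by (simp add: eq[OF L2(2) assms(3,5) plancherel_L1_L2(1)[OF s(1,2)]])
  qed (use in2 L2 assms in auto)
qed

text \<open>Closedness of the graph: if G is any transform of f, then the isometry makes S k
  converge to G as well as to F, so the two agree almost everywhere.\<close>

lemma L2_fourier_limit:
  assumes "\<And>k::nat. L2_fourier (s k) (S k)" "f \<in> Lp_space 2" "F \<in> Lp_space 2"
    "L2_tendsto s f" "L2_tendsto S F"
  shows "L2_fourier f F"
proof -
  obtain G where G: "L2_fourier f G" using L2_fourier_exists[OF assms(2)] .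
  have GL: "G \<in> Lp_space 2" by (rule L2_fourier_in2[OF G])
  have SL: "S k \<in> Lp_space 2" for k by (rule L2_fourier_in2[OF assms(1)])
  have 1: "L2_tendsto S G"
    unfolding L2_fourier_norm[OF L2_fourier_diff[OF assms(1) G]]
    using tendsto_mult_right_zero[OF assms(4)] .
  have "(\<lambda>k. L2_norm (\<lambda>\<xi>. G \<xi> - F \<xi>)) \<longlonglongrightarrow> 0"
  proof (rule Lim_null_comparison[OF always_eventually tendsto_add_zero[OF 1 assms(5)]], rule allI)
    fix k
    show "norm (L2_norm (\<lambda>\<xi>. G \<xi> - F \<xi>)) \<le> L2_norm (\<lambda>x. S k x - G x) + L2_norm (\<lambda>x. S k x - F x)"
      using L2_norm_triangle_diff[OF GL SL[of k] assms(3)] L2_norm_minus_commute[of G "S k"] by simp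
  qed
  then have "L2_norm (\<lambda>\<xi>. G \<xi> - F \<xi>) = 0" by (simp add: LIMSEQ_const_iff)
  then have "AE \<xi> in lborel. G \<xi> = F \<xi>"
    using L2_norm_eq_0_iff[OF Lp_space_2_diff[OF GL assms(3)]] by simp
  then show ?thesis
    using assms by (intro L2_fourier_cong_AE[OF G]) (auto simp: Lp_space_2_measurable)
qed

lemma L2_fourier_adjoint:
  assumes "L2_fourier f F" "L2_fourier g G"
  shows "(LBINT \<xi>. F \<xi> * g \<xi>) = (LBINT x. f x * G x)"
proof -
  obtain s where s: "\<And>k. s k \<in> Lp_space 1" "\<And>k::nat. s k \<in> Lp_space 2" "L2_tendsto s f"
    "L2_tendsto (\<lambda>k. fourier_integral (s k)) F"
    using assms(1) by (rule L2_fourierE) (rule that)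
  obtain r where r: "\<And>k. r k \<in> Lp_space 1" "\<And>k::nat. r k \<in> Lp_space 2" "L2_tendsto r g"
    "L2_tendsto (\<lambda>k. fourier_integral (r k)) G"
    using assms(2) by (rule L2_fourierE) (rule that)
  note L2 = L2_fourierD[OF assms(1)] L2_fourierD[OF assms(2)]
  have "(\<lambda>k. LBINT \<xi>. fourier_integral (s k) \<xi> * r k \<xi>) \<longlonglongrightarrow> (LBINT \<xi>. F \<xi> * g \<xi>)"
    by (rule L2_bilinear_tendsto) (use s r L2 in \<open>auto intro!: plancherel_L1_L2(1)\<close>)
  moreover have "(\<lambda>k. LBINT x. s k x * fourier_integral (r k) x) \<longlonglongrightarrow> (LBINT x. f x * G x)"
    by (rule L2_bilinear_tendsto) (use s r L2 in \<open>auto intro!: plancherel_L1_L2(1)\<close>)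
  moreover have "(LBINT \<xi>. fourier_integral (s k) \<xi> * r k \<xi>) = (LBINT x. s k x * fourier_integral (r k) x)" for k
    using s(1) r(1) by (intro integral_fourier_integral_mult) (auto simp: Lp_space_1_iff)
  ultimately show ?thesis using LIMSEQ_unique by simp
qed

section \<open>Inversion and the free evolution\<close>

lemma L2_norm_diff_square:
  assumes f: "f \<in> Lp_space 2" and g: "g \<in> Lp_space 2"
  shows "(L2_norm (\<lambda>x. f x - g x))\<^sup>2 = (L2_norm f)\<^sup>2 - 2 * Re (LBINT x. f x * cnj (g x)) + (L2_norm g)\<^sup>2"
proof -
  have int: "integrable lborel (\<lambda>x. f x * cnj (g x))" using f g by (intro integrable_L2_mult) auto
  have pt: "(cmod (a - b))\<^sup>2 = (cmod a)\<^sup>2 - 2 * Re (a * cnj b) + (cmod b)\<^sup>2" for a b :: complex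
    unfolding cmod_power2 by (simp add: power2_eq_square algebra_simps)
  have "(L2_norm (\<lambda>x. f x - g x))\<^sup>2 = (LBINT x. (cmod (f x))\<^sup>2 - 2 * Re (f x * cnj (g x)) + (cmod (g x))\<^sup>2)"
    using f g by (simp add: L2_norm_power2 Lp_space_2_diff pt)
  also have "\<dots> = (LBINT x. (cmod (f x))\<^sup>2) - (LBINT x. 2 * Re (f x * cnj (g x))) + (LBINT x. (cmod (g x))\<^sup>2)"
    using f g integrable_Re[OF int]
    by (subst Bochner_Integration.integral_add, simp_all add: Lp_space_2_iff del: times_complex.simps complex_cnj)
  also have "(LBINT x. 2 * Re (f x * cnj (g x))) = 2 * Re (LBINT x. f x * cnj (g x))"
    using integral_Re[OF int] by (simp del: times_complex.simps)
  finally show ?thesis using f g by (simp add: L2_norm_power2)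
qed

lemma L2_norm_cnj: "L2_norm (\<lambda>x. cnj (f x)) = L2_norm f"
  by (simp add: L2_norm_def)

text \<open>
  No density argument is needed: the conjugate of H is the adjoint transform of G, and expanding
  the square of the norm of the difference of the two sides with adjointness and isometry gives 0.
\<close>

lemma L2_fourier_inverse:
  fixes G :: "real ^ 'n \<Rightarrow> complex"
  assumes H: "L2_fourier (\<lambda>\<xi>. cnj (G \<xi>)) H"
  shows "L2_fourier (\<lambda>x. cnj (H x)) (\<lambda>\<xi>. (2 * pi) ^ CARD('n) * G \<xi>)"
proof -
  define K where "K = sqrt (2 * pi) ^ CARD('n)"
  have "K\<^sup>2 = ((sqrt (2 * pi))\<^sup>2) ^ CARD('n)"
    by (simp only: K_def power_mult[symmetric] mult.commute)
  then have K2: "K\<^sup>2 = (2 * pi) ^ CARD('n)" by simp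
  have G: "G \<in> Lp_space 2" using Lp_space_2_cnj[OF L2_fourier_in1[OF H]] by simp
  have HL: "H \<in> Lp_space 2" by (rule L2_fourier_in2[OF H])
  have H2: "(L2_norm H)\<^sup>2 = K\<^sup>2 * (L2_norm G)\<^sup>2"
    using L2_fourier_norm[OF H] by (simp add: K_def L2_norm_cnj power_mult_distrib)
  obtain Q where Q: "L2_fourier (\<lambda>x. cnj (H x)) Q" using L2_fourier_exists[OF Lp_space_2_cnj[OF HL]] .
  have Q2: "(L2_norm Q)\<^sup>2 = K\<^sup>2 * (K\<^sup>2 * (L2_norm G)\<^sup>2)"
    using L2_fourier_norm[OF Q] H2 by (simp add: K_def L2_norm_cnj power_mult_distrib)
  have "(LBINT \<xi>. Q \<xi> * cnj (G \<xi>)) = (LBINT x. cnj (H x) * H x)"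
    by (rule L2_fourier_adjoint[OF Q H])
  also have "\<dots> = (LBINT x. complex_of_real ((cmod (H x))\<^sup>2))"
    by (intro Bochner_Integration.integral_cong refl) (subst complex_norm_square, simp add: mult.commute)
  also have "\<dots> = complex_of_real ((L2_norm H)\<^sup>2)"
    unfolding L2_norm_power2[OF HL] by (rule integral_complex_of_real)
  finally have QG: "(LBINT \<xi>. Q \<xi> * cnj (G \<xi>)) = complex_of_real (K\<^sup>2 * (L2_norm G)\<^sup>2)" using H2 by simp
  have "(LBINT \<xi>. Q \<xi> * cnj (complex_of_real (K\<^sup>2) * G \<xi>)) = (LBINT \<xi>. complex_of_real (K\<^sup>2) * (Q \<xi> * cnj (G \<xi>)))"
    by (intro Bochner_Integration.integral_cong refl) (simp add: mult_ac)
  also have "\<dots> = complex_of_real (K\<^sup>2 * (K\<^sup>2 * (L2_norm G)\<^sup>2))"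
    unfolding integral_mult_right_zero QG by (simp only: of_real_mult)
  finally have Re: "Re (LBINT \<xi>. Q \<xi> * cnj (complex_of_real (K\<^sup>2) * G \<xi>)) = K\<^sup>2 * (K\<^sup>2 * (L2_norm G)\<^sup>2)"
    by (simp only: Re_complex_of_real)
  have KG: "(L2_norm (\<lambda>\<xi>. complex_of_real (K\<^sup>2) * G \<xi>))\<^sup>2 = K\<^sup>2 * (K\<^sup>2 * (L2_norm G)\<^sup>2)"
    unfolding L2_norm_cmult[OF G] norm_of_real by (simp add: power2_eq_square mult_ac)
  have QL: "Q \<in> Lp_space 2" by (rule L2_fourier_in2[OF Q])
  \<comment> \<open>In the expanded square the two squared norms and the real part of the inner
    product are all K^4 times the squared norm of G; they occur with coefficients 1, 1 and
    -2.\<close>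
  have "L2_norm (\<lambda>\<xi>. Q \<xi> - complex_of_real (K\<^sup>2) * G \<xi>) = 0"
    using L2_norm_diff_square[OF QL Lp_space_2_cmult[OF G, of "complex_of_real (K\<^sup>2)"]] Re KG Q2 by simp
  then have "AE \<xi> in lborel. Q \<xi> = complex_of_real (K\<^sup>2) * G \<xi>"
    using L2_norm_eq_0_iff[OF Lp_space_2_diff[OF QL Lp_space_2_cmult[OF G, of "complex_of_real (K\<^sup>2)"]]] by simp
  then show ?thesis
    using Lp_space_2_measurable[OF Lp_space_2_cnj[OF HL]] Lp_space_2_measurable[OF Lp_space_2_cmult[OF G]]
    by (intro L2_fourier_cong_AE[OF Q]) (auto simp: K2)
qed

text \<open>Surjectivity gives the choice in \<open>schroedinger\<close> a witness: the transform
  multiplied by the phase must itself be the transform of some function.\<close>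

lemma L2_fourier_surj:
  fixes G :: "real ^ 'n \<Rightarrow> complex"
  assumes "G \<in> Lp_space 2"
  obtains u where "L2_fourier u G"
proof -
  obtain H where H: "L2_fourier (\<lambda>\<xi>. cnj (G \<xi>)) H" using L2_fourier_exists[OF Lp_space_2_cnj[OF assms]] .
  from L2_fourier_cmult[OF L2_fourier_inverse[OF H], of "1 / (2 * pi) ^ CARD('n)"] show ?thesis using that by simp
qed

lemma Lp_space_2_unimodular:
  assumes "F \<in> Lp_space 2" "a \<in> borel_measurable borel"
  shows "(\<lambda>\<xi>. cis (a \<xi>) * F \<xi>) \<in> Lp_space 2"
  by (rule Lp_space_2_bound[OF assms(1), where C = 1])
     (use assms in \<open>auto simp: norm_mult dest!: Lp_space_2_measurable\<close>)

text \<open>The definition of the evolution refers to some transform F' of f, not to the given F.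
  They differ on a null set only, and the relation \<open>L2_fourier\<close> is insensitive to
  that.\<close>

lemma L2_fourier_schroedinger:
  assumes F: "L2_fourier f F"
  shows "L2_fourier (schroedinger t f) (\<lambda>\<xi>. cis (- t * (norm \<xi>)\<^sup>2) * F \<xi>)"
proof -
  have P: "(\<lambda>\<xi>. cis (- t * (norm \<xi>)\<^sup>2) * F \<xi>) \<in> Lp_space 2"
    by (rule Lp_space_2_unimodular[OF L2_fourier_in2[OF F]]) measurable
  then obtain u where "L2_fourier u (\<lambda>\<xi>. cis (- t * (norm \<xi>)\<^sup>2) * F \<xi>)" by (rule L2_fourier_surj)
  then have "\<exists>u F. L2_fourier f F \<and> L2_fourier u (\<lambda>\<xi>. cis (- t * (norm \<xi>)\<^sup>2) * F \<xi>)" using F by blast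
  from someI_ex[OF this] obtain F' where F': "L2_fourier f F'"
    "L2_fourier (schroedinger t f) (\<lambda>\<xi>. cis (- t * (norm \<xi>)\<^sup>2) * F' \<xi>)"
    unfolding schroedinger_def by blast
  have "AE \<xi> in lborel. F' \<xi> = F \<xi>" using L2_fourier_AE_unique[OF F'(1) F] by simp
  then show ?thesis
    by (intro L2_fourier_cong_AE[OF F'(2)])
       (use P L2_fourier_in1[OF F'(2)] in \<open>auto simp: Lp_space_2_measurable\<close>)
qed

lemma schroedinger_L2:
  fixes f :: "real ^ 'n \<Rightarrow> complex"
  assumes "f \<in> Lp_space 2"
  shows Lp_space_2_schroedinger: "schroedinger t f \<in> Lp_space 2"
    and L2_norm_schroedinger: "L2_norm (schroedinger t f) = L2_norm f"
proof -
  obtain F where F: "L2_fourier f F" using L2_fourier_exists[OF assms] .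
  note S = L2_fourier_schroedinger[OF F, of t]
  show "schroedinger t f \<in> Lp_space 2" by (rule L2_fourier_in1[OF S])
  have "L2_norm (\<lambda>\<xi>. cis (- t * (norm \<xi>)\<^sup>2) * F \<xi>) = L2_norm F"
    by (simp add: L2_norm_def norm_mult)
  then show "L2_norm (schroedinger t f) = L2_norm f"
    using L2_fourier_norm[OF S] L2_fourier_norm[OF F] by simp
qed

section \<open>Symmetries and a jointly measurable version of the evolution\<close>

lemma L2_affine:
  fixes f :: "real ^ 'n \<Rightarrow> complex"
  assumes f: "f \<in> Lp_space 2" and h: "0 < h"
  shows Lp_space_2_affine: "(\<lambda>x. f ((x - c) /\<^sub>R h)) \<in> Lp_space 2"
    and L2_norm_affine: "L2_norm (\<lambda>x. f ((x - c) /\<^sub>R h)) = sqrt (h ^ CARD('n)) * L2_norm f"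
proof -
  have [measurable]: "f \<in> borel_measurable borel" using f by (simp add: Lp_space_2_iff)
  show "(\<lambda>x. f ((x - c) /\<^sub>R h)) \<in> Lp_space 2"
    using f integrable_affine[OF h, of "\<lambda>x. (cmod (f x))\<^sup>2" c] by (simp add: Lp_space_2_iff)
  show "L2_norm (\<lambda>x. f ((x - c) /\<^sub>R h)) = sqrt (h ^ CARD('n)) * L2_norm f"
    using integral_affine[OF h, of "\<lambda>x. (cmod (f x))\<^sup>2" c] by (simp add: L2_norm_eq_sqrt real_sqrt_mult)
qed

lemma L2_fourier_affine:
  fixes f :: "real ^ 'n \<Rightarrow> complex"
  assumes F: "L2_fourier f F" and h: "0 < h"
  shows "L2_fourier (\<lambda>x. cis (x \<bullet> \<xi>0) * f ((x - x0) /\<^sub>R h))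
    (\<lambda>\<xi>. complex_of_real (h ^ CARD('n)) * cis (- (x0 \<bullet> (\<xi> - \<xi>0))) * F (h *\<^sub>R (\<xi> - \<xi>0)))"
proof -
  \<comment> \<open>Space is dilated by h, hence frequency by 1 / h; in terms of a the frequency
    side has the same affine form as the space side, and the same lemmas apply to it.\<close>
  define a where "a = 1 / h"
  have a: "0 < a" "\<And>y :: real ^ 'n. h *\<^sub>R y = y /\<^sub>R a" using h by (auto simp: a_def)
  obtain s where s: "\<And>k. s k \<in> Lp_space 1" "\<And>k::nat. s k \<in> Lp_space 2" "L2_tendsto s f"
    "L2_tendsto (\<lambda>k. fourier_integral (s k)) F"
    using F by (rule L2_fourierE) (rule that)
  note L2 = L2_fourierD[OF F]
  define S where "S k x = cis (x \<bullet> \<xi>0) * s k ((x - x0) /\<^sub>R h)" for k x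
  have sm[measurable]: "s k \<in> borel_measurable borel" for k using s(2)[of k] by (simp add: Lp_space_2_iff)
  have A: "L2_norm (\<lambda>x. S k x - cis (x \<bullet> \<xi>0) * f ((x - x0) /\<^sub>R h)) = sqrt (h ^ CARD('n)) * L2_norm (\<lambda>x. s k x - f x)" for k
  proof -
    have "L2_norm (\<lambda>x. S k x - cis (x \<bullet> \<xi>0) * f ((x - x0) /\<^sub>R h)) = L2_norm (\<lambda>x. s k ((x - x0) /\<^sub>R h) - f ((x - x0) /\<^sub>R h))"
      unfolding L2_norm_def S_def right_diff_distrib[symmetric] norm_mult by simp
    then show ?thesis using L2_norm_affine[OF Lp_space_2_diff[OF s(2) L2(1)] h] by simp
  qed
  have B: "L2_norm (\<lambda>\<xi>. fourier_integral (S k) \<xi> - complex_of_real (h ^ CARD('n)) * cis (- (x0 \<bullet> (\<xi> - \<xi>0))) * F (h *\<^sub>R (\<xi> - \<xi>0)))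
      = h ^ CARD('n) * (sqrt (a ^ CARD('n)) * L2_norm (\<lambda>\<xi>. fourier_integral (s k) \<xi> - F \<xi>))" for k
  proof -
    have d: "(\<lambda>\<xi>. fourier_integral (s k) \<xi> - F \<xi>) \<in> Lp_space 2"
      using L2 plancherel_L1_L2(1)[OF s(1,2)] by auto
    have "fourier_integral (S k) \<xi> - complex_of_real (h ^ CARD('n)) * cis (- (x0 \<bullet> (\<xi> - \<xi>0))) * F (h *\<^sub>R (\<xi> - \<xi>0))
        = complex_of_real (h ^ CARD('n)) * (cis (- (x0 \<bullet> (\<xi> - \<xi>0))) * (fourier_integral (s k) ((\<xi> - \<xi>0) /\<^sub>R a) - F ((\<xi> - \<xi>0) /\<^sub>R a)))" for \<xi>
      using fourier_integral_affine[OF sm h, of \<xi>0 k x0 \<xi>] unfolding S_def[abs_def] a(2) by (simp add: right_diff_distrib mult_ac)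
    then have "L2_norm (\<lambda>\<xi>. fourier_integral (S k) \<xi> - complex_of_real (h ^ CARD('n)) * cis (- (x0 \<bullet> (\<xi> - \<xi>0))) * F (h *\<^sub>R (\<xi> - \<xi>0)))
      = L2_norm (\<lambda>\<xi>. complex_of_real (h ^ CARD('n)) * (fourier_integral (s k) ((\<xi> - \<xi>0) /\<^sub>R a) - F ((\<xi> - \<xi>0) /\<^sub>R a)))"
      unfolding L2_norm_def by (simp add: norm_mult)
    also have "\<dots> = h ^ CARD('n) * (sqrt (a ^ CARD('n)) * L2_norm (\<lambda>\<xi>. fourier_integral (s k) \<xi> - F \<xi>))"
      unfolding L2_norm_cmult[OF Lp_space_2_affine[OF d a(1)]] L2_norm_affine[OF d a(1)] norm_of_real using h by simp
    finally show ?thesis .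
  qed
  show ?thesis
  proof (rule L2_fourierI)
    show "(\<lambda>x. cis (x \<bullet> \<xi>0) * f ((x - x0) /\<^sub>R h)) \<in> Lp_space 2"
      by (intro Lp_space_2_unimodular Lp_space_2_affine L2 h) measurable
    have "(\<lambda>\<xi>. complex_of_real (h ^ CARD('n)) * (cis (- (x0 \<bullet> (\<xi> - \<xi>0))) * F ((\<xi> - \<xi>0) /\<^sub>R a))) \<in> Lp_space 2"
      by (intro Lp_space_2_cmult Lp_space_2_unimodular Lp_space_2_affine L2 a(1)) measurable
    then show "(\<lambda>\<xi>. complex_of_real (h ^ CARD('n)) * cis (- (x0 \<bullet> (\<xi> - \<xi>0))) * F (h *\<^sub>R (\<xi> - \<xi>0))) \<in> Lp_space 2"
      by (simp add: a(2) mult.assoc)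
    show "S k \<in> Lp_space 1" for k
    proof -
      have "integrable lborel (\<lambda>x. s k ((x - x0) /\<^sub>R h))"
        using s(1)[of k] h by (intro integrable_affine) (auto simp: Lp_space_1_iff)
      then show ?thesis unfolding Lp_space_1_iff S_def[abs_def] by (rule integrable_cis_mult) measurable
    qed
    show "S k \<in> Lp_space 2" for k
      unfolding S_def[abs_def] by (intro Lp_space_2_unimodular Lp_space_2_affine s h) measurable
    show "(\<lambda>k. L2_norm (\<lambda>x. S k x - cis (x \<bullet> \<xi>0) * f ((x - x0) /\<^sub>R h))) \<longlonglongrightarrow> 0"
      unfolding A by (rule tendsto_mult_right_zero[OF s(3)])
    show "(\<lambda>k. L2_norm (\<lambda>\<xi>. fourier_integral (S k) \<xi> - complex_of_real (h ^ CARD('n)) * cis (- (x0 \<bullet> (\<xi> - \<xi>0))) * F (h *\<^sub>R (\<xi> - \<xi>0)))) \<longlonglongrightarrow> 0"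
      unfolding B by (intro tendsto_mult_right_zero s(4))
  qed
qed

text \<open>Galilean covariance is checked on the Fourier side, where both functions have explicit
  transforms that differ only in how the quadratic phase is arranged. Injectivity of the transform
  then identifies the functions almost everywhere at each time.\<close>

lemma schroedinger_sym_group:
  fixes \<phi> :: "real ^ 'n \<Rightarrow> complex"
  assumes \<phi>: "\<phi> \<in> Lp_space 2" and h: "0 < h"
  shows Lp_space_2_sym_group: "sym_group \<theta> h \<xi>0 x0 t0 \<phi> \<in> Lp_space 2"
    and L2_norm_sym_group: "L2_norm (sym_group \<theta> h \<xi>0 x0 t0 \<phi>) = L2_norm \<phi>"
    and schroedinger_sym_group_AE: "AE y in lborel. schroedinger s (sym_group \<theta> h \<xi>0 x0 t0 \<phi>) y =
      cis (\<theta> - s * (norm \<xi>0)\<^sup>2) * cis (y \<bullet> \<xi>0) * complex_of_real (1 / h powr (real CARD('n) / 2)) *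
        schroedinger ((s - t0) / h\<^sup>2) \<phi> ((y - (x0 + (2 * s) *\<^sub>R \<xi>0)) /\<^sub>R h)"
proof -
  define c where "c = complex_of_real (1 / h powr (real CARD('n) / 2))"
  obtain \<Phi> where \<Phi>: "L2_fourier \<phi> \<Phi>" using L2_fourier_exists[OF \<phi>] .
  define \<psi> where "\<psi> y = c * \<phi> ((y - x0) /\<^sub>R h)" for y
  have \<psi>L: "\<psi> \<in> Lp_space 2"
    unfolding \<psi>_def[abs_def] by (intro Lp_space_2_cmult Lp_space_2_affine \<phi> h)
  have \<psi>N: "L2_norm \<psi> = L2_norm \<phi>"
  proof -
    have "(h powr (real CARD('n) / 2))\<^sup>2 = h ^ CARD('n)"
      using h by (simp add: power2_eq_square powr_add[symmetric] powr_realpow)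
    then have "h powr (real CARD('n) / 2) = sqrt (h ^ CARD('n))" by (simp add: real_sqrt_unique)
    then show ?thesis
      unfolding \<psi>_def[abs_def] L2_norm_cmult[OF Lp_space_2_affine[OF \<phi> h]] L2_norm_affine[OF \<phi> h]
      using h by (simp add: c_def norm_divide)
  qed
  define v where "v = schroedinger (- t0) \<psi>"
  have g: "sym_group \<theta> h \<xi>0 x0 t0 \<phi> = (\<lambda>x. cis \<theta> * (cis (x \<bullet> \<xi>0) * v x))"
    by (simp add: sym_group_def v_def \<psi>_def[abs_def] c_def fun_eq_iff)
  have vL: "v \<in> Lp_space 2" unfolding v_def by (rule Lp_space_2_schroedinger[OF \<psi>L])
  show "sym_group \<theta> h \<xi>0 x0 t0 \<phi> \<in> Lp_space 2"
    unfolding g by (intro Lp_space_2_cmult Lp_space_2_unimodular vL) measurable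
  have "L2_norm (sym_group \<theta> h \<xi>0 x0 t0 \<phi>) = L2_norm v"
    unfolding g by (simp add: L2_norm_def norm_mult)
  then show "L2_norm (sym_group \<theta> h \<xi>0 x0 t0 \<phi>) = L2_norm \<phi>"
    using L2_norm_schroedinger[OF \<psi>L] \<psi>N by (simp add: v_def)
  define P where "P \<xi> = c * (complex_of_real (h ^ CARD('n)) * cis (- (x0 \<bullet> (\<xi> - 0))) * \<Phi> (h *\<^sub>R (\<xi> - 0)))" for \<xi>
  have "L2_fourier \<psi> P"
    using L2_fourier_cmult[OF L2_fourier_affine[OF \<Phi> h, of 0 x0], of c]
    by (simp add: \<psi>_def[abs_def] P_def[abs_def])
  from L2_fourier_schroedinger[OF this, of "- t0"]
  have v: "L2_fourier v (\<lambda>\<xi>. cis (- (- t0) * (norm \<xi>)\<^sup>2) * P \<xi>)" by (simp only: v_def)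
  from L2_fourier_schroedinger[OF L2_fourier_cmult[OF L2_fourier_affine[OF v, of 1 \<xi>0 0], of "cis \<theta>"], of s]
  have S: "L2_fourier (schroedinger s (sym_group \<theta> h \<xi>0 x0 t0 \<phi>))
      (\<lambda>\<xi>. cis (- s * (norm \<xi>)\<^sup>2) * (cis \<theta> * (cis (t0 * (norm (\<xi> - \<xi>0))\<^sup>2) * P (\<xi> - \<xi>0))))"
    unfolding g by simp
  define \<tau> where "\<tau> = (s - t0) / h\<^sup>2"
  define X where "X = x0 + (2 * s) *\<^sub>R \<xi>0"
  define k where "k = cis (\<theta> - s * (norm \<xi>0)\<^sup>2) * c"
  have R: "L2_fourier (\<lambda>y. k * (cis (y \<bullet> \<xi>0) * schroedinger \<tau> \<phi> ((y - X) /\<^sub>R h)))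
     (\<lambda>\<xi>. k * (complex_of_real (h ^ CARD('n)) * cis (- (X \<bullet> (\<xi> - \<xi>0))) *
        (cis (- \<tau> * (norm (h *\<^sub>R (\<xi> - \<xi>0)))\<^sup>2) * \<Phi> (h *\<^sub>R (\<xi> - \<xi>0)))))"
    by (rule L2_fourier_cmult[OF L2_fourier_affine[OF L2_fourier_schroedinger[OF \<Phi>] h]])
  have eq: "cis (- s * (norm \<xi>)\<^sup>2) * (cis \<theta> * (cis (t0 * (norm (\<xi> - \<xi>0))\<^sup>2) * P (\<xi> - \<xi>0))) =
     k * (complex_of_real (h ^ CARD('n)) * cis (- (X \<bullet> (\<xi> - \<xi>0))) *
        (cis (- \<tau> * (norm (h *\<^sub>R (\<xi> - \<xi>0)))\<^sup>2) * \<Phi> (h *\<^sub>R (\<xi> - \<xi>0))))" for \<xi>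
  proof -
    define \<eta> where "\<eta> = \<xi> - \<xi>0"
    have \<xi>: "\<xi> = \<eta> + \<xi>0" by (simp add: \<eta>_def)
    have n1: "(norm \<xi>)\<^sup>2 = (norm \<eta>)\<^sup>2 + 2 * (\<xi>0 \<bullet> \<eta>) + (norm \<xi>0)\<^sup>2"
      unfolding \<xi> power2_norm_eq_inner by (simp add: inner_add_left inner_add_right inner_commute)
    have n2: "\<tau> * (norm (h *\<^sub>R \<eta>))\<^sup>2 = (s - t0) * (norm \<eta>)\<^sup>2"
      using h by (simp add: \<tau>_def power_mult_distrib)
    \<comment> \<open>The term linear in \<eta> from the square of \<xi> joins the translation phase
      and moves the centre from x0 to X; the terms quadratic in \<eta> combine to the rescaled time
      \<tau>; what remains is a constant phase.\<close>
    have ph: "- s * (norm \<xi>)\<^sup>2 + (\<theta> + (t0 * (norm \<eta>)\<^sup>2 + - (x0 \<bullet> \<eta>))) =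
        (\<theta> - s * (norm \<xi>0)\<^sup>2) + (- (X \<bullet> \<eta>) + - (\<tau> * (norm (h *\<^sub>R \<eta>))\<^sup>2))"
      unfolding n1 n2 X_def by (simp add: inner_add_left algebra_simps)
    have "cis (- s * (norm \<xi>)\<^sup>2) * (cis \<theta> * (cis (t0 * (norm \<eta>)\<^sup>2) * P \<eta>)) =
      cis (- s * (norm \<xi>)\<^sup>2 + (\<theta> + (t0 * (norm \<eta>)\<^sup>2 + - (x0 \<bullet> \<eta>)))) * (c * complex_of_real (h ^ CARD('n)) * \<Phi> (h *\<^sub>R \<eta>))"
      unfolding cis_mult[symmetric] P_def by (simp only: mult_ac diff_0_right)
    also have "\<dots> = k * (complex_of_real (h ^ CARD('n)) * cis (- (X \<bullet> \<eta>)) *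
        (cis (- \<tau> * (norm (h *\<^sub>R \<eta>))\<^sup>2) * \<Phi> (h *\<^sub>R \<eta>)))"
      unfolding ph cis_mult[symmetric] k_def minus_mult_left by (simp only: mult_ac)
    finally show ?thesis by (simp only: \<eta>_def)
  qed
  have "AE y in lborel. schroedinger s (sym_group \<theta> h \<xi>0 x0 t0 \<phi>) y = k * (cis (y \<bullet> \<xi>0) * schroedinger \<tau> \<phi> ((y - X) /\<^sub>R h))"
    unfolding L2_fourier_AE_unique[OF S R] eq by simp
  then show "AE y in lborel. schroedinger s (sym_group \<theta> h \<xi>0 x0 t0 \<phi>) y =
      cis (\<theta> - s * (norm \<xi>0)\<^sup>2) * cis (y \<bullet> \<xi>0) * complex_of_real (1 / h powr (real CARD('n) / 2)) *
        schroedinger ((s - t0) / h\<^sup>2) \<phi> ((y - (x0 + (2 * s) *\<^sub>R \<xi>0)) /\<^sub>R h)"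
    by (simp add: k_def c_def \<tau>_def X_def mult_ac)
qed

section \<open>A jointly measurable representative\<close>

abbreviation borel_measurable2 :: "('a::topological_space \<times> 'b::topological_space \<Rightarrow> 'c::topological_space) set" where
  "borel_measurable2 \<equiv> borel_measurable (borel \<Otimes>\<^sub>M borel)"

text \<open>Truncating the transform of \<phi> makes the inverse transform an honest integral
  depending measurably on (t, x). The phase has modulus 1, so the approximation is equally fast at
  all times, and a single choice of truncation levels lets the pointwise limit represent the
  evolution at every t.\<close>

lemma schroedinger_jointly_measurable:
  fixes \<phi> :: "real ^ 'n \<Rightarrow> complex"
  assumes \<phi>: "\<phi> \<in> Lp_space 2"
  obtains U where "(\<lambda>(t, x). U t x) \<in> borel_measurable2"
    "\<And>t. AE x in lborel. schroedinger t \<phi> x = U t x"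
proof -
  obtain \<Phi> where \<Phi>: "L2_fourier \<phi> \<Phi>" using L2_fourier_exists[OF \<phi>] .
  have \<Phi>L: "\<Phi> \<in> Lp_space 2" by (rule L2_fourier_in2[OF \<Phi>])
  have [measurable]: "\<Phi> \<in> borel_measurable borel" using \<Phi>L by (simp add: Lp_space_2_iff)
  define K where "K = sqrt (2 * pi) ^ CARD('n)"
  have K: "0 < K" by (simp add: K_def)
  define T where "T k \<xi> = (if norm \<xi> \<le> real k \<and> cmod (\<Phi> \<xi>) \<le> real k then \<Phi> \<xi> else 0)" for k \<xi>
  have "T k \<in> Lp_space 1 \<inter> Lp_space 2" for k
    by (rule Lp_space_bounded_support[of _ "real k" "real k"]) (auto simp: T_def[abs_def])
  then have T: "T k \<in> Lp_space 1" "T k \<in> Lp_space 2" for k by auto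
  have Tlim: "L2_tendsto T \<Phi>" unfolding T_def by (rule L2_truncate_tendsto[OF \<Phi>L])
  \<comment> \<open>Inversion divides norms by K, so increments of at most K (1/2)^k in frequency
    become (1/2)^k in space.\<close>
  obtain r where r: "\<And>k. L2_norm (\<lambda>x. T (r k) x - \<Phi> x) \<le> K / 2 * (1/2) ^ k"
    "\<And>k. L2_norm (\<lambda>x. T (r (Suc k)) x - T (r k) x) \<le> 2 * (K / 2) * (1/2) ^ k"
    using L2_fast_approx[OF T(2) \<Phi>L Tlim, of "K / 2"] K by auto
  define G where "G t k \<xi> = cis (- t * (norm \<xi>)\<^sup>2) * T (r k) \<xi>" for t :: real and k \<xi>
  \<comment> \<open>Inversion in the form of \<open>L2_fourier_inverse\<close>: the conjugate of the
    forward transform of the conjugate, normalized by (2 pi)^d.\<close>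
  define u where "u t k x = complex_of_real (1 / (2 * pi) ^ CARD('n)) * cnj (fourier_integral (\<lambda>\<xi>. cnj (G t k \<xi>)) x)" for t k x
  have Tm[measurable]: "T k \<in> borel_measurable borel" for k unfolding T_def by measurable
  have uG: "L2_fourier (u t k) (G t k)" for t k
  proof -
    have G1: "integrable lborel (G t k)"
      unfolding G_def[abs_def] by (rule integrable_cis_mult) (use T(1) in \<open>auto simp: Lp_space_1_iff\<close>)
    have "G t k \<in> Lp_space 2"
      unfolding G_def[abs_def] by (intro Lp_space_2_unimodular T) measurable
    then have "L2_fourier (\<lambda>\<xi>. cnj (G t k \<xi>)) (fourier_integral (\<lambda>\<xi>. cnj (G t k \<xi>)))"
      by (intro L2_fourier_L1) (use G1 in \<open>auto simp: Lp_space_1_iff\<close>)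
    from L2_fourier_cmult[OF L2_fourier_inverse[OF this], of "complex_of_real (1 / (2 * pi) ^ CARD('n))"]
    show ?thesis by (simp add: u_def[abs_def])
  qed
  have Gdiff: "L2_norm (\<lambda>\<xi>. G t j \<xi> - cis (- t * (norm \<xi>)\<^sup>2) * F \<xi>) = L2_norm (\<lambda>\<xi>. T (r j) \<xi> - F \<xi>)" for t j F
    unfolding L2_norm_def G_def right_diff_distrib[symmetric] norm_mult by simp
  have ud: "L2_norm (\<lambda>x. u t (Suc k) x - u t k x) \<le> (1/2) ^ k" for t k
  proof -
    have "K * L2_norm (\<lambda>x. u t (Suc k) x - u t k x) = L2_norm (\<lambda>\<xi>. G t (Suc k) \<xi> - G t k \<xi>)"
      using L2_fourier_norm[OF L2_fourier_diff[OF uG[of t "Suc k"] uG[of t k]]] by (simp add: K_def)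
    also have "\<dots> = L2_norm (\<lambda>\<xi>. T (r (Suc k)) \<xi> - T (r k) \<xi>)"
      using Gdiff[of t "Suc k" "T (r k)"] by (simp add: G_def)
    also have "\<dots> \<le> K * (1/2) ^ k" using r(2)[of k] by simp
    finally show ?thesis using K by simp
  qed
  have uL: "u t k \<in> Lp_space 2" for t k by (rule L2_fourier_in1[OF uG])
  define U where "U t x = lim (\<lambda>k. u t k x)" for t x
  have UG: "L2_fourier (U t) (\<lambda>\<xi>. cis (- t * (norm \<xi>)\<^sup>2) * \<Phi> \<xi>)" for t
    unfolding U_def
  proof (rule L2_fourier_limit[OF uG])
    show "(\<lambda>x. lim (\<lambda>k. u t k x)) \<in> Lp_space 2" by (rule L2_complete_in[OF uL ud])
    show "(\<lambda>\<xi>. cis (- t * (norm \<xi>)\<^sup>2) * \<Phi> \<xi>) \<in> Lp_space 2"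
      by (intro Lp_space_2_unimodular \<Phi>L) measurable
    show "(\<lambda>k. L2_norm (\<lambda>x. u t k x - lim (\<lambda>k. u t k x))) \<longlonglongrightarrow> 0" by (rule L2_complete_tendsto[OF uL ud])
    have "(\<lambda>k. K / 2 * (1/2) ^ k) \<longlonglongrightarrow> 0"
      by (intro tendsto_mult_right_zero LIMSEQ_realpow_zero) auto
    then show "(\<lambda>k. L2_norm (\<lambda>\<xi>. G t k \<xi> - cis (- t * (norm \<xi>)\<^sup>2) * \<Phi> \<xi>)) \<longlonglongrightarrow> 0"
      unfolding Gdiff by (rule Lim_null_comparison[rotated]) (use r(1) in auto)
  qed
  have "(\<lambda>z. u (fst z) k (snd z)) \<in> borel_measurable2" for k
    unfolding u_def G_def fourier_integral_def by measurable
  then have "(\<lambda>z. U (fst z) (snd z)) \<in> borel_measurable2"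
    unfolding U_def by (rule borel_measurable_lim_metric)
  then have "(\<lambda>(t, x). U t x) \<in> borel_measurable2" by (simp add: case_prod_beta')
  moreover have "AE x in lborel. schroedinger t \<phi> x = U t x" for t
    unfolding L2_fourier_AE_unique[OF L2_fourier_schroedinger[OF \<Phi>] UG] by simp
  ultimately show ?thesis using that by blast
qed

section \<open>Mixed integrals\<close>

text \<open>The shares x / (x + y) and y / (x + y) lie in [0, 1], where a power with exponent at
  most 1 only enlarges; and the shares add up to 1.\<close>

lemma powr_add_le_concave:
  fixes x y :: real
  assumes "0 \<le> x" "0 \<le> y" "0 < a" "a \<le> 1"
  shows "(x + y) powr a \<le> x powr a + y powr a"
proof (cases "x + y = 0")
  case False
  then have s: "0 < x + y" using assms by linarith
  have "x / (x + y) \<le> (x / (x + y)) powr a"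
    using powr_mono'[of a 1 "x / (x + y)"] assms s by (simp add: divide_le_eq)
  moreover have "y / (x + y) \<le> (y / (x + y)) powr a"
    using powr_mono'[of a 1 "y / (x + y)"] assms s by (simp add: divide_le_eq)
  moreover have "x / (x + y) + y / (x + y) = 1" using s by (simp add: add_divide_distrib[symmetric])
  ultimately have "1 \<le> (x powr a + y powr a) / (x + y) powr a"
    using assms s by (simp add: powr_divide add_divide_distrib)
  then show ?thesis using s by (simp add: le_divide_eq)
qed (use assms in simp)

lemma powr_convex_combination:
  fixes u v :: real
  assumes "0 \<le> u" "0 \<le> v" "0 \<le> l" "l \<le> 1" "1 \<le> p"
  shows "(l * u + (1 - l) * v) powr p \<le> l * u powr p + (1 - l) * v powr p"
proof (cases "u = 0 \<or> v = 0")
  case True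
  have "(c * w) powr p \<le> c * w powr p" if "0 \<le> c" "c \<le> 1" "0 \<le> w" for c w :: real
    using that powr_mono'[of 1 p c] assms(5) by (auto simp: powr_mult intro!: mult_right_mono)
  from this[of l u] this[of "1 - l" v] show ?thesis using True assms by auto
next
  case False
  then show ?thesis
    using convex_onD[OF powr_convex[OF assms(5)], of "1 - l" u v] assms by simp
qed

lemma ennreal_powr_add_le_concave:
  assumes "0 < a" "a \<le> 1"
  shows "(x + y) powr\<^sub>e a \<le> x powr\<^sub>e a + y powr\<^sub>e a"
proof (cases "x = top \<or> y = top")
  case False
  then obtain x' y' where "x = ennreal x'" "0 \<le> x'" "y = ennreal y'" "0 \<le> y'"
    by (cases x; cases y) auto
  then show ?thesis
    using powr_add_le_concave[of x' y' a] assms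
    by (simp add: ennreal_powr_ennreal flip: ennreal_plus)
qed (use assms in auto)

text \<open>Convexity is applied to x / b and y / c with weights proportional to b and c. In
  Minkowski's inequality b and c become the two norms, up to a small margin, and the two terms then
  add up to (b + c)^a.\<close>

lemma ennreal_powr_add_le_convex:
  assumes a: "1 \<le> a" and b: "0 < b" and c: "0 < c"
  shows "(x + y) powr\<^sub>e a \<le>
    ennreal ((b + c) powr (a - 1) * b powr (1 - a)) * x powr\<^sub>e a + ennreal ((b + c) powr (a - 1) * c powr (1 - a)) * y powr\<^sub>e a"
proof (cases "x = top \<or> y = top")
  case True
  moreover have "0 < (b + c) powr (a - 1) * b powr (1 - a)" "0 < (b + c) powr (a - 1) * c powr (1 - a)"
    using b c by auto
  ultimately show ?thesis by (auto simp: ennreal_mult_top)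
next
  case False
  then obtain x' y' where xy: "x = ennreal x'" "0 \<le> x'" "y = ennreal y'" "0 \<le> y'"
    by (cases x; cases y) auto
  have bc: "0 < b + c" using b c by simp
  have e: "(z / w) powr a * w = z powr a * w powr (1 - a)" if "0 \<le> z" "0 < w" for z w
    using that by (simp add: powr_divide powr_diff)
  have bca: "(b + c) powr a / (b + c) = (b + c) powr (a - 1)" using bc by (simp add: powr_diff)
  have one: "1 - b / (b + c) = c / (b + c)" using bc by (simp add: field_simps)
  have "(x' + y') powr a = (b + c) powr a * ((x' + y') / (b + c)) powr a"
    using xy bc by (simp add: powr_divide)
  also have "(x' + y') / (b + c) = b / (b + c) * (x' / b) + (1 - b / (b + c)) * (y' / c)"
    unfolding one using b c by (simp add: add_divide_distrib)
  also have "(b / (b + c) * (x' / b) + (1 - b / (b + c)) * (y' / c)) powr a \<le>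
      b / (b + c) * (x' / b) powr a + (1 - b / (b + c)) * (y' / c) powr a"
    using xy b c a by (intro powr_convex_combination) auto
  also note one
  also have "(b + c) powr a * (b / (b + c) * (x' / b) powr a + c / (b + c) * (y' / c) powr a) =
      ((b + c) powr a / (b + c)) * ((x' / b) powr a * b + (y' / c) powr a * c)"
    by (simp add: distrib_left add_divide_distrib mult_ac)
  also have "\<dots> = (b + c) powr (a - 1) * b powr (1 - a) * x' powr a + (b + c) powr (a - 1) * c powr (1 - a) * y' powr a"
    unfolding bca e[OF xy(2) b] e[OF xy(4) c] by (simp add: distrib_left mult_ac)
  finally have "(x' + y') powr a \<le> (b + c) powr (a - 1) * b powr (1 - a) * x' powr a + (b + c) powr (a - 1) * c powr (1 - a) * y' powr a"
    using bc by (simp add: mult_left_mono)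
  then show ?thesis
    using xy by (simp add: ennreal_powr_ennreal flip: ennreal_plus ennreal_mult')
qed

lemma nn_integral_Minkowski:
  assumes [measurable]: "f \<in> borel_measurable M" "g \<in> borel_measurable M" and a: "1 \<le> a"
  shows "(\<integral>\<^sup>+x. (f x + g x) powr\<^sub>e a \<partial>M) powr\<^sub>e (1 / a) \<le>
    (\<integral>\<^sup>+x. f x powr\<^sub>e a \<partial>M) powr\<^sub>e (1 / a) + (\<integral>\<^sup>+x. g x powr\<^sub>e a \<partial>M) powr\<^sub>e (1 / a)" (is "?L \<le> ?A + ?B")
proof (rule ennreal_le_epsilon)
  fix e :: real assume fin: "?A + ?B < top" and e: "0 < e"
  then obtain A B where AB: "?A = ennreal A" "0 \<le> A" "?B = ennreal B" "0 \<le> B"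
    by (cases ?A; cases ?B) auto
  \<comment> \<open>The margin e / 2 keeps both weights positive even if one of the norms is
    0.\<close>
  define b c where "b = A + e / 2" and "c = B + e / 2"
  have bc: "0 < b" "0 < c" using AB e by (auto simp: b_def c_def)
  have pw: "(z powr\<^sub>e (1 / a)) powr\<^sub>e a = z" for z using a by (simp add: ennreal_powr_powr)
  have fA: "(\<integral>\<^sup>+x. f x powr\<^sub>e a \<partial>M) \<le> ennreal (b powr a)"
    using AB a e pw[of "\<integral>\<^sup>+x. f x powr\<^sub>e a \<partial>M", symmetric]
    by (auto simp: ennreal_powr_ennreal b_def intro!: ennreal_leI powr_mono2)
  have gB: "(\<integral>\<^sup>+x. g x powr\<^sub>e a \<partial>M) \<le> ennreal (c powr a)"
    using AB a e pw[of "\<integral>\<^sup>+x. g x powr\<^sub>e a \<partial>M", symmetric]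
    by (auto simp: ennreal_powr_ennreal c_def intro!: ennreal_leI powr_mono2)
  have "(\<integral>\<^sup>+x. (f x + g x) powr\<^sub>e a \<partial>M) \<le>
     (\<integral>\<^sup>+x. ennreal ((b + c) powr (a - 1) * b powr (1 - a)) * f x powr\<^sub>e a + ennreal ((b + c) powr (a - 1) * c powr (1 - a)) * g x powr\<^sub>e a \<partial>M)"
    by (intro nn_integral_mono ennreal_powr_add_le_convex a bc)
  also have "\<dots> = ennreal ((b + c) powr (a - 1) * b powr (1 - a)) * (\<integral>\<^sup>+x. f x powr\<^sub>e a \<partial>M) +
      ennreal ((b + c) powr (a - 1) * c powr (1 - a)) * (\<integral>\<^sup>+x. g x powr\<^sub>e a \<partial>M)"
    by (simp add: nn_integral_add nn_integral_cmult)
  also have "\<dots> \<le> ennreal ((b + c) powr (a - 1) * b powr (1 - a)) * ennreal (b powr a) +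
      ennreal ((b + c) powr (a - 1) * c powr (1 - a)) * ennreal (c powr a)"
    by (intro add_mono mult_left_mono fA gB) auto
  also have "\<dots> = ennreal ((b + c) powr (a - 1) * (b powr (1 - a) * b powr a + c powr (1 - a) * c powr a))"
    by (simp add: ring_distribs mult.assoc flip: ennreal_plus ennreal_mult')
  also have "(b + c) powr (a - 1) * (b powr (1 - a) * b powr a + c powr (1 - a) * c powr a) = (b + c) powr a"
    using bc by (simp add: powr_add[symmetric] powr_diff)
  finally have "?L \<le> ennreal ((b + c) powr a) powr\<^sub>e (1 / a)"
    using a by (intro ennreal_powr_mono) auto
  also have "\<dots> = ennreal (b + c)"
    using a bc by (simp add: ennreal_powr_ennreal powr_powr)
  also have "\<dots> = ?A + ?B + ennreal e"
    using AB e by (simp add: b_def c_def flip: ennreal_plus)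
  finally show "?L \<le> ?A + ?B + ennreal e" .
qed

section \<open>The mixed gauge and its subadditivity\<close>

definition mixed_integral :: "real \<Rightarrow> (real \<times> (real ^ 'n) \<Rightarrow> ennreal) \<Rightarrow> ennreal" where
  "mixed_integral \<alpha> f = (\<integral>\<^sup>+s. (\<integral>\<^sup>+y. f (s, y) \<partial>lborel) powr\<^sub>e \<alpha> \<partial>lborel)"

text \<open>
  Applied to the r-th power of a modulus and with \<open>\<alpha> = q / r\<close>, this is the mixed norm raised to
  the power \<open>min q r\<close>, which is the power that makes it subadditive in that r-th power.
\<close>

definition mixed_gauge :: "real \<Rightarrow> (real \<times> (real ^ 'n) \<Rightarrow> ennreal) \<Rightarrow> ennreal" where
  "mixed_gauge \<alpha> f = mixed_integral \<alpha> f powr\<^sub>e (min 1 (1 / \<alpha>))"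

lemma mixed_norm_eq_mixed_integral:
  assumes "0 < q" "0 < r"
  shows "mixed_norm (ennreal q) (ennreal r) f =
    mixed_integral (q / r) (\<lambda>z. ennreal (cmod (f (fst z) (snd z)) powr r)) powr\<^sub>e (1 / q)"
  using assms by (simp add: mixed_norm_def Lp_norm_def mixed_integral_def ennreal_powr_powr ennreal_powr_ennreal)

lemma mixed_norm_powr_eq_mixed_gauge:
  assumes "0 < q" "0 < r"
  shows "mixed_norm (ennreal q) (ennreal r) f powr\<^sub>e (min q r) =
    mixed_gauge (q / r) (\<lambda>z. ennreal (cmod (f (fst z) (snd z)) powr r))"
proof -
  have "min q r / q = min 1 (1 / (q / r))" using assms by (auto simp: min_def field_simps)
  then show ?thesis
    unfolding mixed_norm_eq_mixed_integral[OF assms] mixed_gauge_def ennreal_powr_powr by simp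
qed

text \<open>The comparison is made on every time slice up to a null set, which is how two
  representatives of an evolution agree. It lets the jointly measurable version replace the chosen
  one.\<close>

lemma mixed_integral_mono_AE:
  assumes "0 \<le> \<alpha>" "\<And>s. AE y in lborel. f (s, y) \<le> g (s, y)"
  shows "mixed_integral \<alpha> f \<le> mixed_integral \<alpha> g"
  unfolding mixed_integral_def using assms
  by (intro nn_integral_mono ennreal_powr_mono nn_integral_mono_AE) auto

lemma mixed_gauge_mono_AE:
  assumes "0 < \<alpha>" "\<And>s. AE y in lborel. f (s, y) \<le> g (s, y)"
  shows "mixed_gauge \<alpha> f \<le> mixed_gauge \<alpha> g"
  unfolding mixed_gauge_def using assms by (intro ennreal_powr_mono mixed_integral_mono_AE) auto

lemma mixed_gauge_mono:
  assumes "0 < \<alpha>" "\<And>z. f z \<le> g z"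
  shows "mixed_gauge \<alpha> f \<le> mixed_gauge \<alpha> g"
  by (rule mixed_gauge_mono_AE) (use assms in auto)

text \<open>For \<alpha> at most 1 the power \<alpha> is itself subadditive. For larger \<alpha>
  this is Minkowski's inequality in time for the slice integrals, whence the outer exponent 1 /
  \<alpha>.\<close>

lemma mixed_gauge_add:
  assumes \<alpha>: "0 < \<alpha>" and [measurable]: "f \<in> borel_measurable2" "g \<in> borel_measurable2"
  shows "mixed_gauge \<alpha> (\<lambda>z. f z + g z) \<le> mixed_gauge \<alpha> f + mixed_gauge \<alpha> g"
proof -
  have eq: "mixed_integral \<alpha> (\<lambda>z. f z + g z) =
      (\<integral>\<^sup>+s. ((\<integral>\<^sup>+y. f (s, y) \<partial>lborel) + (\<integral>\<^sup>+y. g (s, y) \<partial>lborel)) powr\<^sub>e \<alpha> \<partial>lborel)"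
    unfolding mixed_integral_def by (simp add: nn_integral_add)
  show ?thesis
  proof (cases "\<alpha> \<le> 1")
    case True
    have "mixed_integral \<alpha> (\<lambda>z. f z + g z) \<le>
       (\<integral>\<^sup>+s. (\<integral>\<^sup>+y. f (s, y) \<partial>lborel) powr\<^sub>e \<alpha> + (\<integral>\<^sup>+y. g (s, y) \<partial>lborel) powr\<^sub>e \<alpha> \<partial>lborel)"
      unfolding eq using \<alpha> True by (intro nn_integral_mono ennreal_powr_add_le_concave) auto
    also have "\<dots> = mixed_integral \<alpha> f + mixed_integral \<alpha> g"
      unfolding mixed_integral_def by (rule nn_integral_add) measurable
    finally show ?thesis using True \<alpha> by (simp add: mixed_gauge_def min_def)
  next
    case False
    then have "min 1 (1 / \<alpha>) = 1 / \<alpha>" by (simp add: min_def)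
    then show ?thesis
      unfolding mixed_gauge_def eq unfolding mixed_integral_def using False
      by (simp add: nn_integral_Minkowski)
  qed
qed

lemma mixed_gauge_cmult:
  assumes "0 < \<alpha>" "0 \<le> c" and [measurable]: "f \<in> borel_measurable2"
  shows "mixed_gauge \<alpha> (\<lambda>z. ennreal c * f z) = ennreal (c powr (min \<alpha> 1)) * mixed_gauge \<alpha> f"
proof -
  have "\<alpha> * min 1 (1 / \<alpha>) = min \<alpha> 1" using assms(1) by (auto simp: min_def field_simps)
  then show ?thesis
    unfolding mixed_gauge_def mixed_integral_def using assms(2)
    by (simp add: nn_integral_cmult ennreal_powr_mult ennreal_powr_powr ennreal_powr_ennreal powr_powr)
qed

lemma mixed_gauge_zero [simp]: "mixed_gauge \<alpha> (\<lambda>z. 0) = 0"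
  by (simp add: mixed_gauge_def mixed_integral_def)

lemma mixed_gauge_sum:
  assumes "0 < \<alpha>" "finite I" "\<And>i. i \<in> I \<Longrightarrow> f i \<in> borel_measurable2"
  shows "mixed_gauge \<alpha> (\<lambda>z. \<Sum>i\<in>I. f i z) \<le> (\<Sum>i\<in>I. mixed_gauge \<alpha> (f i))"
  using assms(2,3)
proof (induction I rule: finite_induct)
  case (insert i I)
  have "mixed_gauge \<alpha> (\<lambda>z. f i z + (\<Sum>i\<in>I. f i z)) \<le> mixed_gauge \<alpha> (f i) + mixed_gauge \<alpha> (\<lambda>z. \<Sum>i\<in>I. f i z)"
    using insert by (intro mixed_gauge_add assms(1) borel_measurable_sum) auto
  also have "\<dots> \<le> mixed_gauge \<alpha> (f i) + (\<Sum>i\<in>I. mixed_gauge \<alpha> (f i))"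
    using insert by (intro add_left_mono) auto
  finally show ?case using insert by simp
qed simp

text \<open>
  Either the largest term dominates all others, or it is comparable with a second one.
\<close>

lemma powr_sum_le_cross_terms:
  fixes r :: real
  assumes r: "0 < r" and I: "finite I" and e: "0 < \<epsilon>"
  obtains C where "0 \<le> C" "\<And>a. (\<And>i. i \<in> I \<Longrightarrow> (0::real) \<le> a i) \<Longrightarrow>
    (\<Sum>i\<in>I. a i) powr r \<le> (1 + \<epsilon>) * (\<Sum>i\<in>I. a i powr r) +
      C * (\<Sum>(i, k)\<in>{(i, k). i \<in> I \<and> k \<in> I \<and> i \<noteq> k}. (a i * a k) powr (r / 2))"
proof -
  \<comment> \<open>The added 1 keeps N positive when I is empty. The constant \<delta> below solves
    (1 + N \<delta>)^r = 1 + \<epsilon>, the factor lost if all terms but the largest are at most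
    \<delta> times it.\<close>
  define N where "N = real (card I) + 1"
  have N: "0 < N" "real (card I) \<le> N" by (auto simp: N_def)
  define \<delta> where "\<delta> = ((1 + \<epsilon>) powr (1 / r) - 1) / N"
  have "1 < (1 + \<epsilon>) powr (1 / r)"
    using r e powr_less_mono2[of "1 / r" 1 "1 + \<epsilon>"] by simp
  then have \<delta>: "0 < \<delta>" using N by (simp add: \<delta>_def)
  have \<delta>r: "(1 + N * \<delta>) powr r = 1 + \<epsilon>" using N e r by (simp add: \<delta>_def powr_powr)
  define P where "P = {(i, k). i \<in> I \<and> k \<in> I \<and> i \<noteq> k}"
  have P: "finite P" using I by (rule_tac finite_subset[of _ "I \<times> I"]) (auto simp: P_def)
  \<comment> \<open>If a second term a k exceeds \<delta> times the largest term a m, then the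
    square of a m is at most (1 / \<delta>) a m a k, and the r-th power of N a m is bounded by C
    times a single cross term.\<close>
  define C where "C = N powr r * (1 / \<delta>) powr (r / 2)"
  show ?thesis
  proof (rule that[of C], goal_cases)
    case 1 show ?case by (simp add: C_def)
  next
    case (2 a)
    have a: "\<And>i. i \<in> I \<Longrightarrow> 0 \<le> a i" by fact
    have cr0: "0 \<le> (\<Sum>(i, k)\<in>P. (a i * a k) powr (r / 2))" by (intro sum_nonneg) auto
    have dg0: "0 \<le> (\<Sum>i\<in>I. a i powr r)" by (intro sum_nonneg) auto
    have C0: "0 \<le> C" by (simp add: C_def)
    show ?case
    proof (cases "I = {}")
      case False
      have "Max (a ` I) \<in> a ` I" using False I by (intro Max_in) auto
      then obtain m where m: "m \<in> I" "a m = Max (a ` I)" by auto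
      have am: "a i \<le> a m" if "i \<in> I" for i using that I m by auto
      have S0: "0 \<le> (\<Sum>i\<in>I. a i)" by (intro sum_nonneg a)
      show ?thesis
      proof (cases "\<forall>i\<in>I - {m}. a i \<le> \<delta> * a m")
        case True
        have "(\<Sum>i\<in>I. a i) = a m + (\<Sum>i\<in>I - {m}. a i)" using I m by (simp add: sum.remove)
        also have "\<dots> \<le> a m + (\<Sum>i\<in>I - {m}. \<delta> * a m)" using True by (intro add_left_mono sum_mono) auto
        also have "\<dots> \<le> a m + N * (\<delta> * a m)"
          using I m a[OF m(1)] \<delta> N by (auto intro!: mult_right_mono simp: card_Diff_singleton)
        also have "\<dots> = (1 + N * \<delta>) * a m" by (simp add: algebra_simps)
        finally have "(\<Sum>i\<in>I. a i) powr r \<le> ((1 + N * \<delta>) * a m) powr r"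
          using r S0 by (intro powr_mono2) auto
        also have "\<dots> = (1 + \<epsilon>) * a m powr r"
          using \<delta>r a[OF m(1)] N \<delta> by (simp add: powr_mult)
        also have "\<dots> \<le> (1 + \<epsilon>) * (\<Sum>i\<in>I. a i powr r)"
          using e m I by (intro mult_left_mono member_le_sum) auto
        finally show ?thesis using cr0 C0 unfolding P_def by (smt (verit) mult_nonneg_nonneg)
      next
        case False
        then obtain k where "k \<in> I - {m}" "\<not> a k \<le> \<delta> * a m" by blast
        then have k: "k \<in> I" "k \<noteq> m" "\<delta> * a m < a k" by auto
        have "(\<Sum>i\<in>I. a i) \<le> (\<Sum>i\<in>I. a m)" using am by (intro sum_mono) auto
        also have "\<dots> \<le> N * a m" using N a[OF m(1)] by (auto intro!: mult_right_mono)
        finally have "(\<Sum>i\<in>I. a i) powr r \<le> (N * a m) powr r"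
          using r S0 by (intro powr_mono2) auto
        also have "\<dots> = N powr r * (a m * a m) powr (r / 2)"
          using N a[OF m(1)] by (simp add: powr_mult powr_add[symmetric])
        also have "\<dots> \<le> N powr r * ((1 / \<delta>) * (a m * a k)) powr (r / 2)"
        proof (intro mult_left_mono powr_mono2)
          have "\<delta> * a m * a m \<le> a k * a m"
            using k a[OF m(1)] by (intro mult_right_mono) auto
          then show "a m * a m \<le> (1 / \<delta>) * (a m * a k)"
            using \<delta> by (simp add: pos_le_divide_eq mult_ac)
        qed (use r in auto)
        also have "\<dots> = C * (a m * a k) powr (r / 2)"
          by (subst powr_mult) (use \<delta> a[OF m(1)] a[OF k(1)] in \<open>auto simp: C_def\<close>)
        also have "(a m * a k) powr (r / 2) \<le> (\<Sum>(i, k)\<in>P. (a i * a k) powr (r / 2))"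
          using member_le_sum[of "(m, k)" P "\<lambda>(i, k). (a i * a k) powr (r / 2)"] P k m by (auto simp: P_def)
        finally have "(\<Sum>i\<in>I. a i) powr r \<le> C * (\<Sum>(i, k)\<in>P. (a i * a k) powr (r / 2))"
          using C0 by (simp add: mult_left_mono)
        then show ?thesis using dg0 e unfolding P_def by (smt (verit) mult_nonneg_nonneg)
      qed
    qed (use cr0 C0 in simp)
  qed
qed

section \<open>Galilean transformations and localized functions\<close>

text \<open>The space-time coordinates in which a transformed evolution becomes the original one, up
  to phase and amplitude: a parabolic rescaling whose centre drifts with velocity 2 \<xi>.\<close>

definition galilei :: "real \<Rightarrow> real ^ 'n \<Rightarrow> real ^ 'n \<Rightarrow> real \<Rightarrow> real \<times> (real ^ 'n) \<Rightarrow> real \<times> (real ^ 'n)" where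
  "galilei h \<xi> x t z = ((fst z - t) / h\<^sup>2, (snd z - (x + (2 * fst z) *\<^sub>R \<xi>)) /\<^sub>R h)"

lemma measurable_galilei [measurable]:
  "galilei h \<xi> x t \<in> measurable (borel \<Otimes>\<^sub>M borel) (borel \<Otimes>\<^sub>M borel)"
  unfolding galilei_def by measurable

text \<open>On a fixed time slice the drift is a mere translation, so \<xi>, x and t leave no trace.
  Only the scale contributes, h^d from space and h^2 from time.\<close>

lemma mixed_integral_galilei:
  fixes f :: "real \<times> (real ^ 'n) \<Rightarrow> ennreal"
  assumes [measurable]: "f \<in> borel_measurable2" and h: "0 < h"
  shows "mixed_integral \<alpha> (\<lambda>z. ennreal (h powr \<rho>) * f (galilei h \<xi> x t z)) =
    ennreal (h powr ((\<rho> + real CARD('n)) * \<alpha> + 2)) * mixed_integral \<alpha> f"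
proof -
  define I where "I s = (\<integral>\<^sup>+y. f (s, y) \<partial>lborel)" for s
  have [measurable]: "I \<in> borel_measurable borel" unfolding I_def by measurable
  have "(\<integral>\<^sup>+y. ennreal (h powr \<rho>) * f (galilei h \<xi> x t (s, y)) \<partial>lborel) = ennreal (h powr (\<rho> + real CARD('n))) * I ((s - t) / h\<^sup>2)" for s
  proof -
    have "(\<integral>\<^sup>+y. ennreal (h powr \<rho>) * f (galilei h \<xi> x t (s, y)) \<partial>lborel) =
        ennreal (h powr \<rho>) * (\<integral>\<^sup>+y. f ((s - t) / h\<^sup>2, (y - (x + (2 * s) *\<^sub>R \<xi>)) /\<^sub>R h) \<partial>lborel)"
      unfolding galilei_def by (simp add: nn_integral_cmult)
    also have "(\<integral>\<^sup>+y. f ((s - t) / h\<^sup>2, (y - (x + (2 * s) *\<^sub>R \<xi>)) /\<^sub>R h) \<partial>lborel) = ennreal (h ^ CARD('n)) * I ((s - t) / h\<^sup>2)"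
      unfolding I_def using nn_integral_affine[OF h, of "\<lambda>y. f ((s - t) / h\<^sup>2, y)" "x + (2 * s) *\<^sub>R \<xi>"] by simp
    finally show ?thesis
      using h by (simp add: powr_add powr_realpow ennreal_mult mult.assoc)
  qed
  then have "mixed_integral \<alpha> (\<lambda>z. ennreal (h powr \<rho>) * f (galilei h \<xi> x t z)) =
      (\<integral>\<^sup>+s. ennreal (h powr ((\<rho> + real CARD('n)) * \<alpha>)) * I ((s - t) / h\<^sup>2) powr\<^sub>e \<alpha> \<partial>lborel)"
    unfolding mixed_integral_def by (simp add: ennreal_powr_mult ennreal_powr_ennreal powr_powr)
  also have "\<dots> = ennreal (h powr ((\<rho> + real CARD('n)) * \<alpha>)) * (\<integral>\<^sup>+s. I ((s - t) / h\<^sup>2) powr\<^sub>e \<alpha> \<partial>lborel)"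
    by (rule nn_integral_cmult) measurable
  also have "(\<integral>\<^sup>+s. I ((s - t) / h\<^sup>2) powr\<^sub>e \<alpha> \<partial>lborel) = ennreal (h\<^sup>2) * (\<integral>\<^sup>+s. I s powr\<^sub>e \<alpha> \<partial>lborel)"
    using nn_integral_affine[of "h\<^sup>2" "\<lambda>s. I s powr\<^sub>e \<alpha>" t] h by (simp add: divide_inverse mult.commute)
  finally show ?thesis
    using h by (simp add: mixed_integral_def I_def powr_add ennreal_mult mult.assoc)
qed

lemma mixed_gauge_galilei:
  fixes f :: "real \<times> (real ^ 'n) \<Rightarrow> ennreal"
  assumes "f \<in> borel_measurable2" "0 < h" "(\<rho> + real CARD('n)) * \<alpha> + 2 = 0"
  shows "mixed_gauge \<alpha> (\<lambda>z. ennreal (h powr \<rho>) * f (galilei h \<xi> x t z)) = mixed_gauge \<alpha> f"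
  unfolding mixed_gauge_def mixed_integral_galilei[OF assms(1,2)] assms(3) using assms(2) by simp

text \<open>Dominated convergence is used twice, in space at almost every time and then in time.
  Finiteness of the gauge supplies both dominating functions.\<close>

lemma mixed_gauge_exhaustion_tendsto_0:
  assumes \<alpha>: "0 < \<alpha>" and [measurable]: "f \<in> borel_measurable2"
    and E[measurable]: "\<And>k::nat. E k \<in> sets (borel \<Otimes>\<^sub>M borel)"
    and ev: "\<And>z. eventually (\<lambda>k. z \<in> E k) sequentially"
    and fin: "mixed_gauge \<alpha> f < top"
  shows "(\<lambda>k. mixed_gauge \<alpha> (\<lambda>z. f z * indicator (- E k) z)) \<longlonglongrightarrow> 0"
proof -
  have fin': "mixed_integral \<alpha> f < \<infinity>" using fin by (simp add: mixed_gauge_def)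
  have [measurable]: "(\<lambda>z. indicator (- E k) z :: ennreal) \<in> borel_measurable2" for k
    using sets.compl_sets[OF E[of k]] by (intro borel_measurable_indicator) (simp add: Compl_eq_Diff_UNIV space_pair_measure)
  define I where "I s = (\<integral>\<^sup>+y. f (s, y) \<partial>lborel)" for s
  have [measurable]: "I \<in> borel_measurable borel" unfolding I_def by measurable
  have "AE s in lborel. I s powr\<^sub>e \<alpha> \<noteq> \<infinity>"
    using fin' unfolding mixed_integral_def I_def[symmetric] by (intro nn_integral_PInf_AE) auto
  then have If: "AE s in lborel. I s < \<infinity>"
    by eventually_elim (auto simp: less_top[symmetric])
  have "(\<lambda>k. mixed_integral \<alpha> (\<lambda>z. f z * indicator (- E k) z)) \<longlonglongrightarrow> (\<integral>\<^sup>+(s::real). 0 \<partial>lborel)"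
    unfolding mixed_integral_def
  proof (rule nn_integral_dominated_convergence)
    show "(\<integral>\<^sup>+s. I s powr\<^sub>e \<alpha> \<partial>lborel) < \<infinity>" using fin' by (simp add: mixed_integral_def I_def)
    show "AE s in lborel. (\<integral>\<^sup>+y. f (s, y) * indicator (- E k) (s, y) \<partial>lborel) powr\<^sub>e \<alpha> \<le> I s powr\<^sub>e \<alpha>" for k
      unfolding I_def using \<alpha> by (intro AE_I2 ennreal_powr_mono nn_integral_mono) (auto simp: indicator_def)
    show "AE s in lborel. (\<lambda>k. (\<integral>\<^sup>+y. f (s, y) * indicator (- E k) (s, y) \<partial>lborel) powr\<^sub>e \<alpha>) \<longlonglongrightarrow> 0"
      using If
    proof eventually_elim
      case (elim s)
      have "(\<lambda>k. \<integral>\<^sup>+y. f (s, y) * indicator (- E k) (s, y) \<partial>lborel) \<longlonglongrightarrow> (\<integral>\<^sup>+(y::real^'a). 0 \<partial>lborel)"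
      proof (rule nn_integral_dominated_convergence)
        show "(\<integral>\<^sup>+y. f (s, y) \<partial>lborel) < \<infinity>" using elim by (simp add: I_def)
        show "AE y in lborel. (\<lambda>k. f (s, y) * indicator (- E k) (s, y)) \<longlonglongrightarrow> 0"
        proof (rule AE_I2, rule tendsto_eventually)
          fix y show "\<forall>\<^sub>F k in sequentially. f (s, y) * indicator (- E k) (s, y) = 0"
            using ev[of "(s, y)"] by eventually_elim simp
        qed
      qed (auto simp: indicator_def)
      then show ?case by (intro tendsto_ennreal_powr_0 \<alpha>) simp
    qed
  qed measurable
  then show ?thesis
    unfolding mixed_gauge_def using \<alpha> by (intro tendsto_ennreal_powr_0) auto
qed

lemma tendsto_0_if_limsup_le_0:
  fixes u :: "nat \<Rightarrow> ennreal"
  assumes "limsup u \<le> 0"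
  shows "u \<longlonglongrightarrow> 0"
proof (rule Liminf_eq_Limsup)
  show "limsup u = 0" using assms by simp
  then show "liminf u = 0" using Liminf_le_Limsup[of sequentially u] by simp
qed simp

lemma ennreal_tendsto_0_le:
  fixes u v :: "nat \<Rightarrow> ennreal"
  assumes "v \<longlonglongrightarrow> 0" "\<And>n. u n \<le> v n"
  shows "u \<longlonglongrightarrow> 0"
  by (rule tendsto_sandwich[OF _ _ tendsto_const assms(1)]) (use assms(2) in auto)

lemma limsup_le_const_add_null:
  fixes u :: "nat \<Rightarrow> ennreal"
  assumes "\<And>n. u n \<le> v n + c" "v \<longlonglongrightarrow> 0"
  shows "limsup u \<le> c"
proof -
  have "(\<lambda>n. v n + c) \<longlonglongrightarrow> 0 + c" by (intro tendsto_add assms(2) tendsto_const)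
  then have "limsup (\<lambda>n. v n + c) = c" by (intro lim_imp_Limsup) auto
  moreover have "limsup u \<le> limsup (\<lambda>n. v n + c)" by (intro Limsup_mono always_eventually allI assms(1))
  ultimately show ?thesis by simp
qed

text \<open>
  This replaces interpolation against another admissible pair: a bounded function living on
  a parabolic box of scale m is compared with a diagonal norm, uniformly in m.
\<close>

lemma mixed_integral_localized_le:
  fixes \<alpha> \<rho> P K c0 c1 \<eta> :: real
  assumes pos: "0 < \<alpha>" "0 < \<rho>" "0 < P" "0 < K" "0 < c0" "0 < c1" "0 < \<eta>"
    and scal: "(real CARD('n) - real CARD('n) * \<rho>) * \<alpha> = -2" "real CARD('n) - real CARD('n) * P = -2"
  obtains C where "0 < C" "\<And>m (w :: real \<times> (real ^ 'n) \<Rightarrow> real) S B. 0 < m \<Longrightarrow>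
    w \<in> borel_measurable2 \<Longrightarrow> (\<And>z. 0 \<le> w z) \<Longrightarrow> (\<And>z. w z \<le> K * m powr (- real CARD('n))) \<Longrightarrow>
    S \<in> sets borel \<Longrightarrow> emeasure lborel S \<le> ennreal (c1 * m\<^sup>2) \<Longrightarrow>
    (\<And>s. B s \<in> sets borel) \<Longrightarrow> (\<And>s. emeasure lborel (B s) \<le> ennreal (c0 * m powr real CARD('n))) \<Longrightarrow>
    (\<And>s y. w (s, y) \<noteq> 0 \<Longrightarrow> s \<in> S \<and> y \<in> B s) \<Longrightarrow>
    mixed_integral \<alpha> (\<lambda>z. ennreal (w z powr \<rho>)) \<le> ennreal \<eta> + ennreal C * mixed_integral 1 (\<lambda>z. ennreal (w z powr P))"
proof -
  define d where "d = real CARD('n)"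
  note scal = scal[folded d_def]
  \<comment> \<open>\<kappa> is the threshold between small and large rescaled values. It solves c1
    (2 \<kappa> c0)^\<alpha> = \<eta>, the total cost of those times at which small values
    prevail.\<close>
  define \<kappa> where "\<kappa> = (\<eta> / c1) powr (1 / \<alpha>) / (2 * c0)"
  define L where "L = K powr \<rho> * c0"
  \<comment> \<open>With this constant, C1 v^P reaches the maximal value K^\<rho> as soon as
    v^\<rho> exceeds \<kappa>.\<close>
  define C1 where "C1 = K powr \<rho> * \<kappa> powr (- P / \<rho>)"
  define C2 where "C2 = L powr \<alpha> * C1 / (\<kappa> * c0)"
  have \<kappa>: "0 < \<kappa>" using pos by (simp add: \<kappa>_def)
  have L: "0 < L" using pos by (simp add: L_def)
  have C1: "0 < C1" using pos \<kappa> by (simp add: C1_def)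
  have C2: "0 < C2" using pos \<kappa> L C1 by (simp add: C2_def)
  show ?thesis
  proof (rule that[OF C2])
    fix m :: real and w :: "real \<times> (real ^ 'n) \<Rightarrow> real" and S B
    assume m: "0 < m" and [measurable]: "w \<in> borel_measurable2"
      and w0: "\<And>z. 0 \<le> w z" and wK: "\<And>z. w z \<le> K * m powr (- real CARD('n))"
      and S[measurable]: "S \<in> sets borel" and Sm: "emeasure lborel S \<le> ennreal (c1 * m\<^sup>2)"
      and B[measurable]: "\<And>s. B s \<in> sets borel" and Bm: "\<And>s. emeasure lborel (B s) \<le> ennreal (c0 * m powr real CARD('n))"
      and supp: "\<And>s y. w (s, y) \<noteq> 0 \<Longrightarrow> s \<in> S \<and> y \<in> B s"
    define J where "J s = (\<integral>\<^sup>+y. ennreal (w (s, y) powr P) \<partial>lborel)" for s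
    define I where "I s = (\<integral>\<^sup>+y. ennreal (w (s, y) powr \<rho>) \<partial>lborel)" for s
    have [measurable]: "J \<in> borel_measurable borel" unfolding J_def by measurable
    \<comment> \<open>Passing to v = m^d w removes the scale: v ranges in [0, K], and splitting at
      \<kappa> compares the powers \<rho> and P whichever of them is larger.\<close>
    have pt: "w z powr \<rho> \<le> m powr (- d * \<rho>) * (\<kappa> + C1 * m powr (d * P) * w z powr P)"
      and ptK: "w z powr \<rho> \<le> m powr (- d * \<rho>) * K powr \<rho>" for z
    proof -
      define v where "v = m powr d * w z"
      have v0: "0 \<le> v" using w0 by (simp add: v_def)
      have "v \<le> m powr d * (K * m powr - d)" unfolding v_def d_def by (intro mult_left_mono wK) auto
      also have "\<dots> = K" using m by (simp add: powr_minus)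
      finally have vK: "v \<le> K" .
      have wv: "w z = m powr - d * v" using m by (simp add: v_def powr_minus)
      have wr: "w z powr \<rho> = m powr (- d * \<rho>) * v powr \<rho>"
        unfolding wv using v0 by (simp add: powr_mult powr_powr)
      have vP: "m powr (d * P) * w z powr P = v powr P"
        unfolding v_def using w0[of z] by (simp add: powr_mult powr_powr)
      have vKr: "v powr \<rho> \<le> K powr \<rho>" using vK v0 pos by (intro powr_mono2) auto
      show "w z powr \<rho> \<le> m powr (- d * \<rho>) * K powr \<rho>"
        unfolding wr by (intro mult_left_mono vKr) auto
      have "v powr \<rho> \<le> \<kappa> + C1 * v powr P"
      proof (cases "v powr \<rho> \<le> \<kappa>")
        case True
        have "0 \<le> C1 * v powr P" using C1 by simp
        with True show ?thesis by linarith
      next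
        case False
        then have "\<kappa> powr (P / \<rho>) \<le> (v powr \<rho>) powr (P / \<rho>)" using \<kappa> pos by (intro powr_mono2) auto
        also have "\<dots> = v powr P" using pos by (simp add: powr_powr)
        finally have "K powr \<rho> * \<kappa> powr (- P / \<rho>) * \<kappa> powr (P / \<rho>) \<le> C1 * v powr P"
          unfolding C1_def by (intro mult_left_mono) auto
        then have "K powr \<rho> \<le> C1 * v powr P" using \<kappa> by (simp add: powr_minus mult.assoc)
        then show ?thesis using vKr \<kappa> by linarith
      qed
      then show "w z powr \<rho> \<le> m powr (- d * \<rho>) * (\<kappa> + C1 * m powr (d * P) * w z powr P)"
        unfolding wr mult.assoc vP by (intro mult_left_mono) auto
    qed
    have I_le: "I s powr\<^sub>e \<alpha> \<le> ennreal (m powr -2 * (2 * \<kappa> * c0) powr \<alpha>) * indicator S s + ennreal C2 * J s" for s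
    proof (cases "s \<in> S \<and> J s < top")
      case True
      then obtain j where j: "J s = ennreal j" "0 \<le> j" by (cases "J s") auto
      have "I s \<le> (\<integral>\<^sup>+y. ennreal (m powr (- d * \<rho>) * \<kappa>) * indicator (B s) y + ennreal (m powr (- d * \<rho>) * C1 * m powr (d * P)) * ennreal (w (s, y) powr P) \<partial>lborel)"
        unfolding I_def
      proof (rule nn_integral_mono)
        fix y
        show "ennreal (w (s, y) powr \<rho>) \<le> ennreal (m powr (- d * \<rho>) * \<kappa>) * indicator (B s) y + ennreal (m powr (- d * \<rho>) * C1 * m powr (d * P)) * ennreal (w (s, y) powr P)"
        proof (cases "w (s, y) = 0")
          case False
          then have "y \<in> B s" using supp by blast
          have "ennreal (w (s, y) powr \<rho>) \<le> ennreal (m powr (- d * \<rho>) * (\<kappa> + C1 * m powr (d * P) * w (s, y) powr P))"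
            by (intro ennreal_leI pt)
          also have "\<dots> = ennreal (m powr (- d * \<rho>) * \<kappa>) + ennreal (m powr (- d * \<rho>) * C1 * m powr (d * P)) * ennreal (w (s, y) powr P)"
            using \<kappa> C1 by (simp add: distrib_left mult.assoc flip: ennreal_plus ennreal_mult')
          finally show ?thesis using \<open>y \<in> B s\<close> by simp
        qed (use pos in simp)
      qed
      also have "\<dots> = ennreal (m powr (- d * \<rho>) * \<kappa>) * emeasure lborel (B s) + ennreal (m powr (- d * \<rho>) * C1 * m powr (d * P)) * J s"
        unfolding J_def by (simp add: nn_integral_add nn_integral_cmult)
      also have "\<dots> \<le> ennreal (m powr (- d * \<rho>) * \<kappa>) * ennreal (c0 * m powr d) + ennreal (m powr (- d * \<rho>) * C1 * m powr (d * P)) * ennreal j"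
        unfolding j d_def by (intro add_mono mult_left_mono Bm) auto
      also have "\<dots> = ennreal (m powr (- d * \<rho>) * \<kappa> * (c0 * m powr d) + m powr (- d * \<rho>) * C1 * m powr (d * P) * j)"
        using \<kappa> C1 j pos by (simp flip: ennreal_plus ennreal_mult')
      also have "m powr (- d * \<rho>) * \<kappa> * (c0 * m powr d) + m powr (- d * \<rho>) * C1 * m powr (d * P) * j = m powr (d - d * \<rho>) * (\<kappa> * c0 + C1 * m\<^sup>2 * j)"
      proof -
        have "d * P = d + 2" using scal(2) by linarith
        then have "m powr (d * P) = m powr d * m\<^sup>2" using m by (simp add: powr_add)
        moreover have "m powr (d - d * \<rho>) = m powr d * m powr (- d * \<rho>)" using m by (simp add: powr_add[symmetric])
        ultimately show ?thesis by (simp add: distrib_left mult_ac)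
      qed
      finally have I1: "I s \<le> ennreal (m powr (d - d * \<rho>) * (\<kappa> * c0 + C1 * m\<^sup>2 * j))" .
      have "I s \<le> (\<integral>\<^sup>+y. ennreal (m powr (- d * \<rho>) * K powr \<rho>) * indicator (B s) y \<partial>lborel)"
        unfolding I_def
      proof (rule nn_integral_mono)
        fix y
        show "ennreal (w (s, y) powr \<rho>) \<le> ennreal (m powr (- d * \<rho>) * K powr \<rho>) * indicator (B s) y"
        proof (cases "w (s, y) = 0")
          case False
          then have "y \<in> B s" using supp by blast
          then show ?thesis using ptK by (simp add: ennreal_leI)
        qed (use pos in simp)
      qed
      also have "\<dots> = ennreal (m powr (- d * \<rho>) * K powr \<rho>) * emeasure lborel (B s)"
        by (simp add: nn_integral_cmult)
      also have "\<dots> \<le> ennreal (m powr (- d * \<rho>) * K powr \<rho>) * ennreal (c0 * m powr d)"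
        unfolding d_def by (intro mult_left_mono Bm) auto
      also have "\<dots> = ennreal (m powr (- d * \<rho>) * K powr \<rho> * (c0 * m powr d))"
        by (simp flip: ennreal_mult')
      also have "m powr (- d * \<rho>) * K powr \<rho> * (c0 * m powr d) = m powr (d - d * \<rho>) * L"
      proof -
        have "m powr (d - d * \<rho>) = m powr d * m powr (- d * \<rho>)" using m by (simp add: powr_add[symmetric])
        then show ?thesis by (simp add: L_def mult_ac)
      qed
      finally have I2: "I s \<le> ennreal (m powr (d - d * \<rho>) * L)" .
      have mp: "(m powr (d - d * \<rho>) * z) powr \<alpha> = m powr -2 * z powr \<alpha>" if "0 \<le> z" for z
        using that m scal(1) by (simp add: powr_mult powr_powr)
      \<comment> \<open>A Chebyshev argument in time. Raising \<open>I1\<close> to the power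
        \<alpha> directly would produce a power of j that a multiple of j need not control. Instead,
        either the part with j is dominated by the part with \<kappa>, or m^2 j is bounded below and
        the crude bound \<open>I2\<close> is itself at most a multiple of j.\<close>
      have "I s powr\<^sub>e \<alpha> \<le> ennreal (m powr -2 * (2 * \<kappa> * c0) powr \<alpha> + C2 * j)"
      proof (cases "C1 * m\<^sup>2 * j \<le> \<kappa> * c0")
        case True
        have "I s \<le> ennreal (m powr (d - d * \<rho>) * (2 * \<kappa> * c0))"
          using I1 True by (elim order_trans) (auto intro!: ennreal_leI mult_left_mono)
        then have "I s powr\<^sub>e \<alpha> \<le> ennreal (m powr (d - d * \<rho>) * (2 * \<kappa> * c0)) powr\<^sub>e \<alpha>"
          using pos by (intro ennreal_powr_mono) auto
        also have "\<dots> = ennreal (m powr -2 * (2 * \<kappa> * c0) powr \<alpha>)"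
          using mp[of "2 * \<kappa> * c0"] \<kappa> pos by (simp add: ennreal_powr_ennreal)
        also have "\<dots> \<le> ennreal (m powr -2 * (2 * \<kappa> * c0) powr \<alpha> + C2 * j)"
          using C2 j by (intro ennreal_leI) simp
        finally show ?thesis .
      next
        case False
        then have "1 \<le> C1 * m\<^sup>2 * j / (\<kappa> * c0)" using \<kappa> pos by simp
        then have "m powr -2 * L powr \<alpha> * 1 \<le> m powr -2 * L powr \<alpha> * (C1 * m\<^sup>2 * j / (\<kappa> * c0))"
          by (intro mult_left_mono) auto
        also have "\<dots> = C2 * j" using m by (simp add: C2_def powr_minus field_simps)
        finally have le: "m powr -2 * L powr \<alpha> \<le> C2 * j" by simp
        have "I s powr\<^sub>e \<alpha> \<le> ennreal (m powr (d - d * \<rho>) * L) powr\<^sub>e \<alpha>"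
          using pos I2 by (intro ennreal_powr_mono) auto
        also have "\<dots> = ennreal (m powr -2 * L powr \<alpha>)"
          using mp[of L] L by (simp add: ennreal_powr_ennreal)
        also have "\<dots> \<le> ennreal (m powr -2 * (2 * \<kappa> * c0) powr \<alpha> + C2 * j)"
        proof (rule ennreal_leI)
          have "0 \<le> m powr -2 * (2 * \<kappa> * c0) powr \<alpha>" by simp
          then show "m powr -2 * L powr \<alpha> \<le> m powr -2 * (2 * \<kappa> * c0) powr \<alpha> + C2 * j" using le by linarith
        qed
        finally show ?thesis .
      qed
      also have "\<dots> = ennreal (m powr -2 * (2 * \<kappa> * c0) powr \<alpha>) * indicator S s + ennreal C2 * J s"
        using True j C2 by (simp flip: ennreal_mult')
      finally show ?thesis .
    next
      case False
      then consider "s \<notin> S" | "J s = top" by (auto simp: less_top[symmetric])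
      then show ?thesis
      proof cases
        case 1
        then have "w (s, y) = 0" for y using supp by blast
        then have "I s = 0" by (simp add: I_def)
        then show ?thesis by simp
      next
        case 2
        then show ?thesis using C2 by (simp add: ennreal_mult_top)
      qed
    qed
    have "mixed_integral \<alpha> (\<lambda>z. ennreal (w z powr \<rho>)) = (\<integral>\<^sup>+s. I s powr\<^sub>e \<alpha> \<partial>lborel)"
      by (simp add: mixed_integral_def I_def)
    also have "\<dots> \<le> (\<integral>\<^sup>+s. ennreal (m powr -2 * (2 * \<kappa> * c0) powr \<alpha>) * indicator S s + ennreal C2 * J s \<partial>lborel)"
      by (intro nn_integral_mono I_le)
    also have "\<dots> = ennreal (m powr -2 * (2 * \<kappa> * c0) powr \<alpha>) * emeasure lborel S + ennreal C2 * (\<integral>\<^sup>+s. J s \<partial>lborel)"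
      by (simp add: nn_integral_add nn_integral_cmult)
    also have "\<dots> \<le> ennreal (m powr -2 * (2 * \<kappa> * c0) powr \<alpha>) * ennreal (c1 * m\<^sup>2) + ennreal C2 * (\<integral>\<^sup>+s. J s \<partial>lborel)"
      by (intro add_right_mono mult_left_mono Sm) auto
    \<comment> \<open>The factor m^-2 from the scaling relation meets the length m^2 of the time
      set, and the scale disappears.\<close>
    also have "ennreal (m powr -2 * (2 * \<kappa> * c0) powr \<alpha>) * ennreal (c1 * m\<^sup>2) = ennreal (c1 * (2 * \<kappa> * c0) powr \<alpha>)"
    proof -
      have "m powr -2 * (2 * \<kappa> * c0) powr \<alpha> * (c1 * m\<^sup>2) = c1 * (2 * \<kappa> * c0) powr \<alpha>"
        using m by (simp add: powr_minus field_simps)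
      moreover have "0 \<le> m powr -2 * (2 * \<kappa> * c0) powr \<alpha>" by simp
      ultimately show ?thesis by (metis ennreal_mult')
    qed
    also have "2 * \<kappa> * c0 = (\<eta> / c1) powr (1 / \<alpha>)" using pos by (simp add: \<kappa>_def)
    also have "c1 * ((\<eta> / c1) powr (1 / \<alpha>)) powr \<alpha> = \<eta>" using pos by (simp add: powr_powr)
    finally show "mixed_integral \<alpha> (\<lambda>z. ennreal (w z powr \<rho>)) \<le> ennreal \<eta> + ennreal C2 * mixed_integral 1 (\<lambda>z. ennreal (w z powr P))"
      by (simp add: mixed_integral_def J_def)
  qed
qed

section \<open>Cross terms of wave packets\<close>

text \<open>If U represents the evolution of a profile, this is the modulus of the evolution of its
  image under the symmetry group. Phases are dropped, as only moduli enter the estimates.\<close>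

definition packet :: "(real \<times> (real ^ 'n) \<Rightarrow> complex) \<Rightarrow> real \<Rightarrow> real ^ 'n \<Rightarrow> real ^ 'n \<Rightarrow> real \<Rightarrow> real \<times> (real ^ 'n) \<Rightarrow> real" where
  "packet U h \<xi> x t z = h powr (- (real CARD('n) / 2)) * cmod (U (galilei h \<xi> x t z))"

text \<open>Large values are replaced by 0 rather than clipped, so that at each point U belongs
  entirely either to the truncation or to the remainder.\<close>

definition truncate :: "real \<Rightarrow> (real \<times> (real ^ 'n) \<Rightarrow> complex) \<Rightarrow> real \<times> (real ^ 'n) \<Rightarrow> complex" where
  "truncate R U z = (if \<bar>fst z\<bar> \<le> R \<and> norm (snd z) \<le> R \<and> cmod (U z) \<le> R then U z else 0)"

lemma measurable_truncate [measurable]: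
  assumes [measurable]: "U \<in> borel_measurable2"
  shows "truncate R U \<in> borel_measurable2"
  unfolding truncate_def by measurable

lemma measurable_packet [measurable]:
  assumes [measurable]: "U \<in> borel_measurable2"
  shows "packet U h \<xi> x t \<in> borel_measurable2"
  unfolding packet_def by measurable

lemma packet_nonneg [simp]: "0 \<le> packet U h \<xi> x t z"
  by (simp add: packet_def)

text \<open>Admissibility enters here: it makes the powers of h from the amplitude, from space and
  from time cancel.\<close>

lemma mixed_gauge_packet:
  fixes U :: "real \<times> (real ^ 'n) \<Rightarrow> complex"
  assumes [measurable]: "U \<in> borel_measurable2" and "0 < h"
    and scal: "(real CARD('n) - real CARD('n) * (r / 2)) * \<alpha> = -2"
  shows "mixed_gauge \<alpha> (\<lambda>z. ennreal (packet U h \<xi> x t z powr r)) = mixed_gauge \<alpha> (\<lambda>z. ennreal (cmod (U z) powr r))"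
proof -
  have "ennreal (packet U h \<xi> x t z powr r) = ennreal (h powr (- (real CARD('n) / 2) * r)) * ennreal (cmod (U (galilei h \<xi> x t z)) powr r)" for z
    by (simp add: packet_def powr_mult powr_powr flip: ennreal_mult')
  moreover have "mixed_gauge \<alpha> (\<lambda>z. ennreal (h powr (- (real CARD('n) / 2) * r)) * ennreal (cmod (U (galilei h \<xi> x t z)) powr r))
      = mixed_gauge \<alpha> (\<lambda>z. ennreal (cmod (U z) powr r))"
    by (rule mixed_gauge_galilei[where f = "\<lambda>z. ennreal (cmod (U z) powr r)"]) (use assms in \<open>auto simp: algebra_simps\<close>)
  ultimately show ?thesis by simp
qed

text \<open>The product lives where the narrower packet lives, and since amplitudes decrease with
  the width, both factors are bounded by the narrower amplitude times R. So the localized estimate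
  applies with m the smaller of the two scales. The order of quantifiers is essential: one C serves
  all functions and all parameters.\<close>

lemma packet_truncate_product_le:
  fixes \<alpha> r P R \<eta> :: real
  assumes pos: "0 < \<alpha>" "0 < r" "0 < P" "0 < R" "0 < \<eta>"
    and scal: "(real CARD('n) - real CARD('n) * (r / 2)) * \<alpha> = -2" "real CARD('n) - real CARD('n) * P = -2"
  shows "\<exists>C>0. \<forall>U\<in>borel_measurable2. \<forall>V\<in>borel_measurable2. \<forall>h>0. \<forall>h'>0.
    \<forall>(\<xi> :: real ^ 'n) x t \<xi>' x' t'.
    mixed_integral \<alpha> (\<lambda>z. ennreal ((packet (truncate R U) h \<xi> x t z * packet (truncate R V) h' \<xi>' x' t' z) powr (r / 2)))
    \<le> ennreal \<eta> + ennreal C * mixed_integral 1 (\<lambda>z. ennreal ((packet (truncate R U) h \<xi> x t z * packet (truncate R V) h' \<xi>' x' t' z) powr P))"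
proof -
  let ?w = "\<lambda>(U :: real \<times> (real ^ 'n) \<Rightarrow> complex) h \<xi> x t V h' \<xi>' x' t' z.
    packet (truncate R U) h \<xi> x t z * packet (truncate R V) h' \<xi>' x' t' z"
  define d where "d = real CARD('n)"
  \<comment> \<open>The box at unit scale: c0 is the volume of a ball of radius R, 2 R the length of
    the time interval, and the square of R bounds a product of two truncated values.\<close>
  define c0 where "c0 = unit_ball_vol d * R ^ CARD('n)"
  have c0: "0 < c0" using pos by (simp add: c0_def d_def)
  have pos': "0 < r / 2" "0 < R\<^sup>2" "0 < 2 * R" using pos by auto
  show ?thesis
  proof (rule mixed_integral_localized_le[OF pos(1) pos'(1) pos(3) pos'(2) c0 pos'(3) pos(5) scal], goal_cases)
    case (1 C)
    note C = 1
    have half: "mixed_integral \<alpha> (\<lambda>z. ennreal ((?w U h \<xi> x t V h' \<xi>' x' t' z) powr (r / 2)))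
      \<le> ennreal \<eta> + ennreal C * mixed_integral 1 (\<lambda>z. ennreal ((?w U h \<xi> x t V h' \<xi>' x' t' z) powr P))"
      if h: "0 < h" "h \<le> h'" and [measurable]: "U \<in> borel_measurable2" "V \<in> borel_measurable2"
      for U V :: "real \<times> (real ^ 'n) \<Rightarrow> complex" and h h' \<xi> x t \<xi>' x' t'
    proof (rule C(2)[OF h(1)])
      have tR: "cmod (truncate R W z) \<le> R" for W :: "real \<times> (real ^ 'n) \<Rightarrow> complex" and z
        using pos by (simp add: truncate_def)
      show "?w U h \<xi> x t V h' \<xi>' x' t' z \<le> R\<^sup>2 * h powr (- real CARD('n))" for z
      proof -
        have "h' powr (- (real CARD('n) / 2)) \<le> h powr (- (real CARD('n) / 2))"
          using h by (intro powr_mono2') auto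
        then have "?w U h \<xi> x t V h' \<xi>' x' t' z \<le>
            (h powr (- (real CARD('n) / 2)) * R) * (h powr (- (real CARD('n) / 2)) * R)"
          unfolding packet_def using tR pos by (intro mult_mono) auto
        also have "\<dots> = R\<^sup>2 * h powr (- real CARD('n))"
          using h by (simp add: power2_eq_square mult_ac powr_add[symmetric])
        finally show ?thesis .
      qed
      show "emeasure lborel {t - R * h\<^sup>2 .. t + R * h\<^sup>2} \<le> ennreal (2 * R * h\<^sup>2)"
        using pos by simp
      show "emeasure lborel (cball (x + (2 * s) *\<^sub>R \<xi>) (R * h)) \<le> ennreal (c0 * h powr real CARD('n))" for s
        using pos h by (simp add: emeasure_cball c0_def d_def powr_realpow power_mult_distrib mult_ac)
      fix s y
      assume "packet (truncate R U) h \<xi> x t (s, y) * packet (truncate R V) h' \<xi>' x' t' (s, y) \<noteq> 0"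
      then have "truncate R U (galilei h \<xi> x t (s, y)) \<noteq> 0" by (auto simp: packet_def)
      then have "\<bar>(s - t) / h\<^sup>2\<bar> \<le> R" "norm ((y - (x + (2 * s) *\<^sub>R \<xi>)) /\<^sub>R h) \<le> R"
        by (auto simp: truncate_def galilei_def split: if_splits)
      moreover have "norm v \<le> R * h" if "norm (v /\<^sub>R h) \<le> R" for v :: "real ^ 'n"
        using that h by (simp add: field_simps)
      ultimately have "\<bar>s - t\<bar> \<le> R * h\<^sup>2" "norm (y - (x + (2 * s) *\<^sub>R \<xi>)) \<le> R * h"
        using h by (auto simp: abs_divide pos_divide_le_eq)
      then show "s \<in> {t - R * h\<^sup>2 .. t + R * h\<^sup>2} \<and> y \<in> cball (x + (2 * s) *\<^sub>R \<xi>) (R * h)"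
        by (auto simp: dist_norm norm_minus_commute)
    qed auto
    show ?case
    proof (intro exI[of _ C] conjI C(1) ballI allI impI)
      fix U V :: "real \<times> (real ^ 'n) \<Rightarrow> complex" and h h' t t' :: real and \<xi> x \<xi>' x' :: "real ^ 'n"
      assume A: "U \<in> borel_measurable2" "V \<in> borel_measurable2" "0 < h" "0 < h'"
      show "mixed_integral \<alpha> (\<lambda>z. ennreal ((?w U h \<xi> x t V h' \<xi>' x' t' z) powr (r / 2)))
        \<le> ennreal \<eta> + ennreal C * mixed_integral 1 (\<lambda>z. ennreal ((?w U h \<xi> x t V h' \<xi>' x' t' z) powr P))"
      proof (cases "h \<le> h'")
        case True
        then show ?thesis using half A by blast
      next
        case False
        then show ?thesis
          using half[of h' h V U \<xi>' x' t' \<xi> x t] A by (simp add: mult.commute[of "packet (truncate R V) _ _ _ _ _"])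
      qed
    qed
  qed
qed

text \<open>A weighted arithmetic-geometric mean inequality with generous constants. The large
  weight 1 / \<tau> will fall on a small tail, the small weight \<tau> on a fixed finite
  quantity.\<close>

lemma powr_half_mult_le:
  fixes u v \<tau> r :: real
  assumes "0 \<le> u" "0 \<le> v" "0 < \<tau>"
  shows "(u * v) powr (r / 2) \<le> 1 / \<tau> * u powr r + \<tau> * v powr r"
proof -
  define X Y where "X = u powr (r / 2)" and "Y = v powr (r / 2)"
  have XY: "0 \<le> X" "0 \<le> Y" "X * X = u powr r" "Y * Y = v powr r"
    by (auto simp: X_def Y_def powr_add[symmetric])
  have "X * Y \<le> 1 / \<tau> * (X * X) + \<tau> * (Y * Y)"
  proof (cases "X \<le> \<tau> * Y")
    case True
    then have "X * Y \<le> \<tau> * Y * Y" using XY by (intro mult_right_mono) auto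
    moreover have "0 \<le> 1 / \<tau> * (X * X)" using assms XY by simp
    ultimately show ?thesis by (simp add: mult.assoc)
  next
    case False
    then have "Y \<le> X / \<tau>" using assms by (simp add: field_simps)
    then have "X * Y \<le> X * (X / \<tau>)" using XY by (intro mult_left_mono) auto
    moreover have "0 \<le> \<tau> * (Y * Y)" using assms XY by simp
    ultimately show ?thesis by simp
  qed
  then show ?thesis using assms by (simp add: XY(3,4)) (simp add: X_def Y_def powr_mult)
qed

lemma mixed_gauge_tail_tendsto_0:
  fixes U :: "real \<times> (real ^ 'n) \<Rightarrow> complex"
  assumes "0 < \<alpha>" and [measurable]: "U \<in> borel_measurable2"
    and "mixed_gauge \<alpha> (\<lambda>z. ennreal (cmod (U z) powr r)) < top"
  shows "(\<lambda>k. mixed_gauge \<alpha> (\<lambda>z. ennreal (cmod (U z - truncate (real (Suc k)) U z) powr r))) \<longlonglongrightarrow> 0"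
proof -
  define E where "E k = {z. \<bar>fst z\<bar> \<le> real (Suc k) \<and> norm (snd z) \<le> real (Suc k) \<and> cmod (U z) \<le> real (Suc k)}" for k
  have "E k \<in> sets (borel \<Otimes>\<^sub>M borel)" for k
  proof -
    have "{z \<in> space (borel \<Otimes>\<^sub>M borel). \<bar>fst z\<bar> \<le> real (Suc k) \<and> norm (snd z) \<le> real (Suc k) \<and> cmod (U z) \<le> real (Suc k)} \<in> sets (borel \<Otimes>\<^sub>M borel)"
      by measurable
    then show ?thesis by (simp add: E_def space_pair_measure)
  qed
  moreover have "eventually (\<lambda>k. z \<in> E k) sequentially" for z
    using eventually_ge_at_top[of "nat \<lceil>\<bar>fst z\<bar> + norm (snd z) + cmod (U z)\<rceil>"]
  proof eventually_elim
    case (elim k)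
    then have "\<bar>fst z\<bar> + norm (snd z) + cmod (U z) \<le> real (Suc k)" by linarith
    then show ?case
      using abs_ge_zero[of "fst z"] norm_ge_zero[of "snd z"] norm_ge_zero[of "U z"] unfolding E_def mem_Collect_eq by linarith
  qed
  ultimately have "(\<lambda>k. mixed_gauge \<alpha> (\<lambda>z. ennreal (cmod (U z) powr r) * indicator (- E k) z)) \<longlonglongrightarrow> 0"
    by (intro mixed_gauge_exhaustion_tendsto_0 assms) auto
  moreover have "ennreal (cmod (U z) powr r) * indicator (- E k) z = ennreal (cmod (U z - truncate (real (Suc k)) U z) powr r)" for z k
    by (auto simp: E_def truncate_def)
  ultimately show ?thesis by simp
qed

text \<open>At each truncation level R the truncated product vanishes in the limit by the localized
  estimate. The rest is bounded uniformly in n, because the gauge of a packet does not depend on its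
  parameters; hence R may tend to infinity after n, and \<tau> to 0 after R.\<close>

lemma mixed_gauge_cross_tendsto_0:
  fixes U V :: "real \<times> (real ^ 'n) \<Rightarrow> complex" and h h' t t' :: "nat \<Rightarrow> real" and \<xi> x \<xi>' x' :: "nat \<Rightarrow> real ^ 'n"
    and \<alpha> r P :: real
  assumes pos: "0 < \<alpha>" "0 < r" "0 < P" and h: "\<And>n. 0 < h n" "\<And>n. 0 < h' n"
    and scal: "(real CARD('n) - real CARD('n) * (r / 2)) * \<alpha> = -2" "real CARD('n) - real CARD('n) * P = -2"
    and U[measurable]: "U \<in> borel_measurable2" and V[measurable]: "V \<in> borel_measurable2"
    and fin: "mixed_gauge \<alpha> (\<lambda>z. ennreal (cmod (U z) powr r)) < top" "mixed_gauge \<alpha> (\<lambda>z. ennreal (cmod (V z) powr r)) < top"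
  defines "A \<equiv> \<lambda>n. packet U (h n) (\<xi> n) (x n) (t n)" and "B \<equiv> \<lambda>n. packet V (h' n) (\<xi>' n) (x' n) (t' n)"
  assumes lim: "(\<lambda>n. mixed_integral 1 (\<lambda>z. ennreal ((A n z * B n z) powr P))) \<longlonglongrightarrow> 0"
  shows "(\<lambda>n. mixed_gauge \<alpha> (\<lambda>z. ennreal ((A n z * B n z) powr (r / 2)))) \<longlonglongrightarrow> 0"
proof (rule tendsto_0_if_limsup_le_0)
  define A1 where "A1 R n = packet (truncate R U) (h n) (\<xi> n) (x n) (t n)" for R n
  define B1 where "B1 R n = packet (truncate R V) (h' n) (\<xi>' n) (x' n) (t' n)" for R n
  define A2 where "A2 R n = packet (\<lambda>z. U z - truncate R U z) (h n) (\<xi> n) (x n) (t n)" for R n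
  define B2 where "B2 R n = packet (\<lambda>z. V z - truncate R V z) (h' n) (\<xi>' n) (x' n) (t' n)" for R n
  define TU where "TU R = mixed_gauge \<alpha> (\<lambda>z. ennreal (cmod (U z - truncate R U z) powr r))" for R
  define TV where "TV R = mixed_gauge \<alpha> (\<lambda>z. ennreal (cmod (V z - truncate R V z) powr r))" for R
  define DU where "DU = mixed_gauge \<alpha> (\<lambda>z. ennreal (cmod (U z) powr r))"
  define DV where "DV = mixed_gauge \<alpha> (\<lambda>z. ennreal (cmod (V z) powr r))"
  define \<beta> where "\<beta> = min \<alpha> 1"
  have \<beta>: "0 < \<beta>" using pos by (simp add: \<beta>_def)
  have [measurable]: "A n \<in> borel_measurable2" "B n \<in> borel_measurable2"
    "A1 R n \<in> borel_measurable2" "B1 R n \<in> borel_measurable2"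
    "A2 R n \<in> borel_measurable2" "B2 R n \<in> borel_measurable2" for R n
    unfolding A_def B_def A1_def B1_def A2_def B2_def by measurable
  have nonneg: "0 \<le> A n z" "0 \<le> B n z" "0 \<le> A1 R n z" "0 \<le> B1 R n z" "0 \<le> A2 R n z" "0 \<le> B2 R n z" for R n z
    by (simp_all add: A_def B_def A1_def B1_def A2_def B2_def)
  have main: "(\<lambda>n. mixed_gauge \<alpha> (\<lambda>z. ennreal ((A1 R n z * B1 R n z) powr (r / 2)))) \<longlonglongrightarrow> 0" if R: "0 < R" for R
  proof -
    have "(\<lambda>n. mixed_integral \<alpha> (\<lambda>z. ennreal ((A1 R n z * B1 R n z) powr (r / 2)))) \<longlonglongrightarrow> 0"
    proof (rule tendsto_0_if_limsup_le_0, rule ennreal_le_epsilon)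
      \<comment> \<open>The constant C obtained below depends on \<eta>, but it multiplies a null
        sequence and so disappears in the upper limit, leaving \<eta> alone.\<close>
      fix \<eta> :: real assume \<eta>: "0 < \<eta>"
      show "limsup (\<lambda>n. mixed_integral \<alpha> (\<lambda>z. ennreal ((A1 R n z * B1 R n z) powr (r / 2)))) \<le> 0 + ennreal \<eta>"
        using packet_truncate_product_le[OF pos R \<eta> scal]
      proof (elim exE conjE, goal_cases)
        case (1 C)
        have C: "mixed_integral \<alpha> (\<lambda>z. ennreal ((A1 R n z * B1 R n z) powr (r / 2)))
          \<le> ennreal \<eta> + ennreal C * mixed_integral 1 (\<lambda>z. ennreal ((A1 R n z * B1 R n z) powr P))" for n
          unfolding A1_def B1_def by (rule 1(2)[rule_format, OF U V h(1) h(2)])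
        have le: "A1 R n z * B1 R n z \<le> A n z * B n z" for n z
          unfolding A1_def B1_def A_def B_def packet_def
          by (intro mult_mono mult_left_mono) (auto simp: truncate_def)
        have "mixed_integral \<alpha> (\<lambda>z. ennreal ((A1 R n z * B1 R n z) powr (r / 2))) \<le>
            ennreal C * mixed_integral 1 (\<lambda>z. ennreal ((A n z * B n z) powr P)) + ennreal \<eta>" for n
        proof (rule order_trans[OF C])
          have "mixed_integral 1 (\<lambda>z. ennreal ((A1 R n z * B1 R n z) powr P)) \<le> mixed_integral 1 (\<lambda>z. ennreal ((A n z * B n z) powr P))"
            by (intro mixed_integral_mono_AE AE_I2 ennreal_leI powr_mono2 le) (use pos nonneg in auto)
          then show "ennreal \<eta> + ennreal C * mixed_integral 1 (\<lambda>z. ennreal ((A1 R n z * B1 R n z) powr P)) \<le>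
            ennreal C * mixed_integral 1 (\<lambda>z. ennreal ((A n z * B n z) powr P)) + ennreal \<eta>"
            by (subst add.commute) (intro add_right_mono mult_left_mono, auto)
        qed
        then have "limsup (\<lambda>n. mixed_integral \<alpha> (\<lambda>z. ennreal ((A1 R n z * B1 R n z) powr (r / 2)))) \<le> ennreal \<eta>"
          by (rule limsup_le_const_add_null) (use ennreal_tendsto_cmult[OF _ lim, of "ennreal C"] in simp)
        then show ?case by simp
      qed
    qed
    then show ?thesis unfolding mixed_gauge_def using pos by (intro tendsto_ennreal_powr_0) auto
  qed
  have gauge: "mixed_gauge \<alpha> (\<lambda>z. ennreal (A n z powr r)) = DU" "mixed_gauge \<alpha> (\<lambda>z. ennreal (B n z powr r)) = DV"
    "mixed_gauge \<alpha> (\<lambda>z. ennreal (A2 R n z powr r)) = TU R" "mixed_gauge \<alpha> (\<lambda>z. ennreal (B2 R n z powr r)) = TV R" for n R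
    unfolding A_def B_def A2_def B2_def DU_def DV_def TU_def TV_def
    by (auto intro!: mixed_gauge_packet h scal(1))
  define L where "L = limsup (\<lambda>n. mixed_gauge \<alpha> (\<lambda>z. ennreal ((A n z * B n z) powr (r / 2))))"
  have L1: "L \<le> ennreal ((1 / \<tau>) powr \<beta>) * (TU R + TV R) + ennreal (\<tau> powr \<beta>) * (DU + DV)" if R: "0 < R" and \<tau>: "0 < \<tau>" for R \<tau>
  proof -
    have "mixed_gauge \<alpha> (\<lambda>z. ennreal ((A n z * B n z) powr (r / 2))) \<le>
      mixed_gauge \<alpha> (\<lambda>z. ennreal ((A1 R n z * B1 R n z) powr (r / 2))) +
        (ennreal ((1 / \<tau>) powr \<beta>) * (TU R + TV R) + ennreal (\<tau> powr \<beta>) * (DU + DV))" for n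
    proof -
      \<comment> \<open>As truncation keeps or drops a value entirely, at each point either both
        truncated factors are the full ones, or one of the remainders equals its full factor; in the
        latter case the weighted inequality puts 1 / \<tau> on that remainder.\<close>
      have pt: "(A n z * B n z) powr (r / 2) \<le> (A1 R n z * B1 R n z) powr (r / 2) +
          (1 / \<tau> * (A2 R n z powr r + B2 R n z powr r) + \<tau> * (A n z powr r + B n z powr r))" for z
      proof -
        have c: "A1 R n z = A n z \<or> A2 R n z = A n z" "B1 R n z = B n z \<or> B2 R n z = B n z"
          unfolding A_def B_def A1_def B1_def A2_def B2_def packet_def by (auto simp: truncate_def)
        have nn: "0 \<le> 1 / \<tau> * A2 R n z powr r" "0 \<le> 1 / \<tau> * B2 R n z powr r" "0 \<le> \<tau> * A n z powr r" "0 \<le> \<tau> * B n z powr r"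
          "0 \<le> (A1 R n z * B1 R n z) powr (r / 2)" using \<tau> by auto
        consider "A1 R n z = A n z" "B1 R n z = B n z" | "A2 R n z = A n z" | "B2 R n z = B n z" using c by blast
        then show ?thesis
        proof cases
          case 1
          show ?thesis using nn unfolding distrib_left 1 by linarith
        next
          case 2
          show ?thesis
            using nn powr_half_mult_le[OF nonneg(1,2)[of n z] \<tau>, of r] unfolding distrib_left 2 by linarith
        next
          case 3
          show ?thesis
            using nn powr_half_mult_le[OF nonneg(2,1)[of n z] \<tau>, of r] unfolding distrib_left 3 mult.commute[of "B n z" "A n z"] by linarith
        qed
      qed
      have split: "ennreal (a + (\<sigma> * (b + c) + \<upsilon> * (d + e))) =
          ennreal a + (ennreal \<sigma> * (ennreal b + ennreal c) + ennreal \<upsilon> * (ennreal d + ennreal e))"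
        if "0 \<le> a" "0 \<le> b" "0 \<le> c" "0 \<le> d" "0 \<le> e" "0 \<le> \<sigma>" "0 \<le> \<upsilon>" for a b c d e \<sigma> \<upsilon>
        using that by (simp add: ennreal_plus ennreal_mult)
      have "mixed_gauge \<alpha> (\<lambda>z. ennreal ((A n z * B n z) powr (r / 2))) \<le>
        mixed_gauge \<alpha> (\<lambda>z. ennreal ((A1 R n z * B1 R n z) powr (r / 2)) +
          (ennreal (1 / \<tau>) * (ennreal (A2 R n z powr r) + ennreal (B2 R n z powr r)) +
           ennreal \<tau> * (ennreal (A n z powr r) + ennreal (B n z powr r))))"
      proof (rule mixed_gauge_mono[OF pos(1)])
        fix z
        have "ennreal ((A n z * B n z) powr (r / 2)) \<le> ennreal ((A1 R n z * B1 R n z) powr (r / 2) +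
          (1 / \<tau> * (A2 R n z powr r + B2 R n z powr r) + \<tau> * (A n z powr r + B n z powr r)))"
          by (rule ennreal_leI[OF pt])
        also have "\<dots> = ennreal ((A1 R n z * B1 R n z) powr (r / 2)) +
          (ennreal (1 / \<tau>) * (ennreal (A2 R n z powr r) + ennreal (B2 R n z powr r)) +
           ennreal \<tau> * (ennreal (A n z powr r) + ennreal (B n z powr r)))"
          by (rule split) (use \<tau> in auto)
        finally show "ennreal ((A n z * B n z) powr (r / 2)) \<le> \<dots>" .
      qed
      also have "\<dots> \<le> mixed_gauge \<alpha> (\<lambda>z. ennreal ((A1 R n z * B1 R n z) powr (r / 2))) +
          (mixed_gauge \<alpha> (\<lambda>z. ennreal (1 / \<tau>) * (ennreal (A2 R n z powr r) + ennreal (B2 R n z powr r))) +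
           mixed_gauge \<alpha> (\<lambda>z. ennreal \<tau> * (ennreal (A n z powr r) + ennreal (B n z powr r))))"
        by (intro order_trans[OF mixed_gauge_add] add_left_mono mixed_gauge_add pos(1)) measurable
      also have "\<dots> \<le> mixed_gauge \<alpha> (\<lambda>z. ennreal ((A1 R n z * B1 R n z) powr (r / 2))) +
        (ennreal ((1 / \<tau>) powr \<beta>) * (TU R + TV R) + ennreal (\<tau> powr \<beta>) * (DU + DV))"
      proof (intro add_left_mono add_mono)
        have "mixed_gauge \<alpha> (\<lambda>z. ennreal (1 / \<tau>) * (ennreal (A2 R n z powr r) + ennreal (B2 R n z powr r))) =
            ennreal ((1 / \<tau>) powr \<beta>) * mixed_gauge \<alpha> (\<lambda>z. ennreal (A2 R n z powr r) + ennreal (B2 R n z powr r))"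
          unfolding \<beta>_def using \<tau> by (intro mixed_gauge_cmult pos) auto
        also have "\<dots> \<le> ennreal ((1 / \<tau>) powr \<beta>) * (TU R + TV R)"
          unfolding gauge(3,4)[where n = n, symmetric] by (intro mult_left_mono mixed_gauge_add pos(1)) auto
        finally show "mixed_gauge \<alpha> (\<lambda>z. ennreal (1 / \<tau>) * (ennreal (A2 R n z powr r) + ennreal (B2 R n z powr r))) \<le>
          ennreal ((1 / \<tau>) powr \<beta>) * (TU R + TV R)" .
        have "mixed_gauge \<alpha> (\<lambda>z. ennreal \<tau> * (ennreal (A n z powr r) + ennreal (B n z powr r))) =
            ennreal (\<tau> powr \<beta>) * mixed_gauge \<alpha> (\<lambda>z. ennreal (A n z powr r) + ennreal (B n z powr r))"
          unfolding \<beta>_def using \<tau> by (intro mixed_gauge_cmult pos) auto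
        also have "\<dots> \<le> ennreal (\<tau> powr \<beta>) * (DU + DV)"
          unfolding gauge(1,2)[where n = n, symmetric] by (intro mult_left_mono mixed_gauge_add pos(1)) auto
        finally show "mixed_gauge \<alpha> (\<lambda>z. ennreal \<tau> * (ennreal (A n z powr r) + ennreal (B n z powr r))) \<le> ennreal (\<tau> powr \<beta>) * (DU + DV)" .
      qed
      finally show ?thesis .
    qed
    then show ?thesis unfolding L_def using main[OF R] by (rule limsup_le_const_add_null)
  qed
  \<comment> \<open>While \<tau> is fixed the large weight 1 / \<tau> is harmless: the remainders
    tend to 0 along integer truncation levels, which start at 1 because R must be positive.\<close>
  have L2: "L \<le> ennreal (\<tau> powr \<beta>) * (DU + DV)" if \<tau>: "0 < \<tau>" for \<tau>
  proof (rule LIMSEQ_le_const)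
    have "(\<lambda>k. TU (real (Suc k)) + TV (real (Suc k))) \<longlonglongrightarrow> 0 + 0"
      unfolding TU_def TV_def by (intro tendsto_add mixed_gauge_tail_tendsto_0 pos fin U V)
    then have "(\<lambda>k. ennreal ((1 / \<tau>) powr \<beta>) * (TU (real (Suc k)) + TV (real (Suc k)))) \<longlonglongrightarrow> ennreal ((1 / \<tau>) powr \<beta>) * (0 + 0)"
      by (intro ennreal_tendsto_cmult) auto
    from tendsto_add[OF this tendsto_const]
    show "(\<lambda>k. ennreal ((1 / \<tau>) powr \<beta>) * (TU (real (Suc k)) + TV (real (Suc k))) + ennreal (\<tau> powr \<beta>) * (DU + DV)) \<longlonglongrightarrow> ennreal (\<tau> powr \<beta>) * (DU + DV)"
      by simp
    show "\<exists>N. \<forall>k\<ge>N. L \<le> ennreal ((1 / \<tau>) powr \<beta>) * (TU (real (Suc k)) + TV (real (Suc k))) + ennreal (\<tau> powr \<beta>) * (DU + DV)"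
      using L1[OF _ \<tau>] by auto
  qed
  show "L \<le> 0"
  proof (rule LIMSEQ_le_const)
    have "(\<lambda>k. 1 / real (Suc k)) \<longlonglongrightarrow> 0" by (rule LIMSEQ_Suc[OF lim_1_over_n])
    then have "(\<lambda>k. (1 / real (Suc k)) powr \<beta>) \<longlonglongrightarrow> 0"
      using \<beta> by (intro tendsto_zero_powrI[where b = \<beta>]) auto
    then have "(\<lambda>k. ennreal ((1 / real (Suc k)) powr \<beta>)) \<longlonglongrightarrow> 0" by (metis ennreal_0 tendsto_ennrealI)
    moreover have "DU + DV < top" using fin by (simp add: DU_def DV_def)
    ultimately have "(\<lambda>k. (DU + DV) * ennreal ((1 / real (Suc k)) powr \<beta>)) \<longlonglongrightarrow> (DU + DV) * 0"
      by (intro ennreal_tendsto_cmult)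
    then show "(\<lambda>k. ennreal ((1 / real (Suc k)) powr \<beta>) * (DU + DV)) \<longlonglongrightarrow> 0" by (simp add: mult.commute)
    show "\<exists>N. \<forall>k\<ge>N. L \<le> ennreal ((1 / real (Suc k)) powr \<beta>) * (DU + DV)"
      using L2 by auto
  qed
qed

section \<open>The profile sum\<close>

text \<open>Two exceptional null sets are combined on each slice: that of Galilean covariance, and
  the affine image of the set where U fails to represent the evolution of \<phi> at the rescaled
  time.\<close>

lemma cmod_schroedinger_sym_group_AE:
  fixes \<phi> :: "real ^ 'n \<Rightarrow> complex" and U :: "real \<times> (real ^ 'n) \<Rightarrow> complex"
  assumes "\<phi> \<in> Lp_space 2" "0 < h" "\<And>\<tau>. AE y in lborel. schroedinger \<tau> \<phi> y = U (\<tau>, y)"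
  shows "AE y in lborel. cmod (schroedinger s (sym_group \<theta> h \<xi> x t \<phi>) y) = packet U h \<xi> x t (s, y)"
  using schroedinger_sym_group_AE[OF assms(1,2), where s = s and \<theta> = \<theta> and ?\<xi>0.0 = \<xi> and ?x0.0 = x and ?t0.0 = t]
    AE_affine[OF assms(2) assms(3)[of "(s - t) / h\<^sup>2"], of "x + (2 * s) *\<^sub>R \<xi>"]
proof eventually_elim
  case (elim y)
  then show ?case
    by (simp add: norm_mult packet_def galilei_def powr_minus_divide norm_divide)
qed

lemma limsup_mixed_norm_profiles_le:
  fixes \<phi> :: "nat \<Rightarrow> real ^ 'n \<Rightarrow> complex" and h t :: "nat \<Rightarrow> nat \<Rightarrow> real" and \<xi> x :: "nat \<Rightarrow> nat \<Rightarrow> real ^ 'n"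
    and q r P :: real
  assumes qr: "0 < q" "0 < r" "2 / q + real CARD('n) / r = real CARD('n) / 2" and P: "P = 1 + 2 / real CARD('n)"
    and I: "finite I" and \<phi>: "\<And>j. j \<in> I \<Longrightarrow> \<phi> j \<in> Lp_space 2" and h: "\<And>j n. j \<in> I \<Longrightarrow> 0 < h j n"
  defines "F \<equiv> \<lambda>j n s. schroedinger s (sym_group 0 (h j n) (\<xi> j n) (x j n) (t j n) (\<phi> j))"
  assumes cross: "\<And>j k. j \<in> I \<Longrightarrow> k \<in> I \<Longrightarrow> j \<noteq> k \<Longrightarrow>
      limsup (\<lambda>n. mixed_norm (ennreal P) (ennreal P) (\<lambda>s y. F j n s y * F k n s y)) = 0"
  shows "limsup (\<lambda>n. mixed_norm (ennreal q) (ennreal r) (\<lambda>s y. \<Sum>j\<in>I. F j n s y) powr\<^sub>e (min q r)) \<le>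
    (\<Sum>j\<in>I. mixed_norm (ennreal q) (ennreal r) (\<lambda>s. schroedinger s (\<phi> j)) powr\<^sub>e (min q r))"
proof -
  define \<alpha> where "\<alpha> = q / r"
  define \<beta> where "\<beta> = min \<alpha> 1"
  have \<alpha>: "0 < \<alpha>" using qr by (simp add: \<alpha>_def)
  have P0: "0 < P" by (simp add: P add_pos_nonneg)
  \<comment> \<open>Admissibility, and the definition of the diagonal exponent, in the form in which
    they cancel powers of the scale.\<close>
  have scal: "(real CARD('n) - real CARD('n) * (r / 2)) * \<alpha> = -2" "real CARD('n) - real CARD('n) * P = -2"
  proof -
    have "(real CARD('n) - real CARD('n) * (r / 2)) * \<alpha> = q * (real CARD('n) / r - real CARD('n) / 2)"
      using qr(1,2) by (simp add: \<alpha>_def field_simps)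
    also have "real CARD('n) / r - real CARD('n) / 2 = - (2 / q)" using qr(3) by linarith
    finally show "(real CARD('n) - real CARD('n) * (r / 2)) * \<alpha> = -2" using qr(1) by simp
    show "real CARD('n) - real CARD('n) * P = -2" by (simp add: P field_simps)
  qed
  have "\<exists>U. U \<in> borel_measurable2 \<and> (\<forall>\<tau>. AE y in lborel. schroedinger \<tau> (\<phi> j) y = U (\<tau>, y))" if j: "j \<in> I" for j
  proof -
    obtain V where "(\<lambda>(t, x). V t x) \<in> borel_measurable2" "\<And>t. AE x in lborel. schroedinger t (\<phi> j) x = V t x"
      using schroedinger_jointly_measurable[OF \<phi>[OF j]] by blast
    then show ?thesis by (intro exI[of _ "\<lambda>(t, x). V t x"]) auto
  qed
  then obtain U where Um: "\<And>j. j \<in> I \<Longrightarrow> U j \<in> borel_measurable2"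
    and UAE: "\<And>j \<tau>. j \<in> I \<Longrightarrow> AE y in lborel. schroedinger \<tau> (\<phi> j) y = U j (\<tau>, y)"
    by metis
  define p where "p j n = packet (U j) (h j n) (\<xi> j n) (x j n) (t j n)" for j n
  have pF: "AE y in lborel. cmod (F j n s y) = p j n (s, y)" if "j \<in> I" for j n s
    unfolding F_def p_def by (intro cmod_schroedinger_sym_group_AE \<phi> h UAE that)
  have pm: "p j n \<in> borel_measurable2" if "j \<in> I" for j n
    unfolding p_def by (intro measurable_packet Um that)
  have p0: "0 \<le> p j n z" for j n z by (simp add: p_def)
  define D where "D j = mixed_gauge \<alpha> (\<lambda>z. ennreal (cmod (U j z) powr r))" for j
  have RHS: "mixed_norm (ennreal q) (ennreal r) (\<lambda>s. schroedinger s (\<phi> j)) powr\<^sub>e (min q r) = D j" if "j \<in> I" for j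
    unfolding mixed_norm_powr_eq_mixed_gauge[OF qr(1,2)] \<alpha>_def[symmetric] D_def
  proof (rule antisym; rule mixed_gauge_mono_AE[OF \<alpha>])
    fix s
    show "AE y in lborel. ennreal (cmod (schroedinger (fst (s, y)) (\<phi> j) (snd (s, y))) powr r) \<le> ennreal (cmod (U j (s, y)) powr r)"
      using UAE[OF that, of s] by eventually_elim simp
    show "AE y in lborel. ennreal (cmod (U j (s, y)) powr r) \<le> ennreal (cmod (schroedinger (fst (s, y)) (\<phi> j) (snd (s, y))) powr r)"
      using UAE[OF that, of s] by eventually_elim simp
  qed
  have pD: "mixed_gauge \<alpha> (\<lambda>z. ennreal (p j n z powr r)) = D j" if "j \<in> I" for j n
    unfolding p_def D_def by (intro mixed_gauge_packet Um h scal that)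
  have "limsup (\<lambda>n. mixed_norm (ennreal q) (ennreal r) (\<lambda>s y. \<Sum>j\<in>I. F j n s y) powr\<^sub>e (min q r)) \<le> (\<Sum>j\<in>I. D j)"
  proof (rule ennreal_le_epsilon)
    \<comment> \<open>The rule supplies finiteness of the right-hand side, the infinite case being
      trivial. So each profile has a finite gauge, as the cross-term limit requires.\<close>
    fix e :: real assume fin: "(\<Sum>j\<in>I. D j) < top" and e: "0 < e"
    then obtain S where S: "(\<Sum>j\<in>I. D j) = ennreal S" "0 \<le> S" by (cases "\<Sum>j\<in>I. D j") auto
    have Dfin: "D j < top" if "j \<in> I" for j
      using fin I that by (simp add: ennreal_sum_less_top)
    \<comment> \<open>The denominator S + 1 gives \<epsilon> S <= e and stays positive when S =
      0.\<close>
    define \<epsilon> where "\<epsilon> = e / (S + 1)"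
    have \<epsilon>: "0 < \<epsilon>" using S e by (simp add: \<epsilon>_def)
    define Q where "Q = {(j, k). j \<in> I \<and> k \<in> I \<and> j \<noteq> k}"
    have Q: "finite Q" using I by (rule_tac finite_subset[of _ "I \<times> I"]) (auto simp: Q_def)
    have "\<exists>C\<ge>0. (\<forall>a. (\<forall>i\<in>I. (0::real) \<le> a i) \<longrightarrow>
      (\<Sum>i\<in>I. a i) powr r \<le> (1 + \<epsilon>) * (\<Sum>i\<in>I. a i powr r) + C * (\<Sum>(i, k)\<in>Q. (a i * a k) powr (r / 2)))"
      unfolding Q_def
    proof (rule powr_sum_le_cross_terms[OF qr(2) I \<epsilon>], goal_cases)
      case (1 C)
      show ?case by (intro exI[of _ C] conjI 1(1) allI impI, rule 1(2)) auto
    qed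
    then obtain C where C: "0 \<le> C" "\<forall>a. (\<forall>i\<in>I. (0::real) \<le> a i) \<longrightarrow>
      (\<Sum>i\<in>I. a i) powr r \<le> (1 + \<epsilon>) * (\<Sum>i\<in>I. a i powr r) + C * (\<Sum>(i, k)\<in>Q. (a i * a k) powr (r / 2))"
      by (elim exE conjE) (rule that)
    define X where "X jk n = mixed_gauge \<alpha> (\<lambda>z. ennreal ((p (fst jk) n z * p (snd jk) n z) powr (r / 2)))" for jk n
    have Xlim: "X jk \<longlonglongrightarrow> 0" if jk: "jk \<in> Q" for jk
      unfolding X_def p_def
    proof (rule mixed_gauge_cross_tendsto_0[OF \<alpha> qr(2) P0 _ _ scal])
      have I2: "fst jk \<in> I" "snd jk \<in> I" "fst jk \<noteq> snd jk" using jk by (auto simp: Q_def)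
      show "0 < h (fst jk) n" "0 < h (snd jk) n" for n using h I2 by auto
      show "U (fst jk) \<in> borel_measurable2" "U (snd jk) \<in> borel_measurable2" using Um I2 by auto
      show "mixed_gauge \<alpha> (\<lambda>z. ennreal (cmod (U (fst jk) z) powr r)) < top" "mixed_gauge \<alpha> (\<lambda>z. ennreal (cmod (U (snd jk) z) powr r)) < top"
        using Dfin I2 by (auto simp: D_def)
      have "(\<lambda>n. mixed_norm (ennreal P) (ennreal P) (\<lambda>s y. F (fst jk) n s y * F (snd jk) n s y)) \<longlonglongrightarrow> 0"
        by (rule tendsto_0_if_limsup_le_0) (simp add: cross I2)
      then have "(\<lambda>n. mixed_norm (ennreal P) (ennreal P) (\<lambda>s y. F (fst jk) n s y * F (snd jk) n s y) powr\<^sub>e P) \<longlonglongrightarrow> 0"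
        by (rule tendsto_ennreal_powr_0[OF P0])
      moreover have "mixed_integral 1 (\<lambda>z. ennreal ((p (fst jk) n z * p (snd jk) n z) powr P)) \<le>
          mixed_norm (ennreal P) (ennreal P) (\<lambda>s y. F (fst jk) n s y * F (snd jk) n s y) powr\<^sub>e P" for n
      proof -
        have "mixed_integral 1 (\<lambda>z. ennreal ((p (fst jk) n z * p (snd jk) n z) powr P)) \<le>
            mixed_integral 1 (\<lambda>z. ennreal (cmod (F (fst jk) n (fst z) (snd z) * F (snd jk) n (fst z) (snd z)) powr P))"
        proof (rule mixed_integral_mono_AE)
          fix s
          show "AE y in lborel. ennreal ((p (fst jk) n (s, y) * p (snd jk) n (s, y)) powr P) \<le>
              ennreal (cmod (F (fst jk) n (fst (s, y)) (snd (s, y)) * F (snd jk) n (fst (s, y)) (snd (s, y))) powr P)"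
            using pF[OF I2(1), of n s] pF[OF I2(2), of n s] by eventually_elim (simp add: norm_mult)
        qed simp
        then show ?thesis using P0 by (simp add: mixed_norm_eq_mixed_integral ennreal_powr_powr)
      qed
      ultimately show "(\<lambda>n. mixed_integral 1 (\<lambda>z. ennreal ((packet (U (fst jk)) (h (fst jk) n) (\<xi> (fst jk) n) (x (fst jk) n) (t (fst jk) n) z *
          packet (U (snd jk)) (h (snd jk) n) (\<xi> (snd jk) n) (x (snd jk) n) (t (snd jk) n) z) powr P))) \<longlonglongrightarrow> 0"
        unfolding p_def by (rule ennreal_tendsto_0_le)
    qed
    have "mixed_norm (ennreal q) (ennreal r) (\<lambda>s y. \<Sum>j\<in>I. F j n s y) powr\<^sub>e (min q r) \<le>
        ennreal (C powr \<beta>) * (\<Sum>jk\<in>Q. X jk n) + ennreal (1 + \<epsilon>) * (\<Sum>j\<in>I. D j)" for n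
    proof -
      have mm: "(\<lambda>z. ennreal ((p (fst jk) n z * p (snd jk) n z) powr (r / 2))) \<in> borel_measurable2" if "jk \<in> Q" for jk
      proof -
        have [measurable]: "p (fst jk) n \<in> borel_measurable2" "p (snd jk) n \<in> borel_measurable2"
          using that pm by (auto simp: Q_def)
        show ?thesis by measurable
      qed
      have mr: "(\<lambda>z. ennreal (p j n z powr r)) \<in> borel_measurable2" if "j \<in> I" for j
      proof -
        have [measurable]: "p j n \<in> borel_measurable2" using that pm by auto
        show ?thesis by measurable
      qed
      have "mixed_norm (ennreal q) (ennreal r) (\<lambda>s y. \<Sum>j\<in>I. F j n s y) powr\<^sub>e (min q r) =
          mixed_gauge \<alpha> (\<lambda>z. ennreal (cmod (\<Sum>j\<in>I. F j n (fst z) (snd z)) powr r))"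
        unfolding mixed_norm_powr_eq_mixed_gauge[OF qr(1,2)] \<alpha>_def ..
      also have "\<dots> \<le> mixed_gauge \<alpha> (\<lambda>z. ennreal (1 + \<epsilon>) * (\<Sum>j\<in>I. ennreal (p j n z powr r)) +
          ennreal C * (\<Sum>jk\<in>Q. ennreal ((p (fst jk) n z * p (snd jk) n z) powr (r / 2))))"
      proof (rule mixed_gauge_mono_AE[OF \<alpha>])
        fix s
        have "AE y in lborel. \<forall>j\<in>I. cmod (F j n s y) = p j n (s, y)"
          using I pF by (intro AE_finite_allI) auto
        then show "AE y in lborel. ennreal (cmod (\<Sum>j\<in>I. F j n (fst (s, y)) (snd (s, y))) powr r) \<le>
          ennreal (1 + \<epsilon>) * (\<Sum>j\<in>I. ennreal (p j n (s, y) powr r)) +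
          ennreal C * (\<Sum>jk\<in>Q. ennreal ((p (fst jk) n (s, y) * p (snd jk) n (s, y)) powr (r / 2)))"
        proof eventually_elim
          case (elim y)
          have "cmod (\<Sum>j\<in>I. F j n s y) \<le> (\<Sum>j\<in>I. p j n (s, y))"
            using elim by (intro sum_norm_le) auto
          then have "cmod (\<Sum>j\<in>I. F j n s y) powr r \<le> (\<Sum>j\<in>I. p j n (s, y)) powr r"
            using qr by (intro powr_mono2) auto
          also have "\<dots> \<le> (1 + \<epsilon>) * (\<Sum>j\<in>I. p j n (s, y) powr r) + C * (\<Sum>(j, k)\<in>Q. (p j n (s, y) * p k n (s, y)) powr (r / 2))"
            by (rule C(2)[rule_format]) (rule p0)
          finally have "ennreal (cmod (\<Sum>j\<in>I. F j n s y) powr r) \<le>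
             ennreal ((1 + \<epsilon>) * (\<Sum>j\<in>I. p j n (s, y) powr r) + C * (\<Sum>jk\<in>Q. (p (fst jk) n (s, y) * p (snd jk) n (s, y)) powr (r / 2)))"
            by (intro ennreal_leI) (simp add: case_prod_beta')
          also have "\<dots> = ennreal (1 + \<epsilon>) * (\<Sum>j\<in>I. ennreal (p j n (s, y) powr r)) +
            ennreal C * (\<Sum>jk\<in>Q. ennreal ((p (fst jk) n (s, y) * p (snd jk) n (s, y)) powr (r / 2)))"
            using C(1) \<epsilon> by (simp add: ennreal_plus[OF mult_nonneg_nonneg mult_nonneg_nonneg] sum_nonneg ennreal_mult sum_ennreal del: ennreal_plus)
          finally show ?case by simp
        qed
      qed
      also have "\<dots> \<le> mixed_gauge \<alpha> (\<lambda>z. ennreal (1 + \<epsilon>) * (\<Sum>j\<in>I. ennreal (p j n z powr r))) +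
          mixed_gauge \<alpha> (\<lambda>z. ennreal C * (\<Sum>jk\<in>Q. ennreal ((p (fst jk) n z * p (snd jk) n z) powr (r / 2))))"
        by (intro mixed_gauge_add \<alpha> borel_measurable_times_ennreal borel_measurable_const borel_measurable_sum mm mr)
      also have "\<dots> = ennreal ((1 + \<epsilon>) powr \<beta>) * mixed_gauge \<alpha> (\<lambda>z. \<Sum>j\<in>I. ennreal (p j n z powr r)) +
          ennreal (C powr \<beta>) * mixed_gauge \<alpha> (\<lambda>z. \<Sum>jk\<in>Q. ennreal ((p (fst jk) n z * p (snd jk) n z) powr (r / 2)))"
        unfolding \<beta>_def using \<epsilon> C(1)
        by (intro arg_cong2[where f = "(+)"] mixed_gauge_cmult \<alpha> borel_measurable_sum mm mr) auto
      also have "\<dots> \<le> ennreal (1 + \<epsilon>) * (\<Sum>j\<in>I. D j) + ennreal (C powr \<beta>) * (\<Sum>jk\<in>Q. X jk n)"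
      proof (intro add_mono mult_mono ennreal_leI)
        \<comment> \<open>The base is at least 1 and \<beta> at most 1, so the homogeneity degree of
          the gauge can be ignored in this factor.\<close>
        show "(1 + \<epsilon>) powr \<beta> \<le> 1 + \<epsilon>"
          using powr_mono[of \<beta> 1 "1 + \<epsilon>"] \<epsilon> by (simp add: \<beta>_def)
        have "mixed_gauge \<alpha> (\<lambda>z. \<Sum>j\<in>I. ennreal (p j n z powr r)) \<le> (\<Sum>j\<in>I. mixed_gauge \<alpha> (\<lambda>z. ennreal (p j n z powr r)))"
          by (intro mixed_gauge_sum \<alpha> I mr)
        also have "\<dots> = (\<Sum>j\<in>I. D j)" by (intro sum.cong refl pD)
        finally show "mixed_gauge \<alpha> (\<lambda>z. \<Sum>j\<in>I. ennreal (p j n z powr r)) \<le> (\<Sum>j\<in>I. D j)" .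
        show "mixed_gauge \<alpha> (\<lambda>z. \<Sum>jk\<in>Q. ennreal ((p (fst jk) n z * p (snd jk) n z) powr (r / 2))) \<le> (\<Sum>jk\<in>Q. X jk n)"
          unfolding X_def by (intro mixed_gauge_sum \<alpha> Q mm)
      qed auto
      finally show ?thesis by (simp add: add.commute)
    qed
    moreover have "(\<lambda>n. ennreal (C powr \<beta>) * (\<Sum>jk\<in>Q. X jk n)) \<longlonglongrightarrow> 0"
    proof -
      have "(\<lambda>n. \<Sum>jk\<in>Q. X jk n) \<longlonglongrightarrow> (\<Sum>jk\<in>Q. 0)" by (intro tendsto_sum Xlim)
      from ennreal_tendsto_cmult[OF _ this, of "ennreal (C powr \<beta>)"] show ?thesis by simp
    qed
    ultimately have "limsup (\<lambda>n. mixed_norm (ennreal q) (ennreal r) (\<lambda>s y. \<Sum>j\<in>I. F j n s y) powr\<^sub>e (min q r)) \<le> ennreal (1 + \<epsilon>) * (\<Sum>j\<in>I. D j)"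
      by (rule limsup_le_const_add_null)
    also have "\<dots> = ennreal (S + \<epsilon> * S)"
      using S \<epsilon> by (simp add: distrib_right flip: ennreal_mult')
    also have "\<dots> \<le> ennreal (S + e)"
      using S e by (intro ennreal_leI) (simp add: \<epsilon>_def field_simps)
    finally show "limsup (\<lambda>n. mixed_norm (ennreal q) (ennreal r) (\<lambda>s y. \<Sum>j\<in>I. F j n s y) powr\<^sub>e (min q r)) \<le> (\<Sum>j\<in>I. D j) + ennreal e"
      using S e by simp
  qed
  then show ?thesis using RHS by simp
qed

section \<open>Infinite time exponent: unitarity and asymptotic orthogonality\<close>

lemma mixed_norm_infinity_2:
  assumes "\<And>s. f s \<in> Lp_space 2" "\<And>s. L2_norm (f s) = c"
  shows "mixed_norm \<infinity> 2 f powr\<^sub>e 2 = ennreal (c\<^sup>2)"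
proof -
  have c: "0 \<le> c" using assms(2)[of 0] L2_norm_nonneg by metis
  have "Lp_norm lborel 2 (\<lambda>x. ennreal (cmod (f s x))) = ennreal c" for s
    using assms nn_integral_eq_L2_norm[OF assms(1), of s] c
    by (simp add: Lp_norm_2 ennreal_powr_ennreal powr_half_sqrt)
  then have "mixed_norm \<infinity> 2 f = esssup lborel (\<lambda>s::real. ennreal c)"
    by (simp add: mixed_norm_def) (simp add: Lp_norm_def)
  also have "\<dots> = ennreal c" by (rule esssup_const) simp
  finally show ?thesis using c by (simp add: ennreal_powr_ennreal powr_numeral)
qed

text \<open>The evolutions are chosen independently and add up only up to null sets, so the
  comparison is made between transforms: the common multiplier of modulus 1 factors out of the
  sum.\<close>

lemma L2_norm_sum_schroedinger:
  fixes f :: "'i \<Rightarrow> real ^ 'n \<Rightarrow> complex"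
  assumes "\<And>j. j \<in> I \<Longrightarrow> f j \<in> Lp_space 2"
  shows "L2_norm (\<lambda>y. \<Sum>j\<in>I. schroedinger s (f j) y) = L2_norm (\<lambda>y. \<Sum>j\<in>I. f j y)"
proof -
  have "\<forall>j\<in>I. \<exists>F. L2_fourier (f j) F" using assms L2_fourier_exists by metis
  then obtain F where F: "\<And>j. j \<in> I \<Longrightarrow> L2_fourier (f j) (F j)" by metis
  have 1: "L2_fourier (\<lambda>y. \<Sum>j\<in>I. f j y) (\<lambda>\<xi>. \<Sum>j\<in>I. F j \<xi>)" by (rule L2_fourier_sum[OF F])
  have 2: "L2_fourier (\<lambda>y. \<Sum>j\<in>I. schroedinger s (f j) y) (\<lambda>\<xi>. \<Sum>j\<in>I. cis (- s * (norm \<xi>)\<^sup>2) * F j \<xi>)"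
    by (rule L2_fourier_sum[OF L2_fourier_schroedinger[OF F]])
  have "L2_norm (\<lambda>\<xi>. \<Sum>j\<in>I. cis (- s * (norm \<xi>)\<^sup>2) * F j \<xi>) = L2_norm (\<lambda>\<xi>. \<Sum>j\<in>I. F j \<xi>)"
    unfolding L2_norm_def sum_distrib_left[symmetric] norm_mult by simp
  then show ?thesis using L2_fourier_norm[OF 1] L2_fourier_norm[OF 2] by simp
qed

lemma L2_norm_sum_le_inner:
  fixes g :: "'i \<Rightarrow> real ^ 'n \<Rightarrow> complex"
  assumes I: "finite I" and g: "\<And>j. j \<in> I \<Longrightarrow> g j \<in> Lp_space 2"
  shows "(L2_norm (\<lambda>y. \<Sum>j\<in>I. g j y))\<^sup>2 \<le>
    (\<Sum>j\<in>I. (L2_norm (g j))\<^sup>2) + (\<Sum>j\<in>I. \<Sum>k\<in>I - {j}. cmod (L2_inner (g j) (g k)))"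
proof -
  have sq: "complex_of_real ((L2_norm f)\<^sup>2) = L2_inner f f" if "f \<in> Lp_space 2" for f :: "real ^ 'n \<Rightarrow> complex"
    using that by (simp add: L2_inner_def L2_norm_power2 complex_norm_square[symmetric] del: of_real_power)
  have int: "integrable lborel (\<lambda>y. g j y * cnj (g k y))" if "j \<in> I" "k \<in> I" for j k
    using g that by (intro integrable_L2_mult) auto
  have S2: "(\<lambda>y. \<Sum>j\<in>I. g j y) \<in> Lp_space 2" by (rule Lp_space_2_sum) (rule g)
  have "L2_inner (\<lambda>y. \<Sum>j\<in>I. g j y) (\<lambda>y. \<Sum>j\<in>I. g j y) = (\<Sum>j\<in>I. LBINT y. (\<Sum>k\<in>I. g j y * cnj (g k y)))"
    unfolding L2_inner_def cnj_sum sum_product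
    by (intro Bochner_Integration.integral_sum Bochner_Integration.integrable_sum int)
  also have "\<dots> = (\<Sum>j\<in>I. \<Sum>k\<in>I. L2_inner (g j) (g k))"
    unfolding L2_inner_def by (intro sum.cong refl Bochner_Integration.integral_sum int)
  also have "\<dots> = (\<Sum>j\<in>I. L2_inner (g j) (g j) + (\<Sum>k\<in>I - {j}. L2_inner (g j) (g k)))"
    using I by (intro sum.cong refl) (simp add: sum.remove)
  also have "\<dots> = complex_of_real (\<Sum>j\<in>I. (L2_norm (g j))\<^sup>2) + (\<Sum>j\<in>I. \<Sum>k\<in>I - {j}. L2_inner (g j) (g k))"
    using sq[OF g] by (simp add: sum.distrib del: of_real_power)
  finally have eq: "complex_of_real ((L2_norm (\<lambda>y. \<Sum>j\<in>I. g j y))\<^sup>2) =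
      complex_of_real (\<Sum>j\<in>I. (L2_norm (g j))\<^sup>2) + (\<Sum>j\<in>I. \<Sum>k\<in>I - {j}. L2_inner (g j) (g k))"
    using sq[OF S2] by simp
  have "(L2_norm (\<lambda>y. \<Sum>j\<in>I. g j y))\<^sup>2 = cmod (complex_of_real ((L2_norm (\<lambda>y. \<Sum>j\<in>I. g j y))\<^sup>2))"
    unfolding norm_of_real by simp
  also have "\<dots> \<le> cmod (complex_of_real (\<Sum>j\<in>I. (L2_norm (g j))\<^sup>2)) + cmod (\<Sum>j\<in>I. \<Sum>k\<in>I - {j}. L2_inner (g j) (g k))"
    unfolding eq by (rule norm_triangle_ineq)
  also have "cmod (complex_of_real (\<Sum>j\<in>I. (L2_norm (g j))\<^sup>2)) = (\<Sum>j\<in>I. (L2_norm (g j))\<^sup>2)"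
    unfolding norm_of_real by (simp add: sum_nonneg)
  also have "cmod (\<Sum>j\<in>I. \<Sum>k\<in>I - {j}. L2_inner (g j) (g k)) \<le> (\<Sum>j\<in>I. \<Sum>k\<in>I - {j}. cmod (L2_inner (g j) (g k)))"
    by (intro sum_norm_le norm_sum)
  finally show ?thesis by simp
qed

text \<open>By unitarity the spatial norm of the sum is constant in time, so the supremum over time
  costs nothing and expanding the square of the norm of the initial data suffices.\<close>

lemma limsup_mixed_norm_infinity_profiles_le:
  fixes \<phi> :: "nat \<Rightarrow> real ^ 'n \<Rightarrow> complex" and h t :: "nat \<Rightarrow> nat \<Rightarrow> real" and \<xi> x :: "nat \<Rightarrow> nat \<Rightarrow> real ^ 'n"
  assumes I: "finite I" and \<phi>: "\<And>j. j \<in> I \<Longrightarrow> \<phi> j \<in> Lp_space 2" and h: "\<And>j n. j \<in> I \<Longrightarrow> 0 < h j n"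
  defines "g \<equiv> \<lambda>j n. sym_group 0 (h j n) (\<xi> j n) (x j n) (t j n) (\<phi> j)"
  assumes cross: "\<And>j k. j \<in> I \<Longrightarrow> k \<in> I \<Longrightarrow> j \<noteq> k \<Longrightarrow> limsup (\<lambda>n. ereal (cmod (L2_inner (g j n) (g k n)))) = 0"
  shows "limsup (\<lambda>n. mixed_norm \<infinity> 2 (\<lambda>s y. \<Sum>j\<in>I. schroedinger s (g j n) y) powr\<^sub>e 2) \<le>
    (\<Sum>j\<in>I. mixed_norm \<infinity> 2 (\<lambda>s. schroedinger s (\<phi> j)) powr\<^sub>e 2)"
proof -
  have gL: "g j n \<in> Lp_space 2" if "j \<in> I" for j n
    unfolding g_def by (intro Lp_space_2_sym_group \<phi> h that)
  have gN: "L2_norm (g j n) = L2_norm (\<phi> j)" if "j \<in> I" for j n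
    unfolding g_def by (intro L2_norm_sym_group \<phi> h that)
  define X where "X n = (\<Sum>j\<in>I. \<Sum>k\<in>I - {j}. cmod (L2_inner (g j n) (g k n)))" for n
  have "(\<lambda>n. cmod (L2_inner (g j n) (g k n))) \<longlonglongrightarrow> 0" if "j \<in> I" "k \<in> I" "j \<noteq> k" for j k
  proof -
    have "(\<lambda>n. ereal (cmod (L2_inner (g j n) (g k n)))) \<longlonglongrightarrow> 0"
    proof (rule Liminf_eq_Limsup)
      show "limsup (\<lambda>n. ereal (cmod (L2_inner (g j n) (g k n)))) = 0" by (rule cross[OF that])
      moreover have "0 \<le> liminf (\<lambda>n. ereal (cmod (L2_inner (g j n) (g k n))))"
        by (rule Liminf_bounded) auto
      ultimately show "liminf (\<lambda>n. ereal (cmod (L2_inner (g j n) (g k n)))) = 0"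
        using Liminf_le_Limsup[of sequentially "\<lambda>n. ereal (cmod (L2_inner (g j n) (g k n)))"] by simp
    qed simp
    then show ?thesis by (simp add: zero_ereal_def)
  qed
  then have "X \<longlonglongrightarrow> (\<Sum>j\<in>I. \<Sum>k\<in>I - {j}. 0)" unfolding X_def by (intro tendsto_sum) auto
  then have "X \<longlonglongrightarrow> 0" by simp
  from tendsto_ennrealI[OF this] have X: "(\<lambda>n. ennreal (X n)) \<longlonglongrightarrow> 0" by simp
  have X0: "0 \<le> X n" for n unfolding X_def by (intro sum_nonneg) auto
  have "mixed_norm \<infinity> 2 (\<lambda>s y. \<Sum>j\<in>I. schroedinger s (g j n) y) powr\<^sub>e 2 \<le>
      ennreal (X n) + (\<Sum>j\<in>I. mixed_norm \<infinity> 2 (\<lambda>s. schroedinger s (\<phi> j)) powr\<^sub>e 2)" for n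
  proof -
    have "mixed_norm \<infinity> 2 (\<lambda>s y. \<Sum>j\<in>I. schroedinger s (g j n) y) powr\<^sub>e 2 = ennreal ((L2_norm (\<lambda>y. \<Sum>j\<in>I. g j n y))\<^sup>2)"
      using gL by (intro mixed_norm_infinity_2 L2_norm_sum_schroedinger Lp_space_2_sum Lp_space_2_schroedinger) auto
    also have "\<dots> \<le> ennreal ((\<Sum>j\<in>I. (L2_norm (g j n))\<^sup>2) + X n)"
      unfolding X_def by (intro ennreal_leI L2_norm_sum_le_inner I gL)
    also have "\<dots> = ennreal (X n) + (\<Sum>j\<in>I. ennreal ((L2_norm (\<phi> j))\<^sup>2))"
      using X0[of n] gN by (simp add: sum_nonneg sum_ennreal add.commute)
    also have "(\<Sum>j\<in>I. ennreal ((L2_norm (\<phi> j))\<^sup>2)) = (\<Sum>j\<in>I. mixed_norm \<infinity> 2 (\<lambda>s. schroedinger s (\<phi> j)) powr\<^sub>e 2)"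
      using \<phi> by (intro sum.cong refl mixed_norm_infinity_2[symmetric] Lp_space_2_schroedinger L2_norm_schroedinger) auto
    finally show ?thesis .
  qed
  then show ?thesis using X by (rule limsup_le_const_add_null)
qed

text \<open>A quotient by infinity is 0 in the extended half-line. If r is infinite, a finite q
  satisfies n q = 4 with q at least 2, which leaves the endpoint (4, \<infinity>) for n = 1 and the
  forbidden pair (2, \<infinity>) for n = 2; an infinite q would give n = 0. If only q is infinite,
  then r = 2.\<close>

lemma admissible_cases:
  assumes ad: "admissible TYPE('n::finite) q r" and ne: "\<not> endpoint TYPE('n) q r"
  obtains (infinite) "q = \<infinity>" "r = 2"
    | (finite) q' r' where "q = ennreal q'" "r = ennreal r'" "2 \<le> q'" "2 \<le> r'" "2 / q' + real CARD('n) / r' = real CARD('n) / 2"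
proof -
  define n where "n = CARD('n)"
  have n: "0 < n" by (simp add: n_def)
  have A: "2 \<le> q" "2 \<le> r" "2 / q + of_nat n / r = of_nat n / 2" "\<not> (q = 2 \<and> r = \<infinity> \<and> n = 2)"
    using ad by (auto simp: admissible_def n_def)
  have B: "\<not> (n = 1 \<and> q = 4 \<and> r = \<infinity>)" using ne by (auto simp: endpoint_def n_def)
  have half: "(of_nat n :: ennreal) / 2 = ennreal (real n / 2)"
    using divide_ennreal[of "real n" 2] by (simp add: ennreal_of_nat_eq_real_of_nat)
  have two: "2 / ennreal a = ennreal (2 / a)" if "2 \<le> a" for a
    using divide_ennreal[of 2 a] that by simp
  have nn: "of_nat n / ennreal a = ennreal (real n / a)" if "2 \<le> a" for a
    using divide_ennreal[of "real n" a] that by (simp add: ennreal_of_nat_eq_real_of_nat)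
  have ge2: "2 \<le> a" if "2 \<le> ennreal a" for a
    using that by (metis ennreal_le_iff2 ennreal_numeral linorder_not_le zero_less_numeral order_less_le_trans not_numeral_le_zero)
  show ?thesis
  proof (cases r)
    case (real r')
    then have r': "2 \<le> r'" using A(2) ge2 by simp
    show ?thesis
    proof (cases q)
      case q: (real q')
      then have q': "2 \<le> q'" using A(1) ge2 by simp
      have "ennreal (2 / q' + real n / r') = ennreal (real n / 2)"
        using A(3) q' r' by (simp add: q real two nn half)
      then have "2 / q' + real n / r' = real n / 2"
        using q' r' by (subst (asm) ennreal_inj) auto
      then show ?thesis using finite[OF q(2) real(2) q' r'] by (simp add: n_def)
    next
      case top
      then have "ennreal (real n / r') = ennreal (real n / 2)"
        using A(3) r' by (simp add: real nn half)
      then have "real n / r' = real n / 2" using r' by simp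
      then have "r' = 2" using n r' by (simp add: field_simps)
      then show ?thesis using infinite top real by simp
    qed
  next
    case top
    show ?thesis
    proof (cases q)
      case q: (real q')
      then have q': "2 \<le> q'" using A(1) ge2 by simp
      have "ennreal (2 / q') = ennreal (real n / 2)"
        using A(3) q' by (simp add: q top two half)
      then have "2 / q' = real n / 2" using q' by simp
      then have nq: "real n * q' = 4" using q' by (simp add: field_simps)
      have "real n * 2 \<le> real n * q'" using q' by (intro mult_left_mono) auto
      then have "n = 1 \<or> n = 2" using nq n by auto
      then show ?thesis
      proof
        assume "n = 1"
        then show ?thesis using B nq q top by auto
      next
        assume "n = 2"
        then show ?thesis using A(4) nq q top by auto
      qed
    next
      case q: top
      then show ?thesis using A(3) top n half by simp
    qed
  qed
qed

theorem lemma1p7: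
  fixes u :: "nat \<Rightarrow> real ^ 'n \<Rightarrow> complex"
    and \<phi> :: "nat \<Rightarrow> real ^ 'n \<Rightarrow> complex"
    and h t :: "nat \<Rightarrow> nat \<Rightarrow> real"
    and \<xi> x :: "nat \<Rightarrow> nat \<Rightarrow> real ^ 'n"
    and q r :: ennreal and N :: nat and \<sigma> :: "nat \<Rightarrow> nat" and C :: real
  assumes "admissible TYPE('n) q r" and "\<not> endpoint TYPE('n) q r"
    and "1 \<le> N"
    and "\<And>n. u n \<in> Lp_space 2" and "\<And>n. L2_norm (u n) \<le> C"
    and "strict_mono \<sigma>"
    and "profile_decomposition (\<lambda>n. u (\<sigma> n)) \<phi> h \<xi> x t"
  shows "(r \<le> q \<longrightarrow>
      limsup (\<lambda>n. mixed_norm q r (\<lambda>s y. \<Sum>j=1..N.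
          schroedinger s (sym_group 0 (h j n) (\<xi> j n) (x j n) (t j n) (\<phi> j)) y)
        powr\<^sub>e enn2real r)
      \<le> (\<Sum>j=1..N. mixed_norm q r (\<lambda>s. schroedinger s (\<phi> j)) powr\<^sub>e enn2real r)) \<and>
    (q \<le> r \<longrightarrow>
      limsup (\<lambda>n. mixed_norm q r (\<lambda>s y. \<Sum>j=1..N.
          schroedinger s (sym_group 0 (h j n) (\<xi> j n) (x j n) (t j n) (\<phi> j)) y)
        powr\<^sub>e enn2real q)
      \<le> (\<Sum>j=1..N. mixed_norm q r (\<lambda>s. schroedinger s (\<phi> j)) powr\<^sub>e enn2real q))"
proof -
  note pd = assms(7)[unfolded profile_decomposition_def Let_def]
  have \<phi>: "\<phi> j \<in> Lp_space 2" and h: "0 < h j n" if "j \<in> {1..N}" for j n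
    using pd that by auto
  have cross: "limsup (\<lambda>n. mixed_norm (ennreal (1 + 2 / real CARD('n))) (ennreal (1 + 2 / real CARD('n)))
          (\<lambda>s y. schroedinger s (sym_group 0 (h j n) (\<xi> j n) (x j n) (t j n) (\<phi> j)) y *
                 schroedinger s (sym_group 0 (h k n) (\<xi> k n) (x k n) (t k n) (\<phi> k)) y)) = 0"
    and inner: "limsup (\<lambda>n. ereal (cmod (L2_inner (sym_group 0 (h j n) (\<xi> j n) (x j n) (t j n) (\<phi> j))
        (sym_group 0 (h k n) (\<xi> k n) (x k n) (t k n) (\<phi> k))))) = 0"
    if "j \<in> {1..N}" "k \<in> {1..N}" "j \<noteq> k" for j k
    using pd that by auto
  show ?thesis
    using assms(1,2)
  proof (cases rule: admissible_cases)
    case infinite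
    have "limsup (\<lambda>n. mixed_norm \<infinity> 2 (\<lambda>s y. \<Sum>j=1..N.
          schroedinger s (sym_group 0 (h j n) (\<xi> j n) (x j n) (t j n) (\<phi> j)) y) powr\<^sub>e 2)
      \<le> (\<Sum>j=1..N. mixed_norm \<infinity> 2 (\<lambda>s. schroedinger s (\<phi> j)) powr\<^sub>e 2)"
      by (rule limsup_mixed_norm_infinity_profiles_le) (use \<phi> h inner in auto)
    \<comment> \<open>For the pair (\<infinity>, 2) the second implication is vacuous, and the
      exponent in the first one is 2.\<close>
    moreover have "\<not> (\<infinity> :: ennreal) \<le> 2"
      by (metis ennreal_numeral ennreal_less_top infinity_ennreal_def not_le)
    ultimately show ?thesis using infinite by simp
  next
    case (finite q' r')
    have "limsup (\<lambda>n. mixed_norm q r (\<lambda>s y. \<Sum>j=1..N.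
          schroedinger s (sym_group 0 (h j n) (\<xi> j n) (x j n) (t j n) (\<phi> j)) y) powr\<^sub>e (min q' r'))
      \<le> (\<Sum>j=1..N. mixed_norm q r (\<lambda>s. schroedinger s (\<phi> j)) powr\<^sub>e (min q' r'))"
      unfolding finite(1,2)
      by (rule limsup_mixed_norm_profiles_le[OF _ _ finite(5) refl]) (use finite \<phi> h cross in auto)
    note main = this
    \<comment> \<open>The gauge estimate carries the exponent \<open>min q' r'\<close>, which is the
      exponent claimed in either case; at q = r the two cases agree.\<close>
    have r_le: "min q' r' = enn2real r" if "r \<le> q" using finite that by (auto simp: min_def ennreal_le_iff)
    have q_le: "min q' r' = enn2real q" if "q \<le> r" using finite that by (auto simp: min_def ennreal_le_iff)
    show ?thesis
    proof (intro conjI impI, goal_cases)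
      case 1
      show ?case using main unfolding r_le[OF 1] .
    next
      case 2
      show ?case using main unfolding q_le[OF 2] .
    qed
  qed
qed

end
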